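(* Let $q$ be a prime power, $n\ge 2$, and $V$ an $n$-dimensional $\mathbb{F}_q$-vector space. Then $\dim_{\mathbb{F}_q}Q^{q^{n-1}-n}(\mathrm{Sym}^*(V^* ))=(q-1)(q^2-1)\cdots(q^{n-1}-1)$.
   Context: $\mathrm{Sym}^*(V^* )\cong\mathbb{F}_q[x_1,\dots,x_n]$ with $\deg x_i=1$. The Steenrod algebra $\mathcal{P}$ over $\mathbb{F}_q$ is generated by operations $\mathcal{P}^i$ ($\mathcal{P}^0=1$) acting by $\mathcal{P}^j(x^m)=\binom{m}{j}x^{m+(q-1)j}$ for linear forms $x$ and the Cartan formula $\mathcal{P}^j(fg)=\sum_{i+l=j}\mathcal{P}^i(f)\mathcal{P}^l(g)$. $Q(M)=M/\mathcal{P}^+M$ with $\mathcal{P}^+$ the augmentation ideal, and $Q^i$ is its degree-$i$ part. *)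

theory Defs
  imports Complex_Main "HOL-Library.Poly_Mapping" "HOL-Library.Cardinality"
begin

(* Polynomials over a field 'a in the variables x_0, x_1, ...:
  a monomial is an exponent vector m :: nat =>0 nat (x_i has exponent Poly_Mapping.lookup m i),
  a polynomial is a finitely supported map from monomials to coefficients. *)

type_synonym 'a mpoly = "(nat \<Rightarrow>\<^sub>0 nat) \<Rightarrow>\<^sub>0 'a"

definition pscale :: "'a::field \<Rightarrow> 'a mpoly \<Rightarrow> 'a mpoly" where
  "pscale c p = Poly_Mapping.map ((*) c) p"

definition mdeg :: "(nat \<Rightarrow>\<^sub>0 nat) \<Rightarrow> nat" where
  "mdeg m = (\<Sum>i\<in>Poly_Mapping.keys m. Poly_Mapping.lookup m i)"

definition Sym :: "nat \<Rightarrow> nat \<Rightarrow> 'a::field mpoly set" where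
  "Sym n d = {p. \<forall>m\<in>Poly_Mapping.keys p. Poly_Mapping.keys m \<subseteq> {..<n} \<and> mdeg m = d}"

(* The Steenrod operation P^j over F_q: the unique linear operation with
  P^j(x_i^a) = (a choose j) x_i^(a+(q-1)j) on variables and satisfying the Cartan
  formula; on a monomial x^m it is
  sum over b \<le> m with |b| = j of (prod_i (m_i choose b_i)) x^(m+(q-1)b). *)
definition steenrod :: "nat \<Rightarrow> nat \<Rightarrow> 'a::field mpoly \<Rightarrow> 'a mpoly" where
  "steenrod q j p =
    (\<Sum>m\<in>Poly_Mapping.keys p. \<Sum>b\<in>{b. (\<forall>i. Poly_Mapping.lookup b i \<le> Poly_Mapping.lookup m i) \<and> mdeg b = j}.
       Poly_Mapping.single (m + Poly_Mapping.map ((*) (q - 1)) b)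
         (Poly_Mapping.lookup p m * of_nat (\<Prod>i\<in>Poly_Mapping.keys m. Poly_Mapping.lookup m i choose Poly_Mapping.lookup b i)))"

definition hit :: "nat \<Rightarrow> nat \<Rightarrow> nat \<Rightarrow> 'a::field mpoly set" where
  "hit q n d = module.span pscale
     (\<Union>i\<in>{i. 1 \<le> i \<and> (q - 1) * i \<le> d}. steenrod q i ` Sym n (d - (q - 1) * i))"

(* dim Q^d = dim (Sym^d / (P^+ Sym)^d) = dim Sym^d - dim (P^+ Sym)^d. *)
definition dimQ :: "'a::field itself \<Rightarrow> nat \<Rightarrow> nat \<Rightarrow> nat \<Rightarrow> nat" where
  "dimQ _ q n d = vector_space.dim (pscale :: 'a \<Rightarrow> 'a mpoly \<Rightarrow> 'a mpoly) (Sym n d)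
                 - vector_space.dim (pscale :: 'a \<Rightarrow> 'a mpoly \<Rightarrow> 'a mpoly) (hit q n d)"

end

(* Put n = m + 1, d = q^(m-1) - m and D = q^m - n, and induct on m: a basis h_1, ..., h_N of Sym m d
   modulo hits yields a basis of Sym n D modulo hits with (q^m - 1) N elements.

   Setting the last variable to 1 turns Sym n D into the polynomials of degree at most D in
   x_0, ..., x_(m-1).  With L_i = x_i^q - x_i, the total Steenrod operation becomes, up to powers of a
   unit series, the substitution x -> x + y L, and v(x + y L) = (1 - y)^d v(x) modulo hits, as far as
   the degrees allow.  Polynomials are spanned by the x^b h(L) with all b_i < q and h homogeneous, of
   degree j say.  If j < d, comparing the lowest term (1 - y)^j x^b h(L) of the substitution with
   (1 - y)^d x^b h(L) rewrites x^b h(L) through larger j.  If j > d, then x^b h(L) is a hit: invert the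
   substitution; the relevant coefficients of (1 - y)^(-m) times the inverse vanish by a recursion on
   base q digits.  So only j = d survives, where the degree bound excludes exactly one exponent b,
   namely b_i = q - 1 for all i, and h matters only modulo hits.

   Independence: L vanishes at every point c of F_q^m, so the degree d part of x^b h(L) expanded at c
   is (-1)^d c^b h(x).  Taking the degree d part at c maps hits to hits, and the monomial functions
   c^b with b_i < q are linearly independent on F_q^m. *)
theory Submission
  imports Defs "HOL-Computational_Algebra.Formal_Power_Series" "HOL-Computational_Algebra.Polynomial"
    "HOL-Library.FuncSet"
begin

text \<open>Write y for \<open>fps_X\<close>. The numerical fact behind everything is
  \<open>D + 1 = d + (q - 1) * Q\<close> with \<open>Q = q ^ (m - 1)\<close>. An operation P^l
  landing in degree D starts in degree M = D - (q - 1) l, so M - d = (q - 1)(Q - l) - 1, and for 0 <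
  l < Q the binomial coefficient of M - d over l is zero in the field. This one vanishing serves
  twice: it gives the congruence v(x + y L) = (1 - y)^d v(x), and it removes the only term that is
  not a hit from the degree d part at a rational point. The substitution arises from (x + y x^q) /
  (1 + y) = x + (y / (1 + y)) L. The obstacle is the factor (1 + y)^M in front of it: M changes with
  l, so hits never supply all coefficients of a single series. The congruence trades them for
  relations free of M. These relations can then be recombined with any other weight. The weight (1 +
  y)^d cancels the power of 1 - y exactly, and its coefficient of y^(q i) isolates (P^i h)(L); this
  is why h matters only modulo hits. As q is known only as the size of a field, Frobenius and Lucas
  are developed in base q directly, without the characteristic.\<close>

locale comm_ring_hom =
  fixes \<kappa> :: "'b::comm_ring_1 \<Rightarrow> 'c::comm_ring_1"
  assumes hom_one [simp]: "\<kappa> 1 = 1"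
    and hom_add: "\<kappa> (x + y) = \<kappa> x + \<kappa> y"
    and hom_mult: "\<kappa> (x * y) = \<kappa> x * \<kappa> y"
begin

lemma hom_zero [simp]: "\<kappa> 0 = 0"
  using hom_add[of 0 0] by simp

lemma hom_uminus: "\<kappa> (- x) = - \<kappa> x"
  using hom_add[of x "-x"] by (simp add: eq_neg_iff_add_eq_0 add.commute)

lemma hom_diff: "\<kappa> (x - y) = \<kappa> x - \<kappa> y"
  using hom_add[of x "-y"] by (simp add: hom_uminus)

lemma hom_sum: "\<kappa> (sum f S) = (\<Sum>x\<in>S. \<kappa> (f x))"
  by (induction S rule: infinite_finite_induct) (auto simp: hom_add)

lemma hom_prod: "\<kappa> (prod f S) = (\<Prod>x\<in>S. \<kappa> (f x))"
  by (induction S rule: infinite_finite_induct) (auto simp: hom_mult)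

lemma hom_power: "\<kappa> (x ^ n) = \<kappa> x ^ n"
  by (induction n) (auto simp: hom_mult)

lemma hom_of_nat: "\<kappa> (of_nat n) = of_nat n"
  by (induction n) (auto simp: hom_add)

lemmas homs = hom_add hom_mult hom_uminus hom_diff hom_sum hom_prod hom_power hom_of_nat

end

lemma comm_ring_hom_comp:
  assumes "comm_ring_hom f" "comm_ring_hom g"
  shows "comm_ring_hom (\<lambda>x. f (g x))"
proof -
  interpret f: comm_ring_hom f by fact
  interpret g: comm_ring_hom g by fact
  show ?thesis by unfold_locales (simp_all add: f.homs g.homs)
qed

lemma comm_ring_hom_fps_const: "comm_ring_hom (fps_const :: 'a::comm_ring_1 \<Rightarrow> 'a fps)"
  by unfold_locales simp_all

section \<open>Polynomials and their evaluation\<close>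

abbreviation Con :: "'a::zero \<Rightarrow> 'a mpoly" where
  "Con c \<equiv> Poly_Mapping.single 0 c"

definition Var :: "nat \<Rightarrow> 'a::zero_neq_one mpoly" where
  "Var i = Poly_Mapping.single (Poly_Mapping.single i 1) 1"

definition mono_ev :: "(nat \<Rightarrow> 'b::comm_ring_1) \<Rightarrow> (nat \<Rightarrow>\<^sub>0 nat) \<Rightarrow> 'b" where
  "mono_ev \<sigma> m = (\<Prod>i\<in>Poly_Mapping.keys m. \<sigma> i ^ Poly_Mapping.lookup m i)"

text \<open>The coefficient map is a parameter so that one notion covers substitutions with values
  in polynomials and in power series over them.\<close>

definition ev :: "('a::comm_ring_1 \<Rightarrow> 'b::comm_ring_1) \<Rightarrow> (nat \<Rightarrow> 'b) \<Rightarrow> 'a mpoly \<Rightarrow> 'b" where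
  "ev \<kappa> \<sigma> p = (\<Sum>m\<in>Poly_Mapping.keys p. \<kappa> (Poly_Mapping.lookup p m) * mono_ev \<sigma> m)"

lemma comm_ring_hom_Con: "comm_ring_hom (Con :: 'a::comm_ring_1 \<Rightarrow> _)"
  by unfold_locales (simp_all add: single_add mult_single)

interpretation Con: comm_ring_hom Con
  by (rule comm_ring_hom_Con)

lemma comm_ring_hom_fps_Con: "comm_ring_hom (\<lambda>c::'a::comm_ring_1. fps_const (Con c))"
  by (rule comm_ring_hom_comp[OF comm_ring_hom_fps_const comm_ring_hom_Con])

lemma lookup_Con_mult: "Poly_Mapping.lookup (Con c * p) m = c * Poly_Mapping.lookup p m"
  for c :: "'a::comm_ring_1"
  by (subst mult_map_scale_conv_mult[symmetric], subst map.rep_eq) (auto simp: when_def)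

lemma pscale_eq: "pscale c p = Con c * p"
  by (simp add: pscale_def mult_map_scale_conv_mult)

lemma mono_ev_superset:
  assumes "finite S" "Poly_Mapping.keys m \<subseteq> S"
  shows "mono_ev \<sigma> m = (\<Prod>i\<in>S. \<sigma> i ^ Poly_Mapping.lookup m i)"
  unfolding mono_ev_def
  by (rule prod.mono_neutral_left) (use assms in \<open>auto simp: in_keys_iff\<close>)

lemma mono_ev_0 [simp]: "mono_ev \<sigma> 0 = 1"
  by (simp add: mono_ev_def)

lemma mono_ev_add: "mono_ev \<sigma> (m + n) = mono_ev \<sigma> m * mono_ev \<sigma> n"
proof -
  let ?S = "Poly_Mapping.keys m \<union> Poly_Mapping.keys n"
  have "Poly_Mapping.keys (m + n) \<subseteq> ?S" by (rule keys_add)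
  then show ?thesis
    by (simp add: mono_ev_superset[of ?S] lookup_add power_add prod.distrib)
qed

lemma mono_ev_single [simp]: "mono_ev \<sigma> (Poly_Mapping.single i k) = \<sigma> i ^ k"
  by (simp add: mono_ev_def)

lemma mpoly_eq_sum_single:
  "p = (\<Sum>m\<in>Poly_Mapping.keys p. Poly_Mapping.single m (Poly_Mapping.lookup p m))"
  by (rule poly_mapping_eqI) (auto simp: lookup_sum lookup_single when_def in_keys_iff)

lemma mpoly_induct [case_names single add]:
  assumes s: "\<And>m c. m \<in> Poly_Mapping.keys p \<Longrightarrow> P (Poly_Mapping.single m c)"
    and a: "\<And>p q. P p \<Longrightarrow> P q \<Longrightarrow> P (p + q)"
    and z: "P 0"
  shows "P (p :: 'a::comm_monoid_add mpoly)"
proof -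
  have "P (\<Sum>m\<in>S. Poly_Mapping.single m (Poly_Mapping.lookup p m))"
    if "S \<subseteq> Poly_Mapping.keys p" for S
    using finite_subset[OF that finite_keys] that
    by (induction S rule: finite_induct) (auto intro!: s a z)
  from this[OF order_refl] show ?thesis by (simp flip: mpoly_eq_sum_single)
qed

lemma sum_keys_superset:
  assumes "finite S" "Poly_Mapping.keys p \<subseteq> S" "\<And>m. F m 0 = 0"
  shows "(\<Sum>m\<in>Poly_Mapping.keys p. F m (Poly_Mapping.lookup p m)) = (\<Sum>m\<in>S. F m (Poly_Mapping.lookup p m))"
  by (rule sum.mono_neutral_left) (use assms in \<open>auto simp: in_keys_iff\<close>)

lemma sum_keys_add:
  assumes "\<And>m. F m 0 = 0" "\<And>m a b. F m (a + b) = F m a + F m b"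
  shows "(\<Sum>m\<in>Poly_Mapping.keys (p + q). F m (Poly_Mapping.lookup (p + q) m)) =
    (\<Sum>m\<in>Poly_Mapping.keys p. F m (Poly_Mapping.lookup p m)) + (\<Sum>m\<in>Poly_Mapping.keys q. F m (Poly_Mapping.lookup q m))"
proof -
  let ?S = "Poly_Mapping.keys p \<union> Poly_Mapping.keys q"
  have "Poly_Mapping.keys (p + q) \<subseteq> ?S" by (rule keys_add)
  then have "(\<Sum>m\<in>Poly_Mapping.keys (p + q). F m (Poly_Mapping.lookup (p + q) m)) =
      (\<Sum>m\<in>?S. F m (Poly_Mapping.lookup (p + q) m))"
    by (intro sum_keys_superset) (simp_all add: assms)
  then show ?thesis
    by (simp add: sum_keys_superset[of ?S p F] sum_keys_superset[of ?S q F] assms lookup_add sum.distrib)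
qed

context comm_ring_hom
begin

lemma ev_0 [simp]: "ev \<kappa> \<sigma> 0 = 0"
  by (simp add: ev_def)

lemma ev_single: "ev \<kappa> \<sigma> (Poly_Mapping.single m c) = \<kappa> c * mono_ev \<sigma> m"
  by (simp add: ev_def)

lemma ev_add: "ev \<kappa> \<sigma> (p + q) = ev \<kappa> \<sigma> p + ev \<kappa> \<sigma> q"
  unfolding ev_def by (rule sum_keys_add) (simp_all add: homs algebra_simps)

lemma ev_mult_single: "ev \<kappa> \<sigma> (Poly_Mapping.single m c * q) = ev \<kappa> \<sigma> (Poly_Mapping.single m c) * ev \<kappa> \<sigma> q"
proof (induction q rule: mpoly_induct)
  case (single m' c')
  then show ?case by (simp add: mult_single ev_single mono_ev_add homs mult_ac)
qed (simp_all add: distrib_left ev_add)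

lemma ev_mult: "ev \<kappa> \<sigma> (p * q) = ev \<kappa> \<sigma> p * ev \<kappa> \<sigma> q"
  by (induction p rule: mpoly_induct) (simp_all add: ev_mult_single distrib_right ev_add)

lemma comm_ring_hom_ev: "comm_ring_hom (ev \<kappa> \<sigma>)"
proof
  show "ev \<kappa> \<sigma> 1 = 1"
    using ev_single[of \<sigma> 0 1] by simp
qed (simp_all add: ev_add ev_mult)

lemma ev_Con [simp]: "ev \<kappa> \<sigma> (Con c) = \<kappa> c"
  by (simp add: ev_single)

lemma ev_Var [simp]: "ev \<kappa> \<sigma> (Var i) = \<sigma> i"
  by (simp add: ev_single Var_def)

lemma hom_mono_ev: "\<kappa> (mono_ev \<sigma> m) = mono_ev (\<lambda>i. \<kappa> (\<sigma> i)) m"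
  by (simp add: mono_ev_def homs)

end

lemma hom_ev:
  assumes "comm_ring_hom \<psi>"
  shows "\<psi> (ev \<kappa> \<sigma> p) = ev (\<lambda>c. \<psi> (\<kappa> c)) (\<lambda>i. \<psi> (\<sigma> i)) p"
proof -
  interpret comm_ring_hom \<psi> by fact
  show ?thesis by (simp add: ev_def homs hom_mono_ev)
qed

lemma mono_ev_cong:
  "(\<And>i. i \<in> Poly_Mapping.keys m \<Longrightarrow> \<sigma> i = \<tau> i) \<Longrightarrow> mono_ev \<sigma> m = mono_ev \<tau> m"
  unfolding mono_ev_def by (rule prod.cong) simp_all

lemma mono_ev_Var: "mono_ev Var m = (Poly_Mapping.single m 1 :: 'a::comm_ring_1 mpoly)"
proof -
  have pow: "Var i ^ k = (Poly_Mapping.single (Poly_Mapping.single i k) 1 :: 'a mpoly)" for i k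
    by (induction k) (simp_all add: Var_def mult_single flip: single_add)
  have "finite S \<Longrightarrow> (\<Prod>i\<in>S. Var i ^ Poly_Mapping.lookup m i) =
      (Poly_Mapping.single (\<Sum>i\<in>S. Poly_Mapping.single i (Poly_Mapping.lookup m i)) 1 :: 'a mpoly)" for S
    by (induction S rule: finite_induct) (simp_all add: pow mult_single)
  moreover have "m = (\<Sum>i\<in>Poly_Mapping.keys m. Poly_Mapping.single i (Poly_Mapping.lookup m i))"
    by (rule poly_mapping_eqI) (auto simp: lookup_sum lookup_single when_def in_keys_iff)
  ultimately show ?thesis by (simp add: mono_ev_def)
qed

lemma ev_Con_Var [simp]: "ev Con Var p = p"
proof -
  have "ev Con Var p = (\<Sum>m\<in>Poly_Mapping.keys p. Poly_Mapping.single m (Poly_Mapping.lookup p m))"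
    by (simp add: ev_def mono_ev_Var mult_single)
  then show ?thesis by (simp flip: mpoly_eq_sum_single)
qed

section \<open>Polarisation\<close>

text \<open>The coefficient of \<open>A\<^sup>d\<^sup>-\<^sup>g B\<^sup>g\<close> in the monomial \<open>(A u + B w)\<^sup>m\<close>, where \<open>d = mdeg m\<close>.\<close>

definition mono_polar :: "nat \<Rightarrow> (nat \<Rightarrow> 'b::comm_ring_1) \<Rightarrow> (nat \<Rightarrow> 'b) \<Rightarrow> (nat \<Rightarrow>\<^sub>0 nat) \<Rightarrow> 'b" where
  "mono_polar g u w m =
    (\<Sum>\<gamma> | \<gamma> \<in> (\<Pi>\<^sub>E i\<in>Poly_Mapping.keys m. {..Poly_Mapping.lookup m i}) \<and> sum \<gamma> (Poly_Mapping.keys m) = g.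
      \<Prod>i\<in>Poly_Mapping.keys m. of_nat (Poly_Mapping.lookup m i choose \<gamma> i) * u i ^ (Poly_Mapping.lookup m i - \<gamma> i) * w i ^ \<gamma> i)"

definition polar :: "('a::comm_ring_1 \<Rightarrow> 'b::comm_ring_1) \<Rightarrow> nat \<Rightarrow> (nat \<Rightarrow> 'b) \<Rightarrow> (nat \<Rightarrow> 'b) \<Rightarrow> 'a mpoly \<Rightarrow> 'b" where
  "polar \<kappa> g u w p = (\<Sum>m\<in>Poly_Mapping.keys p. \<kappa> (Poly_Mapping.lookup p m) * mono_polar g u w m)"

lemma prod_add_power:
  fixes a b :: "'i \<Rightarrow> 'b::comm_ring_1"
  assumes "finite I"
  shows "(\<Prod>i\<in>I. (a i + b i) ^ m i) =
    (\<Sum>\<gamma>\<in>(\<Pi>\<^sub>E i\<in>I. {..m i}). \<Prod>i\<in>I. of_nat (m i choose \<gamma> i) * a i ^ (m i - \<gamma> i) * b i ^ \<gamma> i)"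
proof -
  have "(a i + b i) ^ m i = (\<Sum>k\<in>{..m i}. of_nat (m i choose k) * a i ^ (m i - k) * b i ^ k)" for i
    using binomial_ring[of "b i" "a i" "m i"] by (simp add: mult_ac add.commute)
  then show ?thesis
    by (simp add: prod_sum_PiE assms)
qed

lemma mono_ev_combination:
  "mono_ev (\<lambda>i. A * u i + B * w i) m =
    (\<Sum>g\<le>mdeg m. A ^ (mdeg m - g) * B ^ g * mono_polar g u w m)"
proof -
  let ?K = "Poly_Mapping.keys m" and ?l = "Poly_Mapping.lookup m"
  let ?P = "\<Pi>\<^sub>E i\<in>?K. {..?l i}"
  let ?f = "\<lambda>\<gamma>. \<Prod>i\<in>?K. of_nat (?l i choose \<gamma> i) * u i ^ (?l i - \<gamma> i) * w i ^ \<gamma> i"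
  have fin: "finite ?P" by (intro finite_PiE) auto
  have le: "sum \<gamma> ?K \<le> mdeg m" if "\<gamma> \<in> ?P" for \<gamma>
    unfolding mdeg_def using that by (intro sum_mono) auto
  have step: "(\<Prod>i\<in>?K. of_nat (?l i choose \<gamma> i) * (A * u i) ^ (?l i - \<gamma> i) * (B * w i) ^ \<gamma> i)
      = A ^ (mdeg m - sum \<gamma> ?K) * B ^ sum \<gamma> ?K * ?f \<gamma>" if "\<gamma> \<in> ?P" for \<gamma>
  proof -
    have "(\<Sum>i\<in>?K. ?l i - \<gamma> i) = mdeg m - sum \<gamma> ?K"
      unfolding mdeg_def using that by (intro sum_subtractf_nat) auto
    then show ?thesis
      by (simp add: power_mult_distrib prod.distrib mult_ac flip: power_sum)
  qed
  have "mono_ev (\<lambda>i. A * u i + B * w i) m = (\<Sum>\<gamma>\<in>?P. A ^ (mdeg m - sum \<gamma> ?K) * B ^ sum \<gamma> ?K * ?f \<gamma>)"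
    unfolding mono_ev_def by (subst prod_add_power) (auto intro!: sum.cong step)
  also have "\<dots> = (\<Sum>g\<le>mdeg m. \<Sum>\<gamma> | \<gamma> \<in> ?P \<and> sum \<gamma> ?K = g. A ^ (mdeg m - sum \<gamma> ?K) * B ^ sum \<gamma> ?K * ?f \<gamma>)"
    by (rule sum.group[symmetric]) (use fin le in auto)
  also have "\<dots> = (\<Sum>g\<le>mdeg m. A ^ (mdeg m - g) * B ^ g * mono_polar g u w m)"
    by (intro sum.cong refl) (simp add: mono_polar_def sum_distrib_left)
  finally show ?thesis .
qed

lemma mono_polar_eq_0: "mdeg m < g \<Longrightarrow> mono_polar g u w m = 0"
proof -
  assume "mdeg m < g"
  moreover have "sum \<gamma> (Poly_Mapping.keys m) \<le> mdeg m"
    if "\<gamma> \<in> (\<Pi>\<^sub>E i\<in>Poly_Mapping.keys m. {..Poly_Mapping.lookup m i})" for \<gamma>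
    unfolding mdeg_def using that by (intro sum_mono) auto
  ultimately have "{\<gamma>. \<gamma> \<in> (\<Pi>\<^sub>E i\<in>Poly_Mapping.keys m. {..Poly_Mapping.lookup m i}) \<and> sum \<gamma> (Poly_Mapping.keys m) = g} = {}"
    by (auto simp: not_less[symmetric])
  then show ?thesis unfolding mono_polar_def by (simp only: sum.empty)
qed

text \<open>Homogeneity fixes the power of A that accompanies each power of B. The pairs (1 - y,
  y^q) and (-1, 1) will both expand h(L) into Steenrod operations on h.\<close>

lemma ev_combination:
  assumes p: "\<And>m. m \<in> Poly_Mapping.keys p \<Longrightarrow> mdeg m = e"
  shows "ev \<kappa> (\<lambda>i. A * u i + B * w i) p = (\<Sum>g\<le>e. A ^ (e - g) * B ^ g * polar \<kappa> g u w p)"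
proof -
  have "ev \<kappa> (\<lambda>i. A * u i + B * w i) p
      = (\<Sum>m\<in>Poly_Mapping.keys p. \<Sum>g\<le>e. A ^ (e - g) * B ^ g * (\<kappa> (Poly_Mapping.lookup p m) * mono_polar g u w m))"
    unfolding ev_def by (intro sum.cong refl) (simp add: mono_ev_combination p sum_distrib_left mult_ac)
  also have "\<dots> = (\<Sum>g\<le>e. A ^ (e - g) * B ^ g * polar \<kappa> g u w p)"
    unfolding polar_def by (subst sum.swap) (simp add: sum_distrib_left)
  finally show ?thesis .
qed

lemma ev_translate:
  assumes p: "\<And>m. m \<in> Poly_Mapping.keys p \<Longrightarrow> mdeg m \<le> e"
  shows "ev \<kappa> (\<lambda>i. u i + B * w i) p = (\<Sum>g\<le>e. B ^ g * polar \<kappa> g u w p)"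
proof -
  have "mono_ev (\<lambda>i. u i + B * w i) m = (\<Sum>g\<le>e. B ^ g * mono_polar g u w m)" if "m \<in> Poly_Mapping.keys p" for m
  proof -
    have "mono_ev (\<lambda>i. u i + B * w i) m = (\<Sum>g\<le>mdeg m. B ^ g * mono_polar g u w m)"
      using mono_ev_combination[of 1 u B w m] by simp
    also have "\<dots> = (\<Sum>g\<le>e. B ^ g * mono_polar g u w m)"
      by (rule sum.mono_neutral_left) (use p[OF that] in \<open>auto simp: mono_polar_eq_0\<close>)
    finally show ?thesis .
  qed
  then have "ev \<kappa> (\<lambda>i. u i + B * w i) p
      = (\<Sum>m\<in>Poly_Mapping.keys p. \<Sum>g\<le>e. B ^ g * (\<kappa> (Poly_Mapping.lookup p m) * mono_polar g u w m))"
    unfolding ev_def by (intro sum.cong refl) (simp add: sum_distrib_left mult_ac)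
  also have "\<dots> = (\<Sum>g\<le>e. B ^ g * polar \<kappa> g u w p)"
    unfolding polar_def by (subst sum.swap) (simp add: sum_distrib_left)
  finally show ?thesis .
qed

lemma hom_polar:
  assumes "comm_ring_hom \<psi>"
  shows "\<psi> (polar \<kappa> g u w p) = polar (\<lambda>c. \<psi> (\<kappa> c)) g (\<lambda>i. \<psi> (u i)) (\<lambda>i. \<psi> (w i)) p"
proof -
  interpret comm_ring_hom \<psi> by fact
  show ?thesis by (simp add: polar_def mono_polar_def homs)
qed

context comm_ring_hom
begin

lemma polar_add: "polar \<kappa> g u w (p + q) = polar \<kappa> g u w p + polar \<kappa> g u w q"
  unfolding polar_def by (rule sum_keys_add) (simp_all add: homs algebra_simps)

lemma polar_0 [simp]: "polar \<kappa> g u w 0 = 0"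
  by (simp add: polar_def)

end

text \<open>The total operation is the substitution x -> x + y x^q, so P^j is the part of degree j
  in x^q of the polarisation. The exponent vectors b in \<open>steenrod\<close> correspond to the
  extensional functions in \<open>mono_polar\<close>, and m + (q - 1) k = (m - k) + q k matches the
  powers.\<close>

lemma ev_steenrod:
  fixes p :: "'a::field mpoly"
  assumes "comm_ring_hom \<kappa>" "q > 0"
  shows "ev \<kappa> u (steenrod q j p) = polar \<kappa> j u (\<lambda>i. u i ^ q) p"
proof -
  interpret comm_ring_hom \<kappa> by fact
  interpret e: comm_ring_hom "ev \<kappa> u" by (rule comm_ring_hom_ev)
  define R where "R m = {b. (\<forall>i. Poly_Mapping.lookup b i \<le> Poly_Mapping.lookup m i) \<and> mdeg b = j}" for m
  define unlk where "unlk m \<gamma> = (\<Sum>i\<in>Poly_Mapping.keys m. Poly_Mapping.single i (\<gamma> i))"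
    for m :: "nat \<Rightarrow>\<^sub>0 nat" and \<gamma> :: "nat \<Rightarrow> nat"
  have lb: "Poly_Mapping.lookup (unlk m \<gamma>) i = (if i \<in> Poly_Mapping.keys m then \<gamma> i else 0)" for m \<gamma> i
    by (simp add: unlk_def lookup_sum lookup_single when_def)
  have key: "(\<Sum>b\<in>R m. mono_ev u (m + Poly_Mapping.map ((*) (q - 1)) b) *
      of_nat (\<Prod>i\<in>Poly_Mapping.keys m. Poly_Mapping.lookup m i choose Poly_Mapping.lookup b i))
      = mono_polar j u (\<lambda>i. u i ^ q) m" for m
    unfolding mono_polar_def
  proof (rule sum.reindex_bij_witness[where j = "\<lambda>b. restrict (Poly_Mapping.lookup b) (Poly_Mapping.keys m)" and i = "unlk m"])
    let ?K = "Poly_Mapping.keys m" and ?l = "Poly_Mapping.lookup m"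
    have sub: "Poly_Mapping.keys b \<subseteq> ?K" if "b \<in> R m" for b
    proof
      fix i assume "i \<in> Poly_Mapping.keys b"
      then have "Poly_Mapping.lookup b i > 0" by (simp add: in_keys_iff)
      moreover have "Poly_Mapping.lookup b i \<le> ?l i" using that by (simp add: R_def)
      ultimately show "i \<in> ?K" by (simp add: in_keys_iff)
    qed
    have md: "mdeg b = (\<Sum>i\<in>?K. Poly_Mapping.lookup b i)" if "Poly_Mapping.keys b \<subseteq> ?K" for b
      unfolding mdeg_def by (rule sum.mono_neutral_left) (use that in \<open>auto simp: in_keys_iff\<close>)
    fix b assume b: "b \<in> R m"
    show "restrict (Poly_Mapping.lookup b) ?K \<in> {\<gamma>. \<gamma> \<in> (\<Pi>\<^sub>E i\<in>?K. {..?l i}) \<and> sum \<gamma> ?K = j}"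
      using b md[OF sub[OF b]] by (auto simp: R_def)
    show "unlk m (restrict (Poly_Mapping.lookup b) ?K) = b"
      using sub[OF b] by (intro poly_mapping_eqI) (auto simp: lb in_keys_iff)
    have km: "Poly_Mapping.keys (m + Poly_Mapping.map ((*) (q - 1)) b) \<subseteq> ?K"
      proof -
      have "Poly_Mapping.keys (Poly_Mapping.map ((*) (q - 1)) b) \<subseteq> Poly_Mapping.keys b"
        by (auto simp: in_keys_iff map.rep_eq when_def split: if_splits)
      then show ?thesis using keys_add[of m "Poly_Mapping.map ((*) (q - 1)) b"] sub[OF b] by blast
    qed
    have ex: "?l i + (q - 1) * k = (?l i - k) + q * k" if "k \<le> ?l i" for i k
      using that assms(2) by (cases q) auto
    show "(\<Prod>i\<in>?K. of_nat (?l i choose restrict (Poly_Mapping.lookup b) ?K i) * u i ^ (?l i - restrict (Poly_Mapping.lookup b) ?K i) *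
         (u i ^ q) ^ restrict (Poly_Mapping.lookup b) ?K i) =
      mono_ev u (m + Poly_Mapping.map ((*) (q - 1)) b) * of_nat (\<Prod>i\<in>?K. ?l i choose Poly_Mapping.lookup b i)"
      unfolding mono_ev_superset[OF finite_keys km] of_nat_prod prod.distrib[symmetric]
    proof (rule prod.cong[OF refl])
      fix i assume i: "i \<in> ?K"
      have "Poly_Mapping.lookup (m + Poly_Mapping.map ((*) (q - 1)) b) i = ?l i + (q - 1) * Poly_Mapping.lookup b i"
        by (simp add: lookup_add map.rep_eq when_def)
      also have "\<dots> = (?l i - Poly_Mapping.lookup b i) + q * Poly_Mapping.lookup b i"
        by (rule ex) (use b in \<open>simp add: R_def\<close>)
      finally show "of_nat (?l i choose restrict (Poly_Mapping.lookup b) ?K i) * u i ^ (?l i - restrict (Poly_Mapping.lookup b) ?K i) *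
         (u i ^ q) ^ restrict (Poly_Mapping.lookup b) ?K i =
         u i ^ Poly_Mapping.lookup (m + Poly_Mapping.map ((*) (q - 1)) b) i * of_nat (?l i choose Poly_Mapping.lookup b i)"
        using i by (simp add: power_add power_mult mult_ac)
    qed
  next
    let ?K = "Poly_Mapping.keys m" and ?l = "Poly_Mapping.lookup m"
    fix \<gamma> assume g: "\<gamma> \<in> {\<gamma>. \<gamma> \<in> (\<Pi>\<^sub>E i\<in>?K. {..?l i}) \<and> sum \<gamma> ?K = j}"
    have sub: "Poly_Mapping.keys (unlk m \<gamma>) \<subseteq> ?K"
      by (auto simp: in_keys_iff lb split: if_splits)
    have "mdeg (unlk m \<gamma>) = (\<Sum>i\<in>?K. Poly_Mapping.lookup (unlk m \<gamma>) i)"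
      unfolding mdeg_def by (rule sum.mono_neutral_left) (use sub in \<open>auto simp: in_keys_iff\<close>)
    also have "\<dots> = sum \<gamma> ?K" by (rule sum.cong) (simp_all add: lb)
    finally show "unlk m \<gamma> \<in> R m"
      using g by (auto simp: R_def lb)
    show "restrict (Poly_Mapping.lookup (unlk m \<gamma>)) ?K = \<gamma>"
      using g by (auto simp: lb fun_eq_iff PiE_def extensional_def)
  qed
  show ?thesis
    unfolding steenrod_def R_def[symmetric] polar_def
    by (simp add: e.hom_sum ev_single key[symmetric] sum_distrib_left homs mult_ac
        del: of_nat_prod mult_cancel_left)
qed

section \<open>Graded pieces\<close>

interpretation mp: vector_space "pscale :: 'a::field \<Rightarrow> 'a mpoly \<Rightarrow> 'a mpoly"
  by unfold_locales (simp_all add: pscale_eq distrib_left distrib_right mult.assoc single_add mult_single flip: mult.assoc)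

lemma subspace_Con: "mp.subspace S \<Longrightarrow> x \<in> S \<Longrightarrow> Con c * x \<in> S"
  using mp.subspace_scale[of S x c] by (simp add: pscale_eq)

lemma subspaceI:
  assumes "0 \<in> S" "\<And>x y. x \<in> S \<Longrightarrow> y \<in> S \<Longrightarrow> x + y \<in> S" "\<And>c x. x \<in> S \<Longrightarrow> Con c * x \<in> S"
  shows "mp.subspace S"
  using assms by (auto simp: mp.subspace_def pscale_eq)

lemma mdeg_superset:
  assumes "finite S" "Poly_Mapping.keys m \<subseteq> S"
  shows "mdeg m = (\<Sum>i\<in>S. Poly_Mapping.lookup m i)"
  unfolding mdeg_def by (rule sum.mono_neutral_left) (use assms in \<open>auto simp: in_keys_iff\<close>)

lemma mdeg_add: "mdeg (a + b) = mdeg a + mdeg b"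
proof -
  let ?S = "Poly_Mapping.keys a \<union> Poly_Mapping.keys b"
  have "Poly_Mapping.keys (a + b) \<subseteq> ?S" by (rule keys_add)
  then show ?thesis by (simp add: mdeg_superset[of ?S] lookup_add sum.distrib)
qed

lemma mdeg_0 [simp]: "mdeg 0 = 0"
  by (simp add: mdeg_def)

lemma mdeg_single [simp]: "mdeg (Poly_Mapping.single i k) = k"
  by (simp add: mdeg_def)

lemma keys_add_nat: "Poly_Mapping.keys (a + b) = Poly_Mapping.keys a \<union> Poly_Mapping.keys (b :: nat \<Rightarrow>\<^sub>0 nat)"
  by (auto simp: in_keys_iff lookup_add)

text \<open>Common form of \<open>Sym\<close>, \<open>Pol\<close>, \<open>Ord\<close> and
  \<open>Low\<close>: conditions on monomials give subspaces, and products are controlled by adding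
  exponents.\<close>

definition supported :: "((nat \<Rightarrow>\<^sub>0 nat) \<Rightarrow> bool) \<Rightarrow> 'a::field mpoly set" where
  "supported R = {p. \<forall>k\<in>Poly_Mapping.keys p. R k}"

lemma subspace_supported: "mp.subspace (supported R)"
proof (rule subspaceI)
  show "x + y \<in> supported R" if "x \<in> supported R" "y \<in> supported R" for x y :: "'a mpoly"
    using that keys_add[of x y] by (auto simp: supported_def)
  show "Con c * x \<in> supported R" if "x \<in> supported R" for c and x :: "'a mpoly"
    using that by (auto simp: supported_def in_keys_iff lookup_Con_mult)
qed (simp add: supported_def)

lemma supported_mult:
  assumes "x \<in> supported R" "y \<in> supported S" "\<And>a b. R a \<Longrightarrow> S b \<Longrightarrow> T (a + b)"
  shows "x * y \<in> supported T"
  using assms keys_mult[of x y] by (fastforce simp: supported_def)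

lemma single_supported: "R k \<Longrightarrow> Poly_Mapping.single k c \<in> supported R"
  by (simp add: supported_def)

definition Pol :: "nat \<Rightarrow> nat \<Rightarrow> 'a::field mpoly set" where
  "Pol m e = supported (\<lambda>k. Poly_Mapping.keys k \<subseteq> {..<m} \<and> mdeg k \<le> e)"

lemma Sym_eq: "Sym m e = supported (\<lambda>k. Poly_Mapping.keys k \<subseteq> {..<m} \<and> mdeg k = e)"
  by (simp add: Sym_def supported_def)

lemma subspace_Pol: "mp.subspace (Pol m e)"
  unfolding Pol_def by (rule subspace_supported)

lemma subspace_Sym: "mp.subspace (Sym m e)"
  unfolding Sym_eq by (rule subspace_supported)

lemma Sym_subset_Pol: "Sym m e \<subseteq> Pol m e"
  by (auto simp: Sym_eq Pol_def supported_def)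

lemma Pol_mono: "e \<le> e' \<Longrightarrow> Pol m e \<subseteq> Pol m e'"
  by (fastforce simp: Pol_def supported_def)

lemma Pol_mult: "x \<in> Pol m a \<Longrightarrow> y \<in> Pol m b \<Longrightarrow> x * y \<in> Pol m (a + b)"
  unfolding Pol_def by (erule (1) supported_mult) (auto simp: keys_add_nat mdeg_add)

lemma Sym_mult: "x \<in> Sym m a \<Longrightarrow> y \<in> Sym m b \<Longrightarrow> x * y \<in> Sym m (a + b)"
  unfolding Sym_eq by (erule (1) supported_mult) (auto simp: keys_add_nat mdeg_add)

lemma Con_Sym: "Con c \<in> Sym m 0"
  unfolding Sym_eq by (rule single_supported) simp

lemma one_Sym: "1 \<in> Sym m 0"
  using Con_Sym[of 1 m] by simp

lemma Var_Sym: "i < m \<Longrightarrow> Var i \<in> Sym m 1"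
  unfolding Sym_eq Var_def by (rule single_supported) simp

lemma Sym_power: "x \<in> Sym m a \<Longrightarrow> x ^ k \<in> Sym m (a * k)"
  by (induction k) (simp_all add: one_Sym Sym_mult)

lemma Pol_power: "x \<in> Pol m a \<Longrightarrow> x ^ k \<in> Pol m (a * k)"
proof (induction k)
  case 0
  then show ?case using one_Sym[of m] Sym_subset_Pol[of m 0] by auto
qed (simp_all add: Pol_mult)

lemma Sym_prod: "finite I \<Longrightarrow> (\<And>i. i \<in> I \<Longrightarrow> f i \<in> Sym m (a i)) \<Longrightarrow> prod f I \<in> Sym m (sum a I)"
  by (induction I rule: finite_induct) (simp_all add: one_Sym Sym_mult)

lemma Pol_prod: "finite I \<Longrightarrow> (\<And>i. i \<in> I \<Longrightarrow> f i \<in> Pol m (a i)) \<Longrightarrow> prod f I \<in> Pol m (sum a I)"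
proof (induction I rule: finite_induct)
  case empty
  then show ?case using one_Sym[of m] Sym_subset_Pol[of m 0] by auto
qed (simp_all add: Pol_mult)

lemma Pol_ev:
  assumes p: "p \<in> Pol m e" and \<sigma>: "\<And>i. i < m \<Longrightarrow> \<sigma> i \<in> Pol m' k"
  shows "ev Con \<sigma> p \<in> Pol m' (k * e)"
  unfolding ev_def
proof (rule mp.subspace_sum[OF subspace_Pol])
  fix x assume x: "x \<in> Poly_Mapping.keys p"
  then have x': "Poly_Mapping.keys x \<subseteq> {..<m}" "mdeg x \<le> e"
    using p by (auto simp: Pol_def supported_def)
  have "mono_ev \<sigma> x \<in> Pol m' (\<Sum>i\<in>Poly_Mapping.keys x. k * Poly_Mapping.lookup x i)"
    unfolding mono_ev_def by (intro Pol_prod Pol_power \<sigma>) (use x' in auto)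
  also have "(\<Sum>i\<in>Poly_Mapping.keys x. k * Poly_Mapping.lookup x i) = k * mdeg x"
    by (simp add: mdeg_def sum_distrib_left)
  finally show "Con (Poly_Mapping.lookup p x) * mono_ev \<sigma> x \<in> Pol m' (k * e)"
    using Pol_mono[of "k * mdeg x" "k * e" m'] x' by (intro subspace_Con subspace_Pol) auto
qed

section \<open>Homogeneous components and the filtration by order at the origin\<close>

definition hpart :: "nat \<Rightarrow> 'a::comm_ring_1 mpoly \<Rightarrow> 'a mpoly" where
  "hpart e p = (\<Sum>k\<in>Poly_Mapping.keys p. Poly_Mapping.single k (Poly_Mapping.lookup p k when mdeg k = e))"

lemma lookup_hpart: "Poly_Mapping.lookup (hpart e p) k = (Poly_Mapping.lookup p k when mdeg k = e)"
  by (auto simp: hpart_def lookup_sum lookup_single when_def in_keys_iff)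

lemma hpart_add: "hpart e (p + q) = hpart e p + hpart e q"
  by (rule poly_mapping_eqI) (simp add: lookup_hpart lookup_add when_def)

lemma hpart_0 [simp]: "hpart e 0 = 0"
  by (rule poly_mapping_eqI) (simp add: lookup_hpart)

lemma hpart_sum: "hpart e (sum f S) = (\<Sum>x\<in>S. hpart e (f x))"
  by (induction S rule: infinite_finite_induct) (simp_all add: hpart_add)

lemma hpart_Con_mult: "hpart e (Con c * p) = Con c * hpart e p"
  by (rule poly_mapping_eqI) (simp add: lookup_hpart lookup_Con_mult when_def)

lemma hpart_Sym: "p \<in> Sym m e \<Longrightarrow> hpart e p = p"
  by (rule poly_mapping_eqI) (auto simp: lookup_hpart when_def Sym_def in_keys_iff)

lemma hpart_Sym_ne: "p \<in> Sym m e \<Longrightarrow> e \<noteq> e' \<Longrightarrow> hpart e' p = 0"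
  by (rule poly_mapping_eqI) (auto simp: lookup_hpart when_def Sym_def in_keys_iff)

lemma hpart_in_Sym: "p \<in> Pol m e' \<Longrightarrow> hpart e p \<in> Sym m e"
  by (auto simp: Sym_def Pol_def supported_def in_keys_iff lookup_hpart when_def split: if_splits)

lemma Pol_eq_sum_hpart:
  assumes "p \<in> Pol m e"
  shows "p = (\<Sum>k\<le>e. hpart k p)"
proof (rule poly_mapping_eqI)
  fix x
  show "Poly_Mapping.lookup p x = Poly_Mapping.lookup (\<Sum>k\<le>e. hpart k p) x"
    using assms by (auto simp: lookup_sum lookup_hpart when_def Pol_def supported_def in_keys_iff)
qed

text \<open>The k-th power of the ideal generated by the variables; computing modulo
  \<open>Ord (Suc d)\<close> isolates a lowest term of degree d.\<close>

definition Ord :: "nat \<Rightarrow> 'a::field mpoly set" where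
  "Ord k = supported (\<lambda>x. k \<le> mdeg x)"

lemma subspace_Ord: "mp.subspace (Ord k)"
  unfolding Ord_def by (rule subspace_supported)

lemma Ord_mult: "x \<in> Ord a \<Longrightarrow> y \<in> Ord b \<Longrightarrow> x * y \<in> Ord (a + b)"
  unfolding Ord_def by (erule (1) supported_mult) (auto simp: mdeg_add)

lemma Sym_Ord: "e \<le> e' \<Longrightarrow> Sym m e' \<subseteq> Ord e"
  by (auto simp: Ord_def Sym_eq supported_def)

lemma Ord_0: "x \<in> Ord 0"
  by (simp add: Ord_def supported_def)

lemma hpart_Ord:
  assumes "p \<in> Ord k" "e < k"
  shows "hpart e p = 0"
proof (rule poly_mapping_eqI)
  fix x
  have "Poly_Mapping.lookup p x = 0" if "mdeg x = e"
    using assms that by (force simp: Ord_def supported_def in_keys_iff)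
  then show "Poly_Mapping.lookup (hpart e p) x = Poly_Mapping.lookup 0 x"
    by (simp add: lookup_hpart when_def)
qed

lemma steenrod_eq_polar:
  assumes "q > 0"
  shows "steenrod q j p = polar Con j Var (\<lambda>i. Var i ^ q) p"
  using ev_steenrod[OF comm_ring_hom_Con assms, of Var j p] by simp

lemma mono_polar_Sym:
  assumes "Poly_Mapping.keys x \<subseteq> {..<m}" "\<And>i. i < m \<Longrightarrow> u i \<in> Sym m a" "\<And>i. i < m \<Longrightarrow> w i \<in> Sym m b" "g \<le> mdeg x"
  shows "mono_polar g u w x \<in> Sym m (a * (mdeg x - g) + b * g)"
  unfolding mono_polar_def
proof (rule mp.subspace_sum[OF subspace_Sym])
  let ?K = "Poly_Mapping.keys x" and ?l = "Poly_Mapping.lookup x"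
  fix \<gamma> assume g: "\<gamma> \<in> {\<gamma> \<in> (\<Pi>\<^sub>E i\<in>?K. {..?l i}). sum \<gamma> ?K = g}"
  have "(\<Prod>i\<in>?K. of_nat (?l i choose \<gamma> i) * u i ^ (?l i - \<gamma> i) * w i ^ \<gamma> i)
      \<in> Sym m (\<Sum>i\<in>?K. 0 + a * (?l i - \<gamma> i) + b * \<gamma> i)"
  proof (intro Sym_prod Sym_mult Sym_power)
    fix i assume "i \<in> ?K"
    then show "u i \<in> Sym m a" "w i \<in> Sym m b" using assms by auto
    show "of_nat (?l i choose \<gamma> i) \<in> Sym m 0"
      using Con_Sym[of "of_nat (?l i choose \<gamma> i)" m] by simp
  qed simp
  moreover have "(\<Sum>i\<in>?K. ?l i - \<gamma> i) = mdeg x - g"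
    unfolding mdeg_def using g by (subst sum_subtractf_nat) auto
  ultimately show "(\<Prod>i\<in>?K. of_nat (?l i choose \<gamma> i) * u i ^ (?l i - \<gamma> i) * w i ^ \<gamma> i) \<in> Sym m (a * (mdeg x - g) + b * g)"
    using g by (simp add: sum.distrib flip: sum_distrib_left)
qed

lemma steenrod_Sym:
  assumes "q > 0" "p \<in> Sym m e"
  shows "steenrod q j p \<in> Sym m (e + (q - 1) * j)"
  unfolding steenrod_eq_polar[OF assms(1)] polar_def
proof (rule mp.subspace_sum[OF subspace_Sym], rule subspace_Con[OF subspace_Sym])
  fix x assume "x \<in> Poly_Mapping.keys p"
  then have x: "Poly_Mapping.keys x \<subseteq> {..<m}" "mdeg x = e" using assms by (auto simp: Sym_def)
  show "mono_polar j Var (\<lambda>i. Var i ^ q) x \<in> Sym m (e + (q - 1) * j)"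
  proof (cases "j \<le> e")
    case True
    have "mono_polar j Var (\<lambda>i. Var i ^ q) x \<in> Sym m (1 * (mdeg x - j) + (1 * q) * j)"
      by (rule mono_polar_Sym) (use x True Var_Sym Sym_power[OF Var_Sym, of _ m q] in auto)
    moreover have "1 * (mdeg x - j) + (1 * q) * j = e + (q - 1) * j"
      using True x assms(1) by (cases q) auto
    ultimately show ?thesis by metis
  next
    case False
    then show ?thesis using x mp.subspace_0[OF subspace_Sym] by (simp add: mono_polar_eq_0)
  qed
qed

lemma steenrod_eq_0:
  assumes "q > 0" "p \<in> Sym m e" "e < j"
  shows "steenrod q j p = 0"
  unfolding steenrod_eq_polar[OF assms(1)] polar_def
  by (intro sum.neutral ballI) (use assms in \<open>auto simp: Sym_def mono_polar_eq_0\<close>)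

lemma polar_0_left: "polar \<kappa> 0 u w p = ev \<kappa> u p"
proof -
  have "mono_polar 0 u w m = mono_ev u m" for m
  proof (cases "mdeg m = 0")
    case True
    then show ?thesis using mono_ev_combination[of 1 u 0 w m] by simp
  next
    case False
    have "mono_ev u m = (\<Sum>g\<le>mdeg m. 1 ^ (mdeg m - g) * 0 ^ g * mono_polar g u w m)"
      using mono_ev_combination[of 1 u 0 w m] by simp
    also have "\<dots> = (\<Sum>g\<in>{0}. 1 ^ (mdeg m - g) * 0 ^ g * mono_polar g u w m)"
      by (rule sum.mono_neutral_right) (auto simp: power_0_left)
    finally show ?thesis by simp
  qed
  then show ?thesis by (simp add: polar_def ev_def)
qed

lemma steenrod_0_left: "q > 0 \<Longrightarrow> steenrod q 0 p = p"
  by (simp add: steenrod_eq_polar polar_0_left)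

lemma polar_top:
  assumes "\<And>m. m \<in> Poly_Mapping.keys p \<Longrightarrow> mdeg m = e"
  shows "polar \<kappa> e u w p = ev \<kappa> w p"
proof -
  have "ev \<kappa> w p = (\<Sum>g\<le>e. 0 ^ (e - g) * 1 ^ g * polar \<kappa> g u w p)"
    using ev_combination[OF assms, where A = 0 and B = 1 and u = u and w = w and \<kappa> = \<kappa>] by simp
  also have "\<dots> = (\<Sum>g\<in>{e}. 0 ^ (e - g) * 1 ^ g * polar \<kappa> g u w p)"
    by (rule sum.mono_neutral_right) (auto simp: power_0_left)
  finally show ?thesis by simp
qed

lemma polar_eq_0:
  assumes "\<And>m. m \<in> Poly_Mapping.keys p \<Longrightarrow> mdeg m < g"
  shows "polar \<kappa> g u w p = 0"
  unfolding polar_def by (intro sum.neutral ballI) (simp add: mono_polar_eq_0 assms)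

text \<open>Polarisations become the coefficients of one ring homomorphism into power series;
  products and compositions are then handled there.\<close>

lemma fps_nth_ev_translate:
  fixes u w :: "nat \<Rightarrow> 'b::comm_ring_1"
  assumes "comm_ring_hom \<kappa>"
  shows "fps_nth (ev (\<lambda>c. fps_const (\<kappa> c)) (\<lambda>i. fps_const (u i) + fps_X * fps_const (w i)) p) g = polar \<kappa> g u w p"
proof -
  \<comment> \<open>The maximum includes g itself, so that the g-th term is sure to occur in the sum
    up to e.\<close>
  define e where "e = Max (insert g (mdeg ` Poly_Mapping.keys p))"
  have e: "mdeg m \<le> e" if "m \<in> Poly_Mapping.keys p" for m
    unfolding e_def using that by (intro Max_ge) auto
  have ge: "g \<le> e" unfolding e_def by (intro Max_ge) auto
  have "ev (\<lambda>c. fps_const (\<kappa> c)) (\<lambda>i. fps_const (u i) + fps_X * fps_const (w i)) p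
      = (\<Sum>k\<le>e. fps_X ^ k * fps_const (polar \<kappa> k u w p))"
    using ev_translate[OF e, where u = "\<lambda>i. fps_const (u i)" and w = "\<lambda>i. fps_const (w i)" and B = fps_X
        and \<kappa> = "\<lambda>c. fps_const (\<kappa> c)"]
    by (simp add: hom_polar[OF comm_ring_hom_fps_const])
  also have "fps_nth \<dots> g = (\<Sum>k\<le>e. if k = g then polar \<kappa> k u w p else 0)"
    unfolding fps_sum_nth by (intro sum.cong refl) (auto simp: fps_X_power_mult_nth)
  also have "\<dots> = polar \<kappa> g u w p" using ge by simp
  finally show ?thesis .
qed

section \<open>Frobenius\<close>

text \<open>Multiplication by a nonzero x permutes the nonzero elements, so their product is
  unchanged by the factor x^(q - 1).\<close>

lemma field_power_CARD: "x ^ CARD('a) = (x :: 'a::{field,finite})"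
proof (cases "x = 0")
  case False
  have "x * (\<Prod>y\<in>UNIV-{0}. x * y) = x * x ^ (CARD('a) - 1) * \<Prod>(UNIV-{0})"
    by (simp add: prod.distrib mult_ac)
  also have "x * x ^ (CARD('a) - 1) = x ^ CARD('a)"
    using finite_UNIV_card_ge_0[where ?'a = 'a] by (simp flip: power_Suc)
  also have "(\<Prod>y\<in>UNIV-{0}. x * y) = (\<Prod>y\<in>UNIV-{0}. y)"
    by (rule prod.reindex_bij_witness[of _ "\<lambda>y. y / x" "\<lambda>y. x * y"]) (use False in auto)
  finally show ?thesis by simp
qed (use finite_UNIV_card_ge_0[where ?'a = 'a] in auto)

lemma CARD_field_ge_2: "CARD('a::{field,finite}) \<ge> 2"
  using card_mono[of "UNIV :: 'a set" "{0, 1}"] by simp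

text \<open>The polynomial \<open>(x + 1)\<^sup>q - x\<^sup>q - 1\<close> has degree less than \<open>q\<close> and vanishes at all \<open>q\<close> points of the field.\<close>

lemma CARD_choose_eq_0:
  assumes "0 < k" "k < CARD('a)"
  shows "of_nat (CARD('a) choose k) = (0 :: 'a::{field,finite})"
proof -
  let ?q = "CARD('a)"
  define f :: "'a poly" where "f = (\<Sum>k\<in>{1..<?q}. monom (of_nat (?q choose k)) k)"
  have "poly f x = 0" for x
  proof -
    have "(x + 1) ^ ?q = (\<Sum>k\<le>?q. of_nat (?q choose k) * x ^ k)"
      using binomial_ring[of x 1 ?q] by simp
    also have "{..?q} = insert 0 (insert ?q {1..<?q})" by auto
    also have "(\<Sum>k\<in>\<dots>. of_nat (?q choose k) * x ^ k) = 1 + (x ^ ?q + poly f x)"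
      using CARD_field_ge_2[where 'a='a] by (subst sum.insert) (auto simp: f_def poly_sum poly_monom)
    finally show ?thesis by (simp add: field_power_CARD)
  qed
  then have all: "{x. poly f x = 0} = UNIV" by auto
  have "f = 0"
  proof (rule ccontr)
    assume "f \<noteq> 0"
    then have "?q \<le> degree f" using card_poly_roots_bound[of f] all by simp
    moreover have "degree f \<le> ?q - 1"
      unfolding f_def by (rule degree_sum_le) (auto intro: order_trans[OF degree_monom_le])
    ultimately show False using CARD_field_ge_2[where 'a='a] by linarith
  qed
  then have "coeff f k = 0" by simp
  then show ?thesis using assms by (simp add: f_def coeff_sum)
qed

text \<open>Vanishing binomial coefficients are the hypothesis, so that the lemma applies alike to
  polynomials and to power series over the field.\<close>

lemma freshman:
  fixes x y :: "'b::comm_ring_1"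
  assumes "\<And>k. 0 < k \<Longrightarrow> k < q \<Longrightarrow> of_nat (q choose k) = (0 :: 'b)" "q > 0"
  shows "(x + y) ^ q = x ^ q + y ^ q"
proof -
  have "(x + y) ^ q = (\<Sum>k\<le>q. of_nat (q choose k) * x ^ k * y ^ (q - k))"
    by (rule binomial_ring)
  also have "\<dots> = (\<Sum>k\<in>{0, q}. of_nat (q choose k) * x ^ k * y ^ (q - k))"
    by (intro sum.mono_neutral_right ballI) (use assms in auto)
  finally show ?thesis using assms by (simp add: add.commute)
qed

text \<open>Additivity of the q-th power only reaches finite sums, so f is cut after degree n; the
  tail enters f^q from degree q (n + 1) on and cannot affect coefficient n.\<close>

lemma fps_nth_power_freshman:
  fixes f :: "'b::comm_ring_1 fps"
  assumes choose_q_eq_0: "\<And>k. 0 < k \<Longrightarrow> k < q \<Longrightarrow> of_nat (q choose k) = (0 :: 'b)" and q: "q > 0"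
  shows "fps_nth (f ^ q) n = (if q dvd n then fps_nth f (n div q) ^ q else 0)"
proof -
  have fr: "(x + y) ^ q = x ^ q + y ^ q" for x y :: "'b fps"
    by (rule freshman) (use choose_q_eq_0 q in \<open>simp_all flip: fps_of_nat\<close>)
  have frs: "(\<Sum>i\<in>S. g i) ^ q = (\<Sum>i\<in>S. g i ^ q)" for g :: "nat \<Rightarrow> 'b fps" and S
    by (induction S rule: infinite_finite_induct) (use q in \<open>simp_all add: fr power_0_left\<close>)
  define g where "g = (\<Sum>i=0..n. fps_const (fps_nth f i) * fps_X ^ i)"
  have "f = g + fps_X ^ Suc n * fps_shift (Suc n) f"
    unfolding g_def by (rule fps_ext) (simp add: fps_sum_rep_nth fps_X_power_mult_nth del: power_Suc)
  then have "f ^ q = g ^ q + fps_X ^ (q * Suc n) * fps_shift (Suc n) f ^ q"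
    by (metis fr power_mult_distrib power_mult mult.commute)
  moreover have "n < q * Suc n" using q by (cases q) auto
  ultimately have "fps_nth (f ^ q) n = fps_nth (g ^ q) n"
    by (simp add: fps_X_power_mult_nth)
  also have "g ^ q = (\<Sum>i=0..n. fps_const (fps_nth f i ^ q) * fps_X ^ (i * q))"
    unfolding g_def frs by (simp add: power_mult_distrib flip: power_mult)
  also have "fps_nth \<dots> n = (\<Sum>i=0..n. if n = i * q then fps_nth f i ^ q else 0)"
    unfolding fps_sum_nth by (intro sum.cong refl) (auto simp: fps_X_power_nth)
  also have "\<dots> = (if q dvd n then fps_nth f (n div q) ^ q else 0)"
  proof (cases "q dvd n")
    case True
    then have "n = i * q \<longleftrightarrow> i = n div q" for i using q by auto
    then show ?thesis using True by (simp add: div_le_dividend)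
  next
    case False
    then show ?thesis by (intro sum.neutral[THEN trans]) auto
  qed
  finally show ?thesis .
qed

section \<open>Binomial coefficients modulo the characteristic\<close>

lemma fps_nth_one_plus_X_power:
  "fps_nth ((1 + fps_X) ^ n :: 'b::comm_ring_1 fps) k = of_nat (n choose k)"
proof (induction n arbitrary: k)
  case (Suc n)
  then show ?case by (cases k) (simp_all add: distrib_right add.commute)
next
  case 0
  then show ?case by (cases k) simp_all
qed

lemma fps_nth_one_minus_X_power:
  "fps_nth ((1 - fps_X) ^ n :: 'b::comm_ring_1 fps) k = (-1) ^ k * of_nat (n choose k)"
proof (induction n arbitrary: k)
  case (Suc n)
  then show ?case by (cases k) (simp_all add: left_diff_distrib algebra_simps)
next
  case 0
  then show ?case by (cases k) simp_all
qed

text \<open>Compare coefficients in (1 + X)^(q a + b) = ((1 + X)^a)^q (1 + X)^b. The q-th power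
  moves coefficients to multiples of q and fixes their values, which lie in F_q; as b < q, a single
  term of the product survives.\<close>

lemma choose_Lucas:
  assumes q: "q = CARD('a::{field,finite})" and b: "b < q"
  shows "of_nat ((q * a + b) choose n) = (of_nat (a choose (n div q)) * of_nat (b choose (n mod q)) :: 'a)"
proof -
  let ?X = "fps_X :: 'a fps"
  have q0: "q > 0" using b by simp
  have choose_q_eq_0: "of_nat (q choose k) = (0::'a)" if "0 < k" "k < q" for k
    using CARD_choose_eq_0[where 'a='a] that q by simp
  have pw: "fps_nth (f ^ q) i = (if q dvd i then fps_nth f (i div q) ^ q else 0)" for f :: "'a fps" and i
    by (rule fps_nth_power_freshman) (use choose_q_eq_0 q0 in auto)
  have "of_nat ((q * a + b) choose n) = fps_nth ((((1 + ?X) ^ a) ^ q) * (1 + ?X) ^ b) n"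
    by (simp add: fps_nth_one_plus_X_power[symmetric] power_add power_mult mult.commute[of q a])
  also have "\<dots> = (\<Sum>i=0..n. (if q dvd i then of_nat (a choose (i div q)) else 0) * of_nat (b choose (n - i)))"
    unfolding fps_mult_nth[of "((1 + ?X) ^ a) ^ q"] pw fps_nth_one_plus_X_power
    by (intro sum.cong refl) (simp add: q field_power_CARD)
  also have "\<dots> = (\<Sum>i\<in>{q * (n div q)}. (if q dvd i then of_nat (a choose (i div q)) else 0) * of_nat (b choose (n - i)))"
  proof (rule sum.mono_neutral_right)
    show "\<forall>i\<in>{0..n} - {q * (n div q)}. (if q dvd i then of_nat (a choose (i div q)) else 0) * of_nat (b choose (n - i)) = (0::'a)"
    proof
      fix i assume i: "i \<in> {0..n} - {q * (n div q)}"
      show "(if q dvd i then of_nat (a choose (i div q)) else 0) * of_nat (b choose (n - i)) = (0::'a)"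
      proof (cases "q dvd i \<and> n - i \<le> b")
        case True
        then obtain c where c: "i = q * c" by blast
        have "n = q * c + (n - i)" "n - i < q" using i c b True by auto
        then have "n div q = c" by (metis div_mult_self4 div_less add.right_neutral q0 not_gr_zero)
        then show ?thesis using i c by simp
      qed (auto simp: binomial_eq_0)
    qed
  qed auto
  also have "\<dots> = of_nat (a choose (n div q)) * of_nat (b choose (n mod q))"
    using q0 by (simp add: minus_mult_div_eq_mod)
  finally show ?thesis .
qed

text \<open>Induction on the base q digits of l = q l' + c. If c > 0, the lowest digit of the upper
  number is c - 1, which is less than c. If c = 0, that digit is q - 1 and the higher digits pose
  the same problem for l' and r.\<close>

lemma choose_vanish:
  assumes q: "q = CARD('a::{field,finite})" and "1 \<le> l" "l < q ^ r"
  shows "of_nat (((q - 1) * (q ^ r - l) - 1) choose l) = (0 :: 'a)"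
  using assms(2,3)
proof (induction r arbitrary: l)
  case (Suc r)
  have q2: "q \<ge> 2" using CARD_field_ge_2[where 'a='a] q by simp
  define l' c where "l' = l div q" and "c = l mod q"
  have l: "l = q * l' + c" "c < q" using q2 by (simp_all add: l'_def c_def)
  have l': "l' < q ^ r" using Suc.prems by (simp add: l'_def less_mult_imp_div_less mult.commute)
  define A where "A = (q - 1) * (q ^ r - l')"
  have A: "A \<ge> q - 1"
    unfolding A_def using mult_le_mono2[of 1 "q ^ r - l'" "q - 1"] l' by (simp add: Suc_le_eq)
  have "q ^ Suc r - l = q * (q ^ r - l') - c"
    by (simp add: l diff_mult_distrib2)
  then have "(q - 1) * (q ^ Suc r - l) = (q - 1) * (q * (q ^ r - l')) - (q - 1) * c"
    by (simp only: diff_mult_distrib2)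
  then have e: "(q - 1) * (q ^ Suc r - l) = q * A - (q - 1) * c"
    by (simp only: A_def mult.left_commute)
  show ?case
  proof (cases "c = 0")
    case True
    have "(q - 1) * (q ^ Suc r - l) - 1 = q * (A - 1) + (q - 1)"
      using e True A q2 by (cases A) auto
    moreover have "of_nat ((q * (A - 1) + (q - 1)) choose l) = (of_nat ((A - 1) choose l') * of_nat ((q - 1) choose 0) :: 'a)"
      using choose_Lucas[OF q, of "q - 1" "A - 1" l] q2 True unfolding l'_def[symmetric] c_def[symmetric] by simp
    moreover have "of_nat ((A - 1) choose l') = (0 :: 'a)"
      unfolding A_def by (rule Suc.IH) (use l' Suc.prems l True in auto)
    ultimately show ?thesis by simp
  next
    case False
    have cA: "c \<le> A" using A l by linarith
    then obtain A' where A': "A = A' + c" by (metis le_add_diff_inverse2)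
    have e2: "q * A - (q - 1) * c = q * A' + c"
    proof -
      obtain q' where "q = Suc q'" using q2 by (cases q) auto
      then show ?thesis by (simp add: A' add_mult_distrib2)
    qed
    have "(q - 1) * (q ^ Suc r - l) - 1 = q * A' + (c - 1)"
      unfolding e e2 using False by linarith
    moreover have "of_nat ((q * A' + (c - 1)) choose l) = (of_nat (A' choose l') * of_nat ((c - 1) choose c) :: 'a)"
      using choose_Lucas[OF q, of "c - 1" A' l] l(2) unfolding l'_def[symmetric] c_def[symmetric] by linarith
    ultimately show ?thesis using False by (simp add: binomial_eq_0)
  qed
qed simp

text \<open>Inverses of series are formed over the field, where units are available, and then
  carried to polynomial coefficients.\<close>

definition lift_fps :: "'a::comm_ring_1 fps \<Rightarrow> 'a mpoly fps" where
  "lift_fps f = Abs_fps (\<lambda>n. Con (fps_nth f n))"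

lemma comm_ring_hom_lift: "comm_ring_hom lift_fps"
proof
  show "lift_fps 1 = (1 :: 'a::comm_ring_1 mpoly fps)"
    by (rule fps_ext) (simp add: lift_fps_def)
  show "lift_fps (x + y) = lift_fps x + lift_fps y" for x y :: "'a fps"
    by (rule fps_ext) (simp add: lift_fps_def Con.homs)
  show "lift_fps (x * y) = lift_fps x * lift_fps y" for x y :: "'a fps"
    by (rule fps_ext) (simp add: lift_fps_def Con.homs fps_mult_nth)
qed

interpretation lift: comm_ring_hom lift_fps
  by (rule comm_ring_hom_lift)

lemma lift_X [simp]: "lift_fps fps_X = fps_X"
  by (rule fps_ext) (simp add: lift_fps_def)

lemma nth_lift: "fps_nth (lift_fps f) n = Con (fps_nth f n)"
  by (simp add: lift_fps_def)

lemma ev_scale: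
  assumes "\<And>k. k \<in> Poly_Mapping.keys p \<Longrightarrow> mdeg k = e"
  shows "ev \<kappa> (\<lambda>i. c * \<sigma> i) p = c ^ e * ev \<kappa> \<sigma> p"
proof -
  have "mono_ev (\<lambda>i. c * \<sigma> i) k = c ^ mdeg k * mono_ev \<sigma> k" for k
    by (simp add: mono_ev_def mdeg_def power_mult_distrib prod.distrib power_sum)
  then show ?thesis
    by (simp add: ev_def assms sum_distrib_left mult_ac)
qed

section \<open>Dehomogenised hits\<close>

locale hit_step =
  fixes F :: "'a::{field,finite} itself" and q m :: nat
  assumes q: "q = CARD('a)" and m: "m \<ge> 1"
begin

definition "Q = q ^ (m - 1)"
definition "d = Q - m"
definition "D = q ^ m - (m + 1)"

lemma q2: "q \<ge> 2"
  using CARD_field_ge_2[where 'a='a] q by simp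

lemma q0: "q > 0"
  using q2 by simp

lemma Q_ge: "m \<le> Q"
proof -
  have "m \<le> 2 ^ (m - 1)" using less_exp[of "m - 1"] m by linarith
  also have "\<dots> \<le> Q" unfolding Q_def by (rule power_mono) (use q2 in auto)
  finally show ?thesis .
qed

lemma d_plus_m: "d + m = Q"
  using Q_ge by (simp add: d_def)

lemma D_qQ: "D + m + 1 = q * Q"
proof -
  have e: "q ^ m = q * Q" using m by (simp add: Q_def flip: power_Suc)
  have "m < 2 ^ m" by (rule less_exp)
  also have "2 ^ m \<le> q ^ m" by (rule power_mono) (use q2 in auto)
  finally show ?thesis by (simp add: D_def e)
qed

lemma D_d: "D + 1 = d + (q - 1) * Q"
  using D_qQ d_plus_m q2 by (cases q) auto

lemma choose_q_eq_0: "0 < k \<Longrightarrow> k < q \<Longrightarrow> of_nat (q choose k) = (0::'a)"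
  using CARD_choose_eq_0[where 'a='a] q by simp

lemma choose_q_eq_0_mpoly: "0 < k \<Longrightarrow> k < q \<Longrightarrow> of_nat (q choose k) = (0::'a mpoly)"
  using choose_q_eq_0[of k] by (simp flip: single_of_nat)

lemma choose_q_eq_0_fps: "0 < k \<Longrightarrow> k < q \<Longrightarrow> of_nat (q choose k) = (0::'a mpoly fps)"
  using choose_q_eq_0_mpoly[of k] by (simp flip: fps_of_nat)

lemma freshman_mpoly: "(x + y) ^ q = x ^ q + y ^ q" for x y :: "'a mpoly"
  by (rule freshman) (use choose_q_eq_0_mpoly q0 in auto)

lemma freshman_fps: "(x + y) ^ q = x ^ q + y ^ q" for x y :: "'a mpoly fps"
  by (rule freshman) (use choose_q_eq_0_fps q0 in auto)

lemma freshman_fps_diff: "(x - y) ^ q = x ^ q - y ^ q" for x y :: "'a mpoly fps"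
  using freshman_fps[of "x - y" y] by (simp add: eq_diff_eq)

lemma nth_power_q: "fps_nth (f ^ q) n = (if q dvd n then fps_nth f (n div q) ^ q else 0)" for f :: "'a mpoly fps"
  by (rule fps_nth_power_freshman) (use choose_q_eq_0_mpoly q0 in auto)

lemma field_power_q: "(x::'a) ^ q = x"
  using field_power_CARD[of x] q by simp

definition L :: "nat \<Rightarrow> 'a mpoly" where
  "L i = Var i ^ q - Var i"

definition tau :: "nat \<Rightarrow> 'a mpoly" where
  "tau i = (if i < m then Var i else 1)"

definition dehom :: "'a mpoly \<Rightarrow> 'a mpoly" where
  "dehom = ev Con tau"

text \<open>Homogenisation to degree M by the last variable; on \<open>Pol m M\<close> the truncated
  subtraction is exact.\<close>

definition hmg :: "nat \<Rightarrow> 'a mpoly \<Rightarrow> 'a mpoly" where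
  "hmg M v = (\<Sum>k\<in>Poly_Mapping.keys v. Poly_Mapping.single (k + Poly_Mapping.single m (M - mdeg k)) (Poly_Mapping.lookup v k))"

sublocale dehom: comm_ring_hom dehom
  unfolding dehom_def by (rule Con.comm_ring_hom_ev)

lemma dehom_Con [simp]: "dehom (Con c) = Con c"
  by (simp add: dehom_def)

lemma hmg_add: "hmg M (x + y) = hmg M x + hmg M y"
  unfolding hmg_def by (rule sum_keys_add) (simp_all add: single_add)

lemma hmg_0 [simp]: "hmg M 0 = 0"
  by (simp add: hmg_def)

lemma hmg_single: "hmg M (Poly_Mapping.single k c) = Poly_Mapping.single (k + Poly_Mapping.single m (M - mdeg k)) c"
  by (simp add: hmg_def)

lemma hmg_Sym:
  assumes "v \<in> Pol m M"
  shows "hmg M v \<in> Sym (Suc m) M"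
  unfolding hmg_def
proof (rule mp.subspace_sum[OF subspace_Sym])
  fix k assume "k \<in> Poly_Mapping.keys v"
  then have "Poly_Mapping.keys k \<subseteq> {..<m}" "mdeg k \<le> M" using assms by (auto simp: Pol_def supported_def)
  then show "Poly_Mapping.single (k + Poly_Mapping.single m (M - mdeg k)) (Poly_Mapping.lookup v k) \<in> Sym (Suc m) M"
    unfolding Sym_eq by (intro single_supported) (auto simp: keys_add_nat mdeg_add)
qed

lemma dehom_single:
  assumes "Poly_Mapping.keys k \<subseteq> {..<m}"
  shows "dehom (Poly_Mapping.single (k + Poly_Mapping.single m c) a) = Poly_Mapping.single k a"
proof -
  have "mono_ev tau k = mono_ev Var k"
    by (rule mono_ev_cong) (use assms in \<open>auto simp: tau_def\<close>)
  then show ?thesis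
    by (simp add: dehom_def Con.ev_single mono_ev_add mono_ev_Var mult_single tau_def del: single_one)
qed

lemma dehom_hmg:
  assumes "v \<in> Pol m M"
  shows "dehom (hmg M v) = v"
proof -
  have "dehom (hmg M v) = (\<Sum>k\<in>Poly_Mapping.keys v. Poly_Mapping.single k (Poly_Mapping.lookup v k))"
    unfolding hmg_def dehom.hom_sum
    by (intro sum.cong refl dehom_single) (use assms in \<open>auto simp: Pol_def supported_def\<close>)
  then show ?thesis by (simp flip: mpoly_eq_sum_single)
qed

lemma split_last:
  fixes k :: "nat \<Rightarrow>\<^sub>0 nat"
  assumes "Poly_Mapping.keys k \<subseteq> {..<Suc m}"
  obtains k' c where "k = k' + Poly_Mapping.single m c" "Poly_Mapping.keys k' \<subseteq> {..<m}"
proof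
  let ?k' = "k - Poly_Mapping.single m (Poly_Mapping.lookup k m)"
  show "k = ?k' + Poly_Mapping.single m (Poly_Mapping.lookup k m)"
    by (rule poly_mapping_eqI) (auto simp: lookup_add lookup_minus lookup_single when_def)
  show "Poly_Mapping.keys ?k' \<subseteq> {..<m}"
  proof
    fix i assume "i \<in> Poly_Mapping.keys ?k'"
    then have "Poly_Mapping.lookup k i \<noteq> 0" "i \<noteq> m"
      by (auto simp: in_keys_iff lookup_minus lookup_single when_def split: if_splits)
    then have "i \<in> Poly_Mapping.keys k" by (simp add: in_keys_iff)
    then show "i \<in> {..<m}" using assms \<open>i \<noteq> m\<close> by fastforce
  qed
qed

lemma hmg_dehom:
  assumes "V \<in> Sym (Suc m) M"
  shows "hmg M (dehom V) = V"
proof (induction V rule: mpoly_induct)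
  case (single k c)
  then have k: "Poly_Mapping.keys k \<subseteq> {..<Suc m}" "mdeg k = M" using assms by (auto simp: Sym_def)
  obtain k' a where k': "k = k' + Poly_Mapping.single m a" "Poly_Mapping.keys k' \<subseteq> {..<m}"
    using split_last[OF k(1)] .
  have "M - mdeg k' = a" using k k' by (simp add: mdeg_add)
  then show ?case by (simp add: k'(1) dehom_single[OF k'(2)] hmg_single)
qed (simp_all add: dehom.homs hmg_add)

lemma dehom_Pol:
  assumes "V \<in> Sym (Suc m) M"
  shows "dehom V \<in> Pol m M"
proof -
  have "tau i \<in> Pol m 1" for i
    using Var_Sym[of i m] Sym_subset_Pol[of m 1] one_Sym[of m] Sym_subset_Pol[of m 0] Pol_mono[of 0 1 m]
    by (auto simp: tau_def)
  then show ?thesis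
    using Pol_ev[of V "Suc m" M tau m 1] assms Sym_subset_Pol unfolding dehom_def by fastforce
qed

section \<open>The substitution x -> x + y L and Steenrod operations with the last variable set to
  1\<close>

definition polarL :: "nat \<Rightarrow> 'a mpoly \<Rightarrow> 'a mpoly" where
  "polarL g = polar Con g Var L"

definition Psi :: "'a mpoly \<Rightarrow> 'a mpoly fps" where
  "Psi = ev (\<lambda>c. fps_const (Con c)) (\<lambda>i. fps_const (Var i) + fps_X * fps_const (L i))"

sublocale fC: comm_ring_hom "\<lambda>c. fps_const (Con c :: 'a mpoly)"
  by (rule comm_ring_hom_fps_Con)

sublocale Psi: comm_ring_hom Psi
  unfolding Psi_def by (rule fC.comm_ring_hom_ev)

lemma Psi_nth: "fps_nth (Psi v) g = polarL g v"
  unfolding Psi_def polarL_def by (rule fps_nth_ev_translate[OF comm_ring_hom_Con])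

lemma polarL_add: "polarL g (x + y) = polarL g x + polarL g y"
  by (simp add: polarL_def Con.polar_add)

lemma polarL_0 [simp]: "polarL 0 v = v"
  by (simp add: polarL_def polar_0_left)

lemma polarL_zero [simp]: "polarL g 0 = 0"
  by (simp add: polarL_def Con.polar_0)

definition J :: "'a fps" where
  "J = inverse (1 + fps_X)"

lemma J: "(1 + fps_X) * J = 1"
  unfolding J_def by (rule inverse_mult_eq_1') simp

text \<open>This is 1 - y/(1 + y) = 1/(1 + y): replacing y by \<open>fps_X * J\<close> turns powers
  of 1 - y into negative powers of 1 + y.\<close>

lemma J': "1 - fps_X * J = J"
  using J by (simp add: distrib_right eq_diff_eq' add.commute diff_eq_eq)

text \<open>The matrix passing from the coefficients of v(x + y L) to those of (1 + y)^M v(x + y J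
  L). It is unitriangular, so each hit determines one new coefficient from the earlier ones.\<close>

definition shear_coeff :: "nat \<Rightarrow> nat \<Rightarrow> nat \<Rightarrow> 'a" where
  "shear_coeff M l g = fps_nth ((1 + fps_X) ^ M * (fps_X * J) ^ g) l"

lemma zpow_nth: "n < i \<Longrightarrow> fps_nth ((fps_X * J) ^ i) n = 0"
  by (simp add: power_mult_distrib fps_X_power_mult_nth)

lemma shear_coeff_eq_0: "l < g \<Longrightarrow> shear_coeff M l g = 0"
  unfolding shear_coeff_def fps_mult_nth[of "(1 + fps_X) ^ M"] by (intro sum.neutral ballI) (simp add: zpow_nth)

lemma shear_coeff_same: "shear_coeff M l l = 1"
proof -
  have "shear_coeff M l l = fps_nth (fps_X ^ l * ((1 + fps_X) ^ M * J ^ l)) l"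
    unfolding shear_coeff_def by (simp add: power_mult_distrib mult_ac)
  then show ?thesis by (simp add: fps_X_power_mult_nth fps_power_zeroth J_def)
qed

lemma shear_coeff_sum: "(\<Sum>g\<le>l. shear_coeff M l g * fps_nth f g) = fps_nth ((1 + fps_X) ^ M * (f oo (fps_X * J))) l"
proof -
  let ?W = "(1 + fps_X) ^ M :: 'a fps" and ?z = "fps_X * J"
  have "fps_nth (f oo ?z) n = (\<Sum>g\<le>l. fps_nth f g * fps_nth (?z ^ g) n)" if "n \<le> l" for n
    unfolding fps_compose_nth by (rule sum.mono_neutral_left) (use that in \<open>auto simp: zpow_nth\<close>)
  then have "fps_nth (?W * (f oo ?z)) l = (\<Sum>n=0..l. fps_nth ?W n * (\<Sum>g\<le>l. fps_nth f g * fps_nth (?z ^ g) (l - n)))"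
    unfolding fps_mult_nth[of ?W] by (intro sum.cong refl) simp
  also have "\<dots> = (\<Sum>g\<le>l. (\<Sum>n=0..l. fps_nth ?W n * fps_nth (?z ^ g) (l - n)) * fps_nth f g)"
    unfolding sum_distrib_left sum_distrib_right by (subst sum.swap) (simp add: mult_ac)
  finally show ?thesis unfolding shear_coeff_def fps_mult_nth[of ?W] by simp
qed

lemma compose_z: "((1 - fps_X) ^ e * fps_X ^ r) oo (fps_X * J) = J ^ e * (fps_X * J) ^ r"
  by (simp add: fps_compose_mult_distrib fps_compose_power[symmetric] fps_compose_sub_distrib J')

text \<open>What P^l on forms of degree M becomes when the last variable is 1; M must be remembered
  because dehomogenising forgets it.\<close>

definition steenrod_op :: "nat \<Rightarrow> nat \<Rightarrow> 'a mpoly \<Rightarrow> 'a mpoly" where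
  "steenrod_op M l v = (\<Sum>g\<le>l. Con (shear_coeff M l g) * polarL g v)"

definition shear :: "nat \<Rightarrow> 'a mpoly fps" where
  "shear i = fps_const (Var i) + lift_fps (fps_X * J) * fps_const (L i)"

lemma steenrod_op_ev:
  assumes "v \<in> Pol m e"
  shows "steenrod_op M l v = fps_nth (lift_fps ((1 + fps_X) ^ M) * ev (\<lambda>c. fps_const (Con c)) shear v) l"
proof -
  have "ev (\<lambda>c. fps_const (Con c)) shear v = (\<Sum>g\<le>e + l. lift_fps (fps_X * J) ^ g * fps_const (polarL g v))"
    unfolding shear_def polarL_def hom_polar[OF comm_ring_hom_fps_const]
    by (rule ev_translate) (use assms in \<open>auto simp: Pol_def supported_def intro: trans_le_add1\<close>)
  then have "fps_nth (lift_fps ((1 + fps_X) ^ M) * ev (\<lambda>c. fps_const (Con c)) shear v) l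
      = (\<Sum>g\<le>e + l. fps_nth (lift_fps ((1 + fps_X) ^ M * (fps_X * J) ^ g) * fps_const (polarL g v)) l)"
    by (simp add: sum_distrib_left fps_sum_nth lift.homs mult.assoc)
  also have "\<dots> = (\<Sum>g\<le>e + l. Con (shear_coeff M l g) * polarL g v)"
    by (simp add: nth_lift shear_coeff_def)
  also have "\<dots> = steenrod_op M l v"
    unfolding steenrod_op_def by (rule sum.mono_neutral_right) (auto simp: shear_coeff_eq_0)
  finally show ?thesis by simp
qed

lemma one_plus_X_shear: "lift_fps (1 + fps_X) * shear i = fps_const (Var i) + fps_X * fps_const (Var i ^ q)"
proof -
  have "(1 + fps_X) * (fps_X * J) = fps_X * ((1 + fps_X) * J)" by (rule mult.left_commute)
  then have "(1 + fps_X) * (fps_X * J) = fps_X" by (simp only: J mult_1_right)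
  then have "lift_fps (1 + fps_X) * lift_fps (fps_X * J) = fps_X"
    by (simp only: lift.hom_mult[symmetric] lift_X)
  then have "lift_fps (1 + fps_X) * shear i = (1 + fps_X) * fps_const (Var i) + fps_X * fps_const (L i)"
    by (simp add: shear_def distrib_left lift.hom_add flip: mult.assoc)
  then show ?thesis
    by (simp add: L_def algebra_simps flip: fps_const_sub)
qed

text \<open>The total operation sends the last variable, now 1, to 1 + y. Homogeneity of V extracts
  (1 + y)^M, and the remaining arguments (x_i + y x_i^q)/(1 + y) are \<open>shear i\<close>.\<close>

lemma dehom_steenrod:
  assumes V: "V \<in> Sym (Suc m) M"
  shows "dehom (steenrod q l V) = steenrod_op M l (dehom V)"
proof -
  let ?K = "\<lambda>c::'a. fps_const (Con c)"
  define \<sigma> where "\<sigma> i = (if i < m then shear i else 1)" for i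
  interpret sh: comm_ring_hom "ev ?K shear" by (rule fC.comm_ring_hom_ev)
  have "dehom (steenrod q l V) = polar Con l tau (\<lambda>i. tau i ^ q) V"
    unfolding dehom_def by (rule ev_steenrod[OF comm_ring_hom_Con q0])
  also have "\<dots> = fps_nth (ev ?K (\<lambda>i. fps_const (tau i) + fps_X * fps_const (tau i ^ q)) V) l"
    by (rule fps_nth_ev_translate[OF comm_ring_hom_Con, symmetric])
  also have "(\<lambda>i. fps_const (tau i) + fps_X * fps_const (tau i ^ q)) = (\<lambda>i. lift_fps (1 + fps_X) * \<sigma> i)"
  proof
    show "fps_const (tau i) + fps_X * fps_const (tau i ^ q) = lift_fps (1 + fps_X) * \<sigma> i" for i
    proof (cases "i < m")
      case True
      then show ?thesis by (simp only: tau_def \<sigma>_def one_plus_X_shear if_True)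
    qed (simp add: tau_def \<sigma>_def lift.hom_add)
  qed
  also have "ev ?K \<dots> V = lift_fps (1 + fps_X) ^ M * ev ?K \<sigma> V"
    by (rule ev_scale) (use V in \<open>auto simp: Sym_def\<close>)
  also have "ev ?K \<sigma> V = ev ?K shear (dehom V)"
  proof -
    have "\<sigma> = (\<lambda>i. ev ?K shear (tau i))" by (auto simp: fun_eq_iff \<sigma>_def tau_def sh.hom_one)
    then show ?thesis by (simp add: dehom_def hom_ev[OF fC.comm_ring_hom_ev])
  qed
  finally show ?thesis
    by (simp add: steenrod_op_ev[OF dehom_Pol[OF V]] lift.homs)
qed

text \<open>Cartan formula for h times the power M - e of the last variable, read with that variable
  equal to 1.\<close>

lemma steenrod_op_Sym:
  assumes h: "h \<in> Sym m e" "e \<le> M"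
  shows "steenrod_op M l h = (\<Sum>i\<le>l. Con (of_nat ((M - e) choose (l - i))) * steenrod q i h)"
proof -
  let ?K = "\<lambda>c::'a. fps_const (Con c)"
  let ?E = "ev ?K (\<lambda>i. fps_const (Var i) + fps_X * fps_const (Var i ^ q)) h"
  have "?E = lift_fps (1 + fps_X) ^ e * ev ?K shear h"
    unfolding one_plus_X_shear[symmetric]
    by (rule ev_scale) (use h in \<open>auto simp: Sym_def\<close>)
  moreover have "lift_fps ((1 + fps_X) ^ M) = lift_fps (1 + fps_X) ^ (M - e) * lift_fps (1 + fps_X :: 'a fps) ^ e"
    using h(2) by (simp add: lift.hom_power flip: power_add)
  ultimately have "steenrod_op M l h = fps_nth (?E * lift_fps ((1 + fps_X) ^ (M - e))) l"
    using h Sym_subset_Pol[of m e] by (subst steenrod_op_ev[of _ e]) (auto simp: lift.hom_power mult_ac)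
  also have "\<dots> = (\<Sum>i=0..l. Con (of_nat ((M - e) choose (l - i))) * steenrod q i h)"
    unfolding fps_mult_nth fps_nth_ev_translate[OF comm_ring_hom_Con] steenrod_eq_polar[OF q0]
    by (simp add: nth_lift fps_nth_one_plus_X_power mult.commute)
  finally show ?thesis by (simp add: atLeast0AtMost)
qed

section \<open>Congruences modulo dehomogenised hits\<close>

definition H :: "'a mpoly set" where
  "H = dehom ` hit q (Suc m) D"

lemma subspace_hit: "mp.subspace (hit q n e)"
  unfolding hit_def by (rule mp.subspace_span)

lemma subspace_H: "mp.subspace H"
proof (rule subspaceI)
  show "0 \<in> H" unfolding H_def using mp.subspace_0[OF subspace_hit] by (force intro: rev_image_eqI)
  show "x + y \<in> H" if "x \<in> H" "y \<in> H" for x y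
  proof -
    obtain u w where "u \<in> hit q (Suc m) D" "x = dehom u" "w \<in> hit q (Suc m) D" "y = dehom w"
      using \<open>x \<in> H\<close> \<open>y \<in> H\<close> by (auto simp: H_def)
    then show ?thesis unfolding H_def
      using mp.subspace_add[OF subspace_hit] by (intro image_eqI[of _ _ "u + w"]) (auto simp: dehom.homs)
  qed
  show "Con c * x \<in> H" if "x \<in> H" for c x
  proof -
    obtain y where "y \<in> hit q (Suc m) D" "x = dehom y" using \<open>x \<in> H\<close> by (auto simp: H_def)
    then show ?thesis unfolding H_def
      using subspace_Con[OF subspace_hit] by (intro image_eqI[of _ _ "Con c * y"]) (auto simp: dehom.homs)
  qed
qed

lemmas H_add = mp.subspace_add[OF subspace_H]
  and H_diff = mp.subspace_diff[OF subspace_H]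
  and H_sum = mp.subspace_sum[OF subspace_H]
  and H_0 = mp.subspace_0[OF subspace_H]
  and H_Con = subspace_Con[OF subspace_H]

lemma steenrod_op_in_H:
  assumes v: "v \<in> Pol m M" and l: "1 \<le> l" "M + (q - 1) * l = D"
  shows "steenrod_op M l v \<in> H"
proof -
  have "steenrod q l (hmg M v) \<in> hit q (Suc m) D"
    unfolding hit_def
  proof (intro mp.span_base UN_I[of l] imageI)
    show "hmg M v \<in> Sym (Suc m) (D - (q - 1) * l)" using hmg_Sym[OF v]
      by (simp only: l(2)[symmetric] diff_add_inverse2)
  qed (use l in auto)
  moreover have "dehom (steenrod q l (hmg M v)) = steenrod_op M l v"
    by (simp add: dehom_steenrod[OF hmg_Sym[OF v]] dehom_hmg[OF v])
  ultimately show ?thesis unfolding H_def by force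
qed

definition sgn_binom :: "nat \<Rightarrow> nat \<Rightarrow> 'a" where
  "sgn_binom e l = fps_nth ((1 - fps_X) ^ e) l"

text \<open>The hit \<open>steenrod_op M l v\<close> expresses \<open>polarL l v\<close> through
  smaller indices. The multiples \<open>sgn_binom d g\<close> of v satisfy the same recursion: their
  weighted sum is the coefficient of y^l in (1 + y)^M (1 - y J)^d = (1 + y)^(M - d), which is
  zero.\<close>

lemma polarL_cong_small:
  assumes v: "v \<in> Pol m e" and l: "e + (q - 1) * l \<le> D" "l < Q"
  shows "polarL l v - Con (sgn_binom d l) * v \<in> H"
  using l
proof (induction l rule: less_induct)
  case (less l)
  show ?case
  proof (cases "l = 0")
    case True
    then show ?thesis using H_0 by (simp add: sgn_binom_def fps_nth_one_minus_X_power)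
  next
    case False
    define M where "M = D - (q - 1) * l"
    have M: "M + (q - 1) * l = D" "e \<le> M" using less.prems by (auto simp: M_def)
    \<comment> \<open>The excess of M over d is exactly the upper number in
      \<open>choose_vanish\<close> with r = m - 1.\<close>
    have Md: "M = d + ((q - 1) * (Q - l) - 1)"
    proof -
      obtain r where r: "Q = l + r" "r > 0" using less.prems by (metis less_imp_add_positive)
      have "(q - 1) * r \<ge> 1" using r q2 by simp
      moreover have "(q - 1) * Q = (q - 1) * l + (q - 1) * r" by (simp only: r(1) add_mult_distrib2)
      moreover have "Q - l = r" using r(1) by simp
      ultimately show ?thesis using M(1) D_d by presburger
    qed
    have "(\<Sum>g\<le>l. shear_coeff M l g * sgn_binom d g) = fps_nth ((1 + fps_X) ^ M * J ^ d) l"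
      using shear_coeff_sum[where l = l and M = M and f = "(1 - fps_X) ^ d"] compose_z[of d 0] by (simp add: sgn_binom_def)
    also have "(1 + fps_X) ^ M * J ^ d = (1 + fps_X) ^ ((q - 1) * (Q - l) - 1)"
      using J by (simp add: Md power_add power_mult_distrib[symmetric] mult_ac)
    also have "fps_nth \<dots> l = 0"
      unfolding fps_nth_one_plus_X_power Q_def
      by (rule choose_vanish[OF q]) (use False less.prems in \<open>auto simp: Q_def\<close>)
    finally have z: "(\<Sum>g\<le>l. shear_coeff M l g * sgn_binom d g) = 0" .
    have "steenrod_op M l v \<in> H"
      by (rule steenrod_op_in_H) (use v M False Pol_mono[OF M(2), of m] in auto)
    moreover have "(\<Sum>g<l. Con (shear_coeff M l g) * (polarL g v - Con (sgn_binom d g) * v)) \<in> H"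
    proof (rule H_sum, rule H_Con, rule less.IH)
      fix g assume g: "g \<in> {..<l}"
      then have "(q - 1) * g \<le> (q - 1) * l" by (intro mult_le_mono2) auto
      then show "e + (q - 1) * g \<le> D" using less.prems by linarith
    qed (use less.prems in auto)
    ultimately have "steenrod_op M l v - (\<Sum>g<l. Con (shear_coeff M l g) * (polarL g v - Con (sgn_binom d g) * v)) \<in> H"
      by (rule H_diff)
    also have "steenrod_op M l v - (\<Sum>g<l. Con (shear_coeff M l g) * (polarL g v - Con (sgn_binom d g) * v)) = polarL l v - Con (sgn_binom d l) * v"
    proof -
      have a: "steenrod_op M l v = polarL l v + (\<Sum>g<l. Con (shear_coeff M l g) * polarL g v)"
        by (simp add: steenrod_op_def shear_coeff_same flip: lessThan_Suc_atMost)
      have "sgn_binom d l + (\<Sum>g<l. shear_coeff M l g * sgn_binom d g) = 0"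
        using z by (simp add: shear_coeff_same add.commute flip: lessThan_Suc_atMost)
      then have "(\<Sum>g<l. shear_coeff M l g * sgn_binom d g) = - sgn_binom d l"
        by (metis add.inverse_unique)
      then have "Con (\<Sum>g<l. shear_coeff M l g * sgn_binom d g) = - Con (sgn_binom d l)"
        by (simp only: Con.hom_uminus)
      then have "(\<Sum>g<l. Con (shear_coeff M l g) * (Con (sgn_binom d g) * v)) = - (Con (sgn_binom d l) * v)"
        by (simp only: Con.homs mult.assoc[symmetric] sum_distrib_right[symmetric] minus_mult_left)
      then show ?thesis
        by (simp add: a right_diff_distrib sum_subtractf)
    qed
    finally show ?thesis .
  qed
qed

lemma sgn_binom_eq_0: "d < l \<Longrightarrow> sgn_binom d l = 0"
  by (simp add: sgn_binom_def fps_nth_one_minus_X_power binomial_eq_0)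

text \<open>Use the congruence at l = d: a polynomial of degree below d has no coefficient of y^d
  after the substitution, while (1 - y)^d has coefficient 1 or -1 there.\<close>

lemma low_in_H:
  assumes v: "v \<in> Pol m e" and e: "e < d"
  shows "v \<in> H"
proof -
  have "polarL d v - Con (sgn_binom d d) * v \<in> H"
  proof (rule polarL_cong_small[OF v])
    have "(q - 1) * d \<le> (q - 1) * Q" using d_plus_m by (intro mult_le_mono2) simp
    then show "e + (q - 1) * d \<le> D" using e D_d by linarith
    show "d < Q" using d_plus_m m by simp
  qed
  moreover have "polarL d v = 0"
    unfolding polarL_def by (rule polar_eq_0) (use v e in \<open>auto simp: Pol_def supported_def\<close>)
  moreover have "sgn_binom d d = (-1) ^ d" by (simp add: sgn_binom_def fps_nth_one_minus_X_power)
  ultimately have "- (Con ((-1) ^ d) * v) \<in> H" by simp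
  from H_Con[OF this, of "- ((-1) ^ d)"] show ?thesis
    by (simp add: mult.assoc[symmetric] mult_single single_uminus flip: power_add mult_2)
qed

text \<open>Modulo hits, \<open>v(x + y L)\<close> equals \<open>(1 - y)\<^sup>d v(x)\<close>.\<close>

lemma polarL_cong:
  assumes v: "v \<in> Pol m e" and l: "e + (q - 1) * l \<le> D"
  shows "polarL l v - Con (sgn_binom d l) * v \<in> H"
  using l
proof (induction l rule: less_induct)
  case (less l)
  show ?case
  proof (cases "l < Q")
    case True
    then show ?thesis by (intro polarL_cong_small[OF v]) (use less.prems in auto)
  next
    case False
    define M where "M = D - (q - 1) * l"
    have M: "M + (q - 1) * l = D" "e \<le> M" using less.prems by (auto simp: M_def)
    \<comment> \<open>Beyond Q the degree bound forces e < d, so v itself lies in \<open>H\<close>;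
      the scalars no longer matter and only membership has to be propagated.\<close>
    have "(q - 1) * Q \<le> (q - 1) * l" using False by (intro mult_le_mono2) simp
    moreover have "(q - 1) * Q \<ge> 1" using q2 Q_ge m by simp
    ultimately have e: "e < d" using M D_d by linarith
    have vH: "v \<in> H" by (rule low_in_H[OF v e])
    have "polarL g v \<in> H" if "g < l" for g
    proof -
      have "(q - 1) * g \<le> (q - 1) * l" using that by (intro mult_le_mono2) auto
      then have "polarL g v - Con (sgn_binom d g) * v \<in> H" using less.IH[OF that] less.prems by linarith
      from H_add[OF this H_Con[OF vH, of "sgn_binom d g"]] show ?thesis by simp
    qed
    then have "(\<Sum>g<l. Con (shear_coeff M l g) * polarL g v) \<in> H"
      by (intro H_sum H_Con) auto
    moreover have "steenrod_op M l v \<in> H"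
      by (rule steenrod_op_in_H) (use v M False Pol_mono[OF M(2), of m] Q_ge m in auto)
    ultimately have "steenrod_op M l v - (\<Sum>g<l. Con (shear_coeff M l g) * polarL g v) \<in> H" by (simp add: H_diff)
    then have "polarL l v \<in> H" by (simp add: steenrod_op_def lessThan_Suc_atMost[symmetric] shear_coeff_same)
    moreover have "d < l" using False d_plus_m m by linarith
    ultimately show ?thesis by (simp add: sgn_binom_eq_0)
  qed
qed

section \<open>The inverse substitution\<close>

definition Ls :: "'a mpoly \<Rightarrow> 'a mpoly" where
  "Ls = ev Con L"

sublocale Ls: comm_ring_hom Ls
  unfolding Ls_def by (rule Con.comm_ring_hom_ev)

lemma Ls_Var [simp]: "Ls (Var i) = L i"
  by (simp add: Ls_def)

definition monom_fun :: "(nat \<Rightarrow> nat) \<Rightarrow> 'a mpoly" where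
  "monom_fun \<beta> = (\<Prod>i<m. Var i ^ \<beta> i)"

definition exp_sum :: "(nat \<Rightarrow> nat) \<Rightarrow> nat" where
  "exp_sum \<beta> = (\<Sum>i<m. \<beta> i)"

lemma monom_fun_Sym: "monom_fun \<beta> \<in> Sym m (exp_sum \<beta>)"
proof -
  have "Var i ^ \<beta> i \<in> (Sym m (\<beta> i) :: 'a mpoly set)" if "i < m" for i
    using Sym_power[OF Var_Sym[OF that], of "\<beta> i"] by simp
  then show ?thesis unfolding monom_fun_def exp_sum_def by (intro Sym_prod) auto
qed

text \<open>The extension of \<open>Psi\<close> to power series that fixes the variable.\<close>

definition theta :: "'a mpoly fps \<Rightarrow> 'a mpoly fps" where
  "theta f = Abs_fps (\<lambda>n. \<Sum>k\<le>n. fps_nth (Psi (fps_nth f k)) (n - k))"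

lemma theta_nth: "fps_nth (theta f) n = (\<Sum>k\<le>n. polarL (n - k) (fps_nth f k))"
  by (simp add: theta_def Psi_nth)

lemma theta_const: "theta (fps_const x) = Psi x"
proof (rule fps_ext)
  fix n
  have "fps_nth (theta (fps_const x)) n = (\<Sum>k\<in>{0}. polarL (n - k) (fps_nth (fps_const x) k))"
    unfolding theta_nth by (rule sum.mono_neutral_right) auto
  then show "fps_nth (theta (fps_const x)) n = fps_nth (Psi x) n" by (simp add: Psi_nth)
qed

lemma theta_X: "theta fps_X = fps_X"
proof (rule fps_ext)
  fix n
  show "fps_nth (theta fps_X) n = fps_nth fps_X n"
  proof (cases n)
    case (Suc k)
    have "fps_nth (theta fps_X) n = (\<Sum>k\<in>{1}. polarL (n - k) (fps_nth fps_X k))"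
      unfolding theta_nth by (rule sum.mono_neutral_right) (use Suc in auto)
    also have "\<dots> = fps_nth 1 (n - 1)" using Psi_nth[of 1 "n - 1"] by simp
    finally show ?thesis using Suc by (simp del: fps_one_nth) simp
  qed (simp add: theta_nth)
qed

lemma comm_ring_hom_theta: "comm_ring_hom theta"
proof
  show "theta 1 = 1" using theta_const[of 1] by simp
  show "theta (x + y) = theta x + theta y" for x y
    by (rule fps_ext) (simp add: theta_nth polarL_add sum.distrib)
  show "theta (f * g) = theta f * theta g" for f g
  proof (rule fps_ext)
    fix n
    define G where "G i j a b = polarL a (fps_nth f i) * polarL b (fps_nth g j)" for i j a b
    have polarL_mult: "polarL k (x * y) = (\<Sum>a\<le>k. polarL a x * polarL (k - a) y)" for k x y
      by (simp add: Psi.homs fps_mult_nth atLeast0AtMost flip: Psi_nth)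
    have polarL_sum: "polarL k (sum x S) = (\<Sum>i\<in>S. polarL k (x i))" for k and x :: "nat \<Rightarrow> _" and S
      by (simp add: Psi.homs fps_sum_nth flip: Psi_nth)
    have "fps_nth (theta (f * g)) n = (\<Sum>k\<le>n. \<Sum>i\<le>k. \<Sum>a\<le>n - k. G i (k - i) a (n - k - a))"
      by (simp add: theta_nth fps_mult_nth atLeast0AtMost polarL_sum polarL_mult G_def)
    also have "\<dots> = (\<Sum>(k, i, a)\<in>(SIGMA k:{..n}. {..k} \<times> {..n - k}). G i (k - i) a (n - k - a))"
      by (simp add: sum.Sigma sum.cartesian_product)
    \<comment> \<open>Regroup by s = i + a, the total degree in y coming from
      \<open>theta f\<close>, with j = k - i the index taken from g.\<close>
    also have "\<dots> = (\<Sum>(s, i, j)\<in>(SIGMA s:{..n}. {..s} \<times> {..n - s}). G i j (s - i) (n - s - j))"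
      by (rule sum.reindex_bij_witness[where j = "\<lambda>(k, i, a). (i + a, i, k - i)" and i = "\<lambda>(s, i, j). (i + j, i, s - i)"])
        (auto simp: add.commute)
    also have "\<dots> = (\<Sum>s\<le>n. \<Sum>i\<le>s. \<Sum>j\<le>n - s. G i j (s - i) (n - s - j))"
      by (simp add: sum.Sigma sum.cartesian_product)
    also have "\<dots> = fps_nth (theta f * theta g) n"
      by (simp add: theta_nth fps_mult_nth atLeast0AtMost G_def sum_product)
    finally show "fps_nth (theta (f * g)) n = fps_nth (theta f * theta g) n" .
  qed
qed

sublocale theta: comm_ring_hom theta
  by (rule comm_ring_hom_theta)

text \<open>The recursion solves (1 - y) chi + y chi^q = x_i coefficientwise; chi^q contributes only
  at multiples of q, through the coefficient of index n div q.\<close>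

function chi_nth :: "nat \<Rightarrow> nat \<Rightarrow> 'a mpoly" where
  "chi_nth i 0 = Var i"
| "chi_nth i (Suc n) = chi_nth i n - (if q dvd n then chi_nth i (n div q) ^ q else 0)"
  by pat_completeness auto
termination
  by (relation "measure snd") (auto simp: less_Suc_eq_le)

definition chi :: "nat \<Rightarrow> 'a mpoly fps" where
  "chi i = Abs_fps (chi_nth i)"

lemma chi_eq: "(1 - fps_X) * chi i + fps_X * chi i ^ q = fps_const (Var i)"
proof (rule fps_ext)
  show "fps_nth ((1 - fps_X) * chi i + fps_X * chi i ^ q) n = fps_nth (fps_const (Var i)) n" for n
    by (cases n) (simp_all add: chi_def left_diff_distrib nth_power_q)
qed

text \<open>Both y f and y f^q involve, at index n, only coefficients of f below n, so the equation
  determines f recursively.\<close>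

lemma substitution_unique:
  assumes e: "(1 - fps_X) * f + fps_X * f ^ q = (1 - fps_X) * g + fps_X * g ^ q"
  shows "f = (g :: 'a mpoly fps)"
proof (rule fps_ext)
  fix n
  show "fps_nth f n = fps_nth g n"
  proof (induction n rule: less_induct)
    case (less n)
    show ?case
    proof (cases n)
      case 0
      then show ?thesis using arg_cong[OF e, of "\<lambda>h. fps_nth h 0"] by simp
    next
      case (Suc k)
      have "fps_nth f k = fps_nth g k" "fps_nth f (k div q) = fps_nth g (k div q)"
        using less.IH[of k] less.IH[of "k div q"] Suc by (auto simp: less_Suc_eq_le)
      then show ?thesis using arg_cong[OF e, of "\<lambda>h. fps_nth h (Suc k)"] Suc
        by (simp add: left_diff_distrib nth_power_q split: if_splits)
    qed
  qed
qed

lemma Psi_Var: "Psi (Var i) = fps_const (Var i) + fps_X * fps_const (L i)"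
  by (simp add: Psi_def)

text \<open>The constant x_i solves the transformed equation, since (1 - y) x_i + y x_i^q = x_i + y
  L_i is the image of x_i; uniqueness of the solution finishes.\<close>

lemma theta_chi: "theta (chi i) = fps_const (Var i)"
proof (rule substitution_unique)
  have "(1 - fps_X) * theta (chi i) + fps_X * theta (chi i) ^ q = theta ((1 - fps_X) * chi i + fps_X * chi i ^ q)"
    by (simp add: theta.homs theta_X)
  also have "\<dots> = Psi (Var i)" by (simp add: chi_eq theta_const)
  also have "\<dots> = (1 - fps_X) * fps_const (Var i) + fps_X * fps_const (Var i) ^ q"
    by (simp add: Psi_Var L_def algebra_simps flip: fps_const_sub)
  finally show "(1 - fps_X) * theta (chi i) + fps_X * theta (chi i) ^ q =
    (1 - fps_X) * fps_const (Var i) + fps_X * fps_const (Var i) ^ q" .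
qed

text \<open>Each power of y may cost q - 1 degrees, the same rate at which
  \<open>polarL_cong\<close> charges for its index.\<close>

definition graded_series :: "nat \<Rightarrow> 'a mpoly fps \<Rightarrow> bool" where
  "graded_series b f \<longleftrightarrow> (\<forall>k. fps_nth f k \<in> Pol m (b + (q - 1) * k))"

lemma graded_series_mult:
  assumes "graded_series a f" "graded_series b g"
  shows "graded_series (a + b) (f * g)"
  unfolding graded_series_def fps_mult_nth
proof (intro allI mp.subspace_sum[OF subspace_Pol])
  fix k i :: nat assume i: "i \<in> {0..k}"
  have "fps_nth f i * fps_nth g (k - i) \<in> Pol m ((a + (q - 1) * i) + (b + (q - 1) * (k - i)))"
    using assms by (intro Pol_mult) (auto simp: graded_series_def)
  moreover have "(q - 1) * i + (q - 1) * (k - i) = (q - 1) * k"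
    using i by (simp flip: add_mult_distrib2)
  ultimately show "fps_nth f i * fps_nth g (k - i) \<in> Pol m (a + b + (q - 1) * k)"
    by (simp add: add_ac)
qed

lemma graded_series_one: "graded_series 0 1"
  unfolding graded_series_def
proof
  fix k
  have "1 \<in> Pol m ((q - 1) * k)" "0 \<in> Pol m ((q - 1) * k)"
    using one_Sym[of m] Sym_subset_Pol[of m 0] Pol_mono[of 0 _ m] mp.subspace_0[OF subspace_Pol] by auto
  then show "fps_nth 1 k \<in> Pol m (0 + (q - 1) * k)" by (cases k) auto
qed

lemma graded_series_power: "graded_series b f \<Longrightarrow> graded_series (b * k) (f ^ k)"
  by (induction k) (simp_all add: graded_series_one graded_series_mult)

lemma graded_series_prod: "finite I \<Longrightarrow> (\<And>i. i \<in> I \<Longrightarrow> graded_series (b i) (f i)) \<Longrightarrow> graded_series (sum b I) (prod f I)"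
  by (induction I rule: finite_induct) (simp_all add: graded_series_one graded_series_mult)

lemma graded_series_chi:
  assumes "i < m"
  shows "graded_series 1 (chi i)"
proof -
  have "chi_nth i n \<in> Pol m (1 + (q - 1) * n)" for n
  proof (induction n rule: less_induct)
    case (less n)
    show ?case
    proof (cases n)
      case 0
      then show ?thesis using Var_Sym[OF assms] Sym_subset_Pol by auto
    next
      case (Suc k)
      have 1: "chi_nth i k \<in> Pol m (1 + (q - 1) * n)"
        using less.IH[of k] Suc Pol_mono[of "1 + (q - 1) * k" "1 + (q - 1) * n" m] by auto
      have 2: "chi_nth i (k div q) ^ q \<in> Pol m (1 + (q - 1) * n)" if dv: "q dvd k"
      proof -
        obtain c where c: "k = q * c" using dv by blast
        have "chi_nth i c \<in> Pol m (1 + (q - 1) * c)"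
          by (rule less.IH) (use Suc c q0 in \<open>auto simp: less_Suc_eq_le\<close>)
        then have "chi_nth i c ^ q \<in> Pol m ((1 + (q - 1) * c) * q)" by (rule Pol_power)
        moreover have "(1 + (q - 1) * c) * q = 1 + (q - 1) * n"
        proof -
          obtain q' where "q = Suc q'" using q0 by (cases q) auto
          then show ?thesis by (simp add: Suc c algebra_simps)
        qed
        ultimately show ?thesis using c q0 by simp
      qed
      show ?thesis
        using 1 2 mp.subspace_diff[OF subspace_Pol 1 2] mp.subspace_0[OF subspace_Pol] by (simp add: Suc)
    qed
  qed
  then show ?thesis by (simp add: graded_series_def chi_def)
qed

definition chi_monom_fun :: "(nat \<Rightarrow> nat) \<Rightarrow> 'a mpoly fps" where
  "chi_monom_fun \<gamma> = (\<Prod>i<m. chi i ^ \<gamma> i)"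

lemma graded_series_chi_monom_fun: "graded_series (exp_sum \<gamma>) (chi_monom_fun \<gamma>)"
  unfolding chi_monom_fun_def exp_sum_def using graded_series_power[OF graded_series_chi] by (intro graded_series_prod) fastforce+

lemma theta_chi_monom_fun: "theta (chi_monom_fun \<gamma>) = fps_const (monom_fun \<gamma>)"
proof -
  interpret c: comm_ring_hom "fps_const :: 'a mpoly \<Rightarrow> _" by (rule comm_ring_hom_fps_const)
  show ?thesis by (simp add: chi_monom_fun_def monom_fun_def theta.homs theta_chi c.hom_prod)
qed

definition geo :: "'a mpoly fps" where
  "geo = lift_fps (inverse (1 - fps_X))"

lemma geo: "(1 - fps_X) * geo = 1"
proof -
  have "(1 - fps_X) * inverse (1 - fps_X) = (1 :: 'a fps)" by (rule inverse_mult_eq_1') simp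
  then have "lift_fps ((1 - fps_X) * inverse (1 - fps_X)) = (1 :: 'a mpoly fps)" by simp
  then show ?thesis by (simp add: geo_def lift.homs)
qed

lemma chi_geo: "chi i = geo * (fps_const (Var i) + (- fps_X) * chi i ^ q)"
proof -
  have "(1 - fps_X) * chi i = fps_const (Var i) + (- fps_X) * chi i ^ q"
    using chi_eq[of i] by (simp add: eq_diff_eq)
  then have "geo * (fps_const (Var i) + (- fps_X) * chi i ^ q) = geo * ((1 - fps_X) * chi i)"
    by (simp only:)
  also have "\<dots> = ((1 - fps_X) * geo) * chi i" by (simp only: mult_ac)
  finally show ?thesis by (simp only: geo mult_1_left)
qed

text \<open>Expanding chi_i = (x_i - y chi_i^q)/(1 - y) leaves chi only inside a q-th power, so that
  a coefficient can be traced back to one with index divided by q.\<close>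

lemma chi_monom_fun_expand:
  "chi_monom_fun \<gamma> = (\<Sum>\<epsilon>\<in>(\<Pi>\<^sub>E i\<in>{..<m}. {..\<gamma> i}). fps_const (\<Prod>i<m. of_nat (\<gamma> i choose \<epsilon> i) * Var i ^ (\<gamma> i - \<epsilon> i)) *
     (geo ^ exp_sum \<gamma> * (- fps_X) ^ exp_sum \<epsilon> * chi_monom_fun \<epsilon> ^ q))"
proof -
  interpret c: comm_ring_hom "fps_const :: 'a mpoly \<Rightarrow> _" by (rule comm_ring_hom_fps_const)
  have "chi_monom_fun \<gamma> = (\<Prod>i<m. (geo * (fps_const (Var i) + (- fps_X) * chi i ^ q)) ^ \<gamma> i)"
    unfolding chi_monom_fun_def by (intro prod.cong refl arg_cong2[where f = "(^)"] chi_geo)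
  also have "\<dots> = geo ^ exp_sum \<gamma> * (\<Prod>i<m. (fps_const (Var i) + (- fps_X) * chi i ^ q) ^ \<gamma> i)"
    by (simp only: power_mult_distrib prod.distrib exp_sum_def power_sum)
  also have "(\<Prod>i<m. (fps_const (Var i) + (- fps_X) * chi i ^ q) ^ \<gamma> i) =
      (\<Sum>\<epsilon>\<in>(\<Pi>\<^sub>E i\<in>{..<m}. {..\<gamma> i}). \<Prod>i<m. of_nat (\<gamma> i choose \<epsilon> i) * fps_const (Var i) ^ (\<gamma> i - \<epsilon> i) * ((- fps_X) * chi i ^ q) ^ \<epsilon> i)"
    by (rule prod_add_power) simp
  also have "\<dots> = (\<Sum>\<epsilon>\<in>(\<Pi>\<^sub>E i\<in>{..<m}. {..\<gamma> i}). fps_const (\<Prod>i<m. of_nat (\<gamma> i choose \<epsilon> i) * Var i ^ (\<gamma> i - \<epsilon> i)) *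
      ((- fps_X) ^ exp_sum \<epsilon> * chi_monom_fun \<epsilon> ^ q))"
  proof (rule sum.cong[OF refl])
    fix \<epsilon>
    have "chi_monom_fun \<epsilon> ^ q = (\<Prod>i<m. (chi i ^ q) ^ \<epsilon> i)"
      unfolding chi_monom_fun_def prod_power_distrib by (intro prod.cong refl) (simp add: mult.commute flip: power_mult)
    moreover have "(- fps_X) ^ exp_sum \<epsilon> = (\<Prod>i<m. (- fps_X :: 'a mpoly fps) ^ \<epsilon> i)"
      by (simp only: exp_sum_def power_sum)
    ultimately show "(\<Prod>i<m. of_nat (\<gamma> i choose \<epsilon> i) * fps_const (Var i) ^ (\<gamma> i - \<epsilon> i) * ((- fps_X) * chi i ^ q) ^ \<epsilon> i) =
      fps_const (\<Prod>i<m. of_nat (\<gamma> i choose \<epsilon> i) * Var i ^ (\<gamma> i - \<epsilon> i)) * ((- fps_X) ^ exp_sum \<epsilon> * chi_monom_fun \<epsilon> ^ q)"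
      by (simp only: power_mult_distrib prod.distrib c.homs mult.assoc)
  qed
  finally show ?thesis by (simp only: sum_distrib_left mult_ac)
qed

text \<open>Induction on s: extracting q-th powers reduces the coefficient at q^(s + 1) - \<delta>
  to coefficients at q^s - \<delta>1 with q \<delta>1 = \<delta> + |\<epsilon>| + i, and the four
  inequalities persist under this passage. At s = 0 they are contradictory, as 1 \<le> \<delta> <
  \<mu> \<le> 1.\<close>

lemma nth_geo_power_chi_monom_fun:
  assumes "1 \<le> \<delta>" "\<delta> < \<mu>" "\<mu> \<le> s + 1" "\<mu> + exp_sum \<gamma> \<le> q * \<delta>"
  shows "fps_nth (geo ^ \<mu> * chi_monom_fun \<gamma>) (q ^ s - \<delta>) = 0"
  using assms
proof (induction s arbitrary: \<delta> \<mu> \<gamma>)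
  case (Suc s)
  define N where "N = q ^ Suc s - \<delta>"
  have "Suc s < q ^ Suc s" using less_exp[of "Suc s"] power_mono[of 2 q "Suc s"] q2 by linarith
  then have N: "N + \<delta> = q * q ^ s" using Suc.prems by (simp add: N_def)
  have summand: "fps_nth (geo ^ (\<mu> + exp_sum \<gamma>) * (- fps_X) ^ exp_sum \<epsilon> * chi_monom_fun \<epsilon> ^ q) N = 0"
    if \<epsilon>: "\<epsilon> \<in> (\<Pi>\<^sub>E i\<in>{..<m}. {..\<gamma> i})" for \<epsilon>
  proof -
    have B: "exp_sum \<epsilon> \<le> exp_sum \<gamma>" unfolding exp_sum_def using \<epsilon> by (intro sum_mono) auto
    \<comment> \<open>m1 is (\<mu> + |\<gamma>|)/q rounded up and \<rho> the amount added, so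
      \<open>geo\<close> to the power \<mu> + |\<gamma>| equals (1 - y)^\<rho> times a q-th
      power.\<close>
    define m1 \<rho> where "m1 = (\<mu> + exp_sum \<gamma> + (q - 1)) div q" and "\<rho> = q - 1 - (\<mu> + exp_sum \<gamma> + (q - 1)) mod q"
    have r: "q * m1 = \<mu> + exp_sum \<gamma> + \<rho>" "\<rho> < q"
    proof -
      have "q * m1 + (\<mu> + exp_sum \<gamma> + (q - 1)) mod q = \<mu> + exp_sum \<gamma> + (q - 1)"
        unfolding m1_def by (rule mult_div_mod_eq)
      moreover have "(\<mu> + exp_sum \<gamma> + (q - 1)) mod q < q" using q0 by simp
      ultimately show "q * m1 = \<mu> + exp_sum \<gamma> + \<rho>" "\<rho> < q" unfolding \<rho>_def by linarith+
    qed
    define G where "G = geo ^ m1 * chi_monom_fun \<epsilon>"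
    have "geo ^ (\<mu> + exp_sum \<gamma>) = geo ^ (\<mu> + exp_sum \<gamma>) * ((1 - fps_X) * geo) ^ \<rho>" by (simp add: geo)
    also have "\<dots> = (1 - fps_X) ^ \<rho> * geo ^ (m1 * q)"
    proof -
      have "m1 * q = \<mu> + exp_sum \<gamma> + \<rho>" using r(1) by (simp only: mult.commute)
      then show ?thesis by (simp only: power_add power_mult_distrib mult_ac)
    qed
    finally have e00: "geo ^ (\<mu> + exp_sum \<gamma>) * (- fps_X) ^ exp_sum \<epsilon> * chi_monom_fun \<epsilon> ^ q = (- fps_X) ^ exp_sum \<epsilon> * ((1 - fps_X) ^ \<rho> * G ^ q)"
      by (simp only: G_def power_mult_distrib power_mult mult_ac)
    have mX: "(- fps_X :: 'a mpoly fps) ^ exp_sum \<epsilon> = fps_const ((- 1) ^ exp_sum \<epsilon>) * fps_X ^ exp_sum \<epsilon>"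
      by (subst power_minus) (simp flip: fps_const_neg fps_const_power)
    have e: "fps_nth (geo ^ (\<mu> + exp_sum \<gamma>) * (- fps_X) ^ exp_sum \<epsilon> * chi_monom_fun \<epsilon> ^ q) N =
        (- 1) ^ exp_sum \<epsilon> * (if N < exp_sum \<epsilon> then 0 else fps_nth ((1 - fps_X) ^ \<rho> * G ^ q) (N - exp_sum \<epsilon>))"
      by (subst e00, subst mX) (simp add: mult.assoc fps_X_power_mult_nth)
    have "fps_nth ((1 - fps_X) ^ \<rho> * G ^ q) (N - exp_sum \<epsilon>) = 0" if N': "\<not> N < exp_sum \<epsilon>"
      unfolding fps_mult_nth[of "(1 - fps_X) ^ \<rho>"]
    proof (intro sum.neutral ballI)
      fix i assume i: "i \<in> {0..N - exp_sum \<epsilon>}"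
      show "fps_nth ((1 - fps_X) ^ \<rho>) i * fps_nth (G ^ q) (N - exp_sum \<epsilon> - i) = 0"
      proof (cases "i \<le> \<rho> \<and> q dvd N - exp_sum \<epsilon> - i")
        case True
        then obtain w where w: "N - exp_sum \<epsilon> - i = q * w" by blast
        define \<delta>1 where "\<delta>1 = q ^ s - w"
        have "q * w \<le> q * q ^ s" using w N by linarith
        then have "w \<le> q ^ s" using q0 by simp
        then have w': "w + \<delta>1 = q ^ s" by (simp add: \<delta>1_def)
        have "q * w + q * \<delta>1 = q * q ^ s" by (simp flip: w' add: add_mult_distrib2)
        then have qd: "q * \<delta>1 = \<delta> + exp_sum \<epsilon> + i" using w N N' i by simp
        have m1: "m1 \<le> \<delta>"
        proof -
          have "q * m1 < q * (\<delta> + 1)" using r Suc.prems by simp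
          then have "m1 < \<delta> + 1" by (simp only: mult_less_cancel1)
          then show ?thesis by simp
        qed
        have "fps_nth G (q ^ s - \<delta>1) = 0"
          unfolding G_def
        proof (rule Suc.IH)
          show "1 \<le> \<delta>1" using qd Suc.prems by (cases \<delta>1) auto
          \<comment> \<open>Add \<delta> < \<mu>, |\<epsilon>| \<le> |\<gamma>| and i \<le>
            \<rho>.\<close>
          have "q * \<delta>1 < q * m1" using qd r True Suc.prems B by linarith
          then show "\<delta>1 < m1" by simp
          show "m1 \<le> s + 1" using m1 Suc.prems by linarith
          show "m1 + exp_sum \<epsilon> \<le> q * \<delta>1" using m1 qd by linarith
        qed
        moreover have "q ^ s - \<delta>1 = w" using w' by linarith
        ultimately have "fps_nth (G ^ q) (N - exp_sum \<epsilon> - i) = 0"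
          unfolding w using q0 by (simp add: nth_power_q)
        then show ?thesis by simp
      next
        case False
        then show ?thesis by (auto simp: nth_power_q fps_nth_one_minus_X_power binomial_eq_0)
      qed
    qed
    then show ?thesis by (simp add: e)
  qed
  have "geo ^ \<mu> * chi_monom_fun \<gamma> = (\<Sum>\<epsilon>\<in>(\<Pi>\<^sub>E i\<in>{..<m}. {..\<gamma> i}).
      fps_const (\<Prod>i<m. of_nat (\<gamma> i choose \<epsilon> i) * Var i ^ (\<gamma> i - \<epsilon> i)) *
     (geo ^ (\<mu> + exp_sum \<gamma>) * (- fps_X) ^ exp_sum \<epsilon> * chi_monom_fun \<epsilon> ^ q))"
    by (subst chi_monom_fun_expand) (simp only: sum_distrib_left power_add mult_ac)
  then show ?case
    unfolding N_def[symmetric] by (simp add: fps_sum_nth summand)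
qed simp

lemma one_minus_X_power_q: "(1 - fps_X) ^ (q ^ r) = (1 - fps_X ^ (q ^ r) :: 'a mpoly fps)"
proof (induction r)
  case (Suc r)
  have "(1 - fps_X) ^ (q ^ Suc r) = ((1 - fps_X) ^ (q ^ r) :: 'a mpoly fps) ^ q"
    by (simp add: mult.commute flip: power_mult)
  then show ?case by (simp add: Suc freshman_fps_diff mult.commute flip: power_mult)
qed simp

text \<open>x^\<beta> h(L) is the coefficient of y^j in x^\<beta> h(x + y L), the image under
  \<open>theta\<close> of chi^\<beta> h. By the congruence it becomes h times the coefficient of y^j
  in (1 - y)^d chi^\<beta>. As (1 - y)^d = (1 - y^Q)(1 - y)^(-m) and j < Q, this coefficient
  vanishes by the digit recursion with \<delta> = Q - j; here d < j means \<delta> < m.\<close>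

lemma high_in_H:
  assumes h: "h \<in> Sym m j" and j: "d < j" "exp_sum \<beta> + q * j \<le> D"
  shows "monom_fun \<beta> * Ls h \<in> H"
proof -
  interpret c: comm_ring_hom "fps_const :: 'a mpoly \<Rightarrow> _" by (rule comm_ring_hom_fps_const)
  have "q * j < q * Q" using j D_qQ by linarith
  then have jQ: "j < Q" by simp
  define w where "w k = fps_nth (chi_monom_fun \<beta>) k * h" for k
  have "theta (chi_monom_fun \<beta> * fps_const h) = fps_const (monom_fun \<beta>) * Psi h"
    by (simp add: theta.homs theta_chi_monom_fun theta_const)
  moreover have "fps_nth (theta (chi_monom_fun \<beta> * fps_const h)) j = (\<Sum>k\<le>j. polarL (j - k) (w k))"
    by (simp add: theta_nth w_def)
  ultimately have "fps_nth (fps_const (monom_fun \<beta>) * Psi h) j = (\<Sum>k\<le>j. polarL (j - k) (w k))"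
    by (simp only:)
  moreover have "polarL j h = Ls h"
    unfolding polarL_def Ls_def by (rule polar_top) (use h in \<open>auto simp: Sym_def\<close>)
  ultimately have 1: "monom_fun \<beta> * Ls h = (\<Sum>k\<le>j. polarL (j - k) (w k))"
    by (simp add: Psi_nth)
  have "(\<Sum>k\<le>j. polarL (j - k) (w k) - Con (sgn_binom d (j - k)) * w k) \<in> H"
  proof (rule H_sum, rule polarL_cong)
    fix k assume k: "k \<in> {..j}"
    show "w k \<in> Pol m ((exp_sum \<beta> + (q - 1) * k) + j)"
      unfolding w_def using graded_series_chi_monom_fun[of \<beta>] h Sym_subset_Pol by (intro Pol_mult) (auto simp: graded_series_def)
    \<comment> \<open>The cost of the k-th coefficient of chi^\<beta> and that of
      \<open>polarL (j - k)\<close> add up to (q - 1) j, so the same bound |\<beta>| + q j serves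
      every k.\<close>
    have "(q - 1) * k + (q - 1) * (j - k) = (q - 1) * j"
      using k by (simp flip: add_mult_distrib2)
    moreover have "j + (q - 1) * j = q * j" using q0 by (cases q) auto
    ultimately show "exp_sum \<beta> + (q - 1) * k + j + (q - 1) * (j - k) \<le> D" using j by linarith
  qed
  moreover have "(\<Sum>k\<le>j. Con (sgn_binom d (j - k)) * w k) = 0"
  proof -
    have "(\<Sum>k\<le>j. Con (sgn_binom d (j - k)) * w k) = fps_nth (chi_monom_fun \<beta> * lift_fps ((1 - fps_X) ^ d)) j * h"
      by (simp add: fps_mult_nth[of "chi_monom_fun \<beta>"] nth_lift sgn_binom_def w_def atLeast0AtMost sum_distrib_left sum_distrib_right mult_ac)
    also have "chi_monom_fun \<beta> * lift_fps ((1 - fps_X) ^ d) = (1 - fps_X) ^ Q * (geo ^ m * chi_monom_fun \<beta>)"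
    proof -
      have "(1 - fps_X) ^ Q * geo ^ m = (1 - fps_X) ^ d * ((1 - fps_X) * geo) ^ m"
        by (simp add: d_plus_m[symmetric] power_add power_mult_distrib mult_ac)
      then have "(1 - fps_X) ^ Q * geo ^ m = lift_fps ((1 - fps_X) ^ d)"
        by (simp add: geo lift.homs)
      then show ?thesis by (simp only: mult.assoc[symmetric]) (rule mult.commute)
    qed
    also have "\<dots> = geo ^ m * chi_monom_fun \<beta> - fps_X ^ Q * (geo ^ m * chi_monom_fun \<beta>)"
      by (simp only: Q_def one_minus_X_power_q left_diff_distrib mult_1_left)
    also have "fps_nth \<dots> j = fps_nth (geo ^ m * chi_monom_fun \<beta>) (q ^ (m - 1) - (Q - j))"
    proof -
      have "q ^ (m - 1) - (Q - j) = j" using jQ unfolding Q_def by linarith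
      then show ?thesis using jQ by (simp add: fps_X_power_mult_nth)
    qed
    also have "\<dots> = 0"
    proof (rule nth_geo_power_chi_monom_fun)
      show "1 \<le> Q - j" using jQ by simp
      show "Q - j < m" using j d_plus_m jQ by linarith
      show "m \<le> m - 1 + 1" by simp
      show "m + exp_sum \<beta> \<le> q * (Q - j)" using j D_qQ by (simp add: diff_mult_distrib2)
    qed
    finally show ?thesis by simp
  qed
  ultimately show ?thesis by (simp add: 1 sum_subtractf)
qed

section \<open>The substitution on the basis \<open>x\<^sup>\<beta> h(L)\<close>\<close>

text \<open>The map t -> t^q - t is additive, so it can be applied to x_i and y L_i
  separately.\<close>

lemma Psi_L: "Psi (L i) = (1 - fps_X) * fps_const (L i) + fps_X ^ q * fps_const (L i ^ q)"
proof -
  have "Psi (L i) = Psi (Var i) ^ q - Psi (Var i)"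
    by (simp add: L_def Psi.homs)
  also have "\<dots> = (fps_const (Var i) + fps_X * fps_const (L i)) ^ q - (fps_const (Var i) + fps_X * fps_const (L i))"
    by (simp only: Psi_Var)
  also have "\<dots> = fps_const (Var i ^ q) - fps_const (Var i) + (fps_X ^ q * fps_const (L i ^ q) - fps_X * fps_const (L i))"
    by (simp add: freshman_fps power_mult_distrib)
  also have "fps_const (Var i ^ q) - fps_const (Var i) = fps_const (L i)" by (simp add: L_def)
  finally show ?thesis by (simp add: algebra_simps)
qed

text \<open>By homogeneity h((1 - y) L + y^q L^q) splits by the degree i in L^q, and each part is
  P^i h evaluated at L. Here Steenrod operations in the smaller number of variables enter.\<close>

lemma Psi_Ls:
  assumes h: "h \<in> Sym m j"
  shows "Psi (Ls h) = (\<Sum>i\<le>j. lift_fps ((1 - fps_X) ^ (j - i) * fps_X ^ (q * i)) * fps_const (Ls (steenrod q i h)))"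
proof -
  let ?K = "\<lambda>c::'a. fps_const (Con c)"
  have K: "Psi (Con c) = ?K c" for c by (simp add: Psi_def)
  have "Psi (Ls h) = ev ?K (\<lambda>i. (1 - fps_X) * fps_const (L i) + fps_X ^ q * fps_const (L i ^ q)) h"
    unfolding Ls_def hom_ev[OF Psi.comm_ring_hom_axioms] by (simp add: K Psi_L)
  also have "\<dots> = (\<Sum>i\<le>j. (1 - fps_X) ^ (j - i) * (fps_X ^ q) ^ i * polar ?K i (\<lambda>i. fps_const (L i)) (\<lambda>i. fps_const (L i ^ q)) h)"
    by (rule ev_combination) (use h in \<open>auto simp: Sym_def\<close>)
  also have "\<dots> = (\<Sum>i\<le>j. lift_fps ((1 - fps_X) ^ (j - i) * fps_X ^ (q * i)) * fps_const (Ls (steenrod q i h)))"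
    by (intro sum.cong refl)
      (simp add: Ls_def ev_steenrod[OF comm_ring_hom_Con q0] hom_polar[OF comm_ring_hom_fps_const] lift.homs power_mult)
  finally show ?thesis .
qed

definition multi_choose :: "(nat \<Rightarrow> nat) \<Rightarrow> (nat \<Rightarrow> nat) \<Rightarrow> 'a" where
  "multi_choose \<beta> \<epsilon> = (\<Prod>i<m. of_nat (\<beta> i choose \<epsilon> i))"

lemma Psi_monom_fun:
  "Psi (monom_fun \<beta>) = (\<Sum>\<epsilon>\<in>(\<Pi>\<^sub>E i\<in>{..<m}. {..\<beta> i}). fps_X ^ exp_sum \<epsilon> * fps_const (Con (multi_choose \<beta> \<epsilon>) * monom_fun (\<lambda>i. \<beta> i - \<epsilon> i) * Ls (monom_fun \<epsilon>)))"
proof -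
  interpret c: comm_ring_hom "fps_const :: 'a mpoly \<Rightarrow> _" by (rule comm_ring_hom_fps_const)
  have "Psi (monom_fun \<beta>) = (\<Prod>i<m. (fps_const (Var i) + fps_X * fps_const (L i)) ^ \<beta> i)"
    by (simp add: monom_fun_def Psi.homs Psi_Var)
  also have "\<dots> = (\<Sum>\<epsilon>\<in>(\<Pi>\<^sub>E i\<in>{..<m}. {..\<beta> i}). \<Prod>i<m. of_nat (\<beta> i choose \<epsilon> i) * fps_const (Var i) ^ (\<beta> i - \<epsilon> i) * (fps_X * fps_const (L i)) ^ \<epsilon> i)"
    by (rule prod_add_power) simp
  also have "\<dots> = (\<Sum>\<epsilon>\<in>(\<Pi>\<^sub>E i\<in>{..<m}. {..\<beta> i}). fps_X ^ exp_sum \<epsilon> * fps_const (Con (multi_choose \<beta> \<epsilon>) * monom_fun (\<lambda>i. \<beta> i - \<epsilon> i) * Ls (monom_fun \<epsilon>)))"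
  proof (rule sum.cong[OF refl])
    fix \<epsilon>
    have x: "fps_X ^ exp_sum \<epsilon> = (\<Prod>i<m. fps_X ^ \<epsilon> i :: 'a mpoly fps)"
      by (simp only: exp_sum_def power_sum)
    have b: "Con (multi_choose \<beta> \<epsilon>) = (\<Prod>i<m. of_nat (\<beta> i choose \<epsilon> i) :: 'a mpoly)"
      by (simp only: multi_choose_def Con.homs)
    show "(\<Prod>i<m. of_nat (\<beta> i choose \<epsilon> i) * fps_const (Var i) ^ (\<beta> i - \<epsilon> i) * (fps_X * fps_const (L i)) ^ \<epsilon> i)
        = fps_X ^ exp_sum \<epsilon> * fps_const (Con (multi_choose \<beta> \<epsilon>) * monom_fun (\<lambda>i. \<beta> i - \<epsilon> i) * Ls (monom_fun \<epsilon>))"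
      unfolding x b by (simp only: monom_fun_def Ls.homs Ls_Var c.homs power_mult_distrib prod.distrib mult_ac)
  qed
  finally show ?thesis .
qed

lemma polarL_gen:
  assumes h: "h \<in> Sym m j"
  shows "polarL g (monom_fun \<beta> * Ls h) = (\<Sum>\<epsilon>\<in>(\<Pi>\<^sub>E i\<in>{..<m}. {..\<beta> i}). \<Sum>i\<le>j.
    Con (fps_nth ((1 - fps_X) ^ (j - i) * fps_X ^ (q * i + exp_sum \<epsilon>)) g) *
    (Con (multi_choose \<beta> \<epsilon>) * (monom_fun (\<lambda>i. \<beta> i - \<epsilon> i) * Ls (monom_fun \<epsilon> * steenrod q i h))))"
proof -
  let ?P = "\<Pi>\<^sub>E i\<in>{..<m}. {..\<beta> i}"
  have "Psi (monom_fun \<beta> * Ls h) = (\<Sum>\<epsilon>\<in>?P. \<Sum>i\<le>j.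
      lift_fps ((1 - fps_X) ^ (j - i) * fps_X ^ (q * i + exp_sum \<epsilon>)) *
      fps_const (Con (multi_choose \<beta> \<epsilon>) * (monom_fun (\<lambda>i. \<beta> i - \<epsilon> i) * Ls (monom_fun \<epsilon> * steenrod q i h))))"
    unfolding Psi.hom_mult Psi_monom_fun Psi_Ls[OF h] sum_product
  proof (intro sum.cong refl)
    fix \<epsilon> i
    have "lift_fps ((1 - fps_X) ^ (j - i) * fps_X ^ (q * i + exp_sum \<epsilon>)) =
      fps_X ^ exp_sum \<epsilon> * lift_fps ((1 - fps_X) ^ (j - i) * fps_X ^ (q * i) :: 'a fps)"
      by (simp add: lift.homs power_add mult_ac)
    then show "fps_X ^ exp_sum \<epsilon> * fps_const (Con (multi_choose \<beta> \<epsilon>) * monom_fun (\<lambda>i. \<beta> i - \<epsilon> i) * Ls (monom_fun \<epsilon>)) *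
       (lift_fps ((1 - fps_X) ^ (j - i) * fps_X ^ (q * i)) * fps_const (Ls (steenrod q i h))) =
      lift_fps ((1 - fps_X) ^ (j - i) * fps_X ^ (q * i + exp_sum \<epsilon>)) *
      fps_const (Con (multi_choose \<beta> \<epsilon>) * (monom_fun (\<lambda>i. \<beta> i - \<epsilon> i) * Ls (monom_fun \<epsilon> * steenrod q i h)))"
      by (simp only: Ls.hom_mult fps_const_mult[symmetric] mult_ac)
  qed
  then have "fps_nth (Psi (monom_fun \<beta> * Ls h)) g = (\<Sum>\<epsilon>\<in>?P. \<Sum>i\<le>j.
      fps_nth (lift_fps ((1 - fps_X) ^ (j - i) * fps_X ^ (q * i + exp_sum \<epsilon>)) *
      fps_const (Con (multi_choose \<beta> \<epsilon>) * (monom_fun (\<lambda>i. \<beta> i - \<epsilon> i) * Ls (monom_fun \<epsilon> * steenrod q i h)))) g)"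
    by (simp only: fps_sum_nth)
  then show ?thesis by (simp only: Psi_nth fps_mult_right_const_nth nth_lift)
qed

section \<open>Spanning modulo hits\<close>

text \<open>The lower bound on the degree of h gives the filtration along which elements are
  rewritten.\<close>

definition gens :: "nat \<Rightarrow> 'a mpoly set" where
  "gens J0 = {monom_fun \<beta> * Ls h | \<beta> h j. (\<forall>i<m. \<beta> i < q) \<and> h \<in> Sym m j \<and> J0 \<le> j \<and> exp_sum \<beta> + q * j \<le> D}"

lemma gensI:
  assumes "\<forall>i<m. \<beta> i < q" "h \<in> Sym m j" "J0 \<le> j" "exp_sum \<beta> + q * j \<le> D"
  shows "monom_fun \<beta> * Ls h \<in> gens J0"
  unfolding gens_def using assms by blast

lemma L_Pol: "i < m \<Longrightarrow> L i \<in> Pol m q"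
  unfolding L_def
  using Sym_power[OF Var_Sym, of i m q] Var_Sym[of i m] Sym_subset_Pol[of m q] Sym_subset_Pol[of m 1] Pol_mono[of 1 q m] q0
  by (intro mp.subspace_diff[OF subspace_Pol]) auto

lemma Ls_Pol: "h \<in> Sym m j \<Longrightarrow> Ls h \<in> Pol m (q * j)"
  unfolding Ls_def using Sym_subset_Pol[of m j] by (intro Pol_ev) (auto intro: L_Pol)

lemma monom_fun_Ls_Pol:
  assumes "h \<in> Sym m j" "exp_sum \<beta> + q * j \<le> D"
  shows "monom_fun \<beta> * Ls h \<in> Pol m D"
  using Pol_mult[OF subsetD[OF Sym_subset_Pol monom_fun_Sym] Ls_Pol[OF assms(1)], of \<beta>] Pol_mono[OF assms(2), of m]
  by auto

definition Low :: "nat \<Rightarrow> 'a mpoly set" where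
  "Low e = supported (\<lambda>k. Poly_Mapping.keys k \<subseteq> {..<m} \<and> mdeg k < e)"

lemma subspace_Low: "mp.subspace (Low e)"
  unfolding Low_def by (rule subspace_supported)

lemma Low_mult: "x \<in> Low a \<Longrightarrow> y \<in> Pol m b \<Longrightarrow> x * y \<in> Low (a + b)"
  unfolding Low_def Pol_def by (erule (1) supported_mult) (auto simp: keys_add_nat mdeg_add)

definition top_eq :: "nat \<Rightarrow> 'a mpoly \<Rightarrow> 'a mpoly \<Rightarrow> bool" where
  "top_eq a x y \<longleftrightarrow> x \<in> Pol m a \<and> y \<in> Pol m a \<and> x - y \<in> Low a"

lemma top_eq_refl: "x \<in> Pol m a \<Longrightarrow> top_eq a x x"
  using mp.subspace_0[OF subspace_Low] by (simp add: top_eq_def)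

lemma top_eq_mult:
  assumes "top_eq a x x'" "top_eq b y y'"
  shows "top_eq (a + b) (x * y) (x' * y')"
proof -
  have "(x - x') * y \<in> Low (a + b)" "(y - y') * x' \<in> Low (b + a)"
    using assms by (auto simp: top_eq_def intro!: Low_mult)
  moreover have "x * y - x' * y' = (x - x') * y + (y - y') * x'" by (simp add: algebra_simps)
  ultimately have "x * y - x' * y' \<in> Low (a + b)"
    using mp.subspace_add[OF subspace_Low] by (simp add: add.commute)
  then show ?thesis using assms by (auto simp: top_eq_def intro!: Pol_mult)
qed

lemma top_eq_one: "top_eq 0 1 1"
  using one_Sym[of m] Sym_subset_Pol[of m 0] by (intro top_eq_refl) auto

lemma top_eq_power: "top_eq a x y \<Longrightarrow> top_eq (a * k) (x ^ k) (y ^ k)"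
  by (induction k) (simp_all add: top_eq_one top_eq_mult)

lemma top_eq_prod: "finite I \<Longrightarrow> (\<And>i. i \<in> I \<Longrightarrow> top_eq (a i) (x i) (y i)) \<Longrightarrow> top_eq (sum a I) (prod x I) (prod y I)"
  by (induction I rule: finite_induct) (simp_all add: top_eq_one top_eq_mult)

lemma top_eq_L:
  assumes "i < m"
  shows "top_eq q (L i) (Var i ^ q)"
proof -
  have 1: "Var i ^ q \<in> Pol m q"
    using Sym_power[OF Var_Sym[OF assms], of q] Sym_subset_Pol by auto
  have "Var i \<in> Low q"
    unfolding Low_def Var_def by (rule single_supported) (use assms q2 in auto)
  then have "L i - Var i ^ q \<in> Low q"
    using subspace_Con[OF subspace_Low, of "Var i" q "-1"] by (simp add: L_def single_uminus)
  then show ?thesis using 1 L_Pol[OF assms] by (simp add: top_eq_def)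
qed

text \<open>Divide each exponent by q with remainder; replacing x_i^q by L_i then changes only terms
  of lower degree.\<close>

lemma single_top_eq_gen:
  assumes "Poly_Mapping.keys k \<subseteq> {..<m}" "mdeg k \<le> D"
  obtains g where "g \<in> gens 0" "g - Poly_Mapping.single k 1 \<in> Low (mdeg k)"
proof
  let ?l = "Poly_Mapping.lookup k"
  define \<beta> a where "\<beta> = (\<lambda>i. ?l i mod q)" and "a = (\<lambda>i. ?l i div q)"
  have exp_sum: "mdeg k = exp_sum \<beta> + q * exp_sum a"
    unfolding mdeg_superset[OF finite_lessThan assms(1)] exp_sum_def \<beta>_def a_def
    by (simp add: sum_distrib_left flip: sum.distrib)
  show "monom_fun \<beta> * Ls (monom_fun a) \<in> gens 0"
    using exp_sum assms q0 by (intro gensI[OF _ monom_fun_Sym[of a]]) (auto simp: \<beta>_def)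
  have "Poly_Mapping.single k 1 = (\<Prod>i<m. Var i ^ ?l i :: 'a mpoly)"
    by (simp flip: mono_ev_Var add: mono_ev_superset[OF finite_lessThan assms(1)])
  also have "\<dots> = monom_fun \<beta> * (\<Prod>i<m. (Var i ^ q) ^ a i)"
    by (simp add: monom_fun_def \<beta>_def a_def flip: prod.distrib power_mult power_add)
  finally have k: "Poly_Mapping.single k 1 = monom_fun \<beta> * (\<Prod>i<m. (Var i ^ q) ^ a i)" .
  have "top_eq (sum (\<lambda>i. q * a i) {..<m}) (\<Prod>i<m. L i ^ a i) (\<Prod>i<m. (Var i ^ q) ^ a i)"
    by (intro top_eq_prod top_eq_power top_eq_L) auto
  moreover have "top_eq (exp_sum \<beta>) (monom_fun \<beta>) (monom_fun \<beta>)"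
    using monom_fun_Sym[of \<beta>] Sym_subset_Pol by (intro top_eq_refl) auto
  ultimately have "top_eq (exp_sum \<beta> + q * exp_sum a) (monom_fun \<beta> * (\<Prod>i<m. L i ^ a i)) (Poly_Mapping.single k 1)"
    unfolding k exp_sum_def[of a] sum_distrib_left by (intro top_eq_mult) auto
  moreover have "Ls (monom_fun a) = (\<Prod>i<m. L i ^ a i)"
    by (simp add: monom_fun_def Ls.homs)
  ultimately show "monom_fun \<beta> * Ls (monom_fun a) - Poly_Mapping.single k 1 \<in> Low (mdeg k)"
    by (simp add: top_eq_def exp_sum)
qed

lemma Pol_subset_span_gens: "Pol m D \<subseteq> mp.span (gens 0)"
proof -
  have "p \<in> mp.span (gens 0)" if "p \<in> Low e" "e \<le> D + 1" for p e
    using that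
  proof (induction e arbitrary: p rule: less_induct)
    case (less e)
    show ?case
    proof (subst mpoly_eq_sum_single[of p], rule mp.span_sum)
      fix k assume "k \<in> Poly_Mapping.keys p"
      then have k: "Poly_Mapping.keys k \<subseteq> {..<m}" "mdeg k < e"
        using less.prems by (auto simp: Low_def supported_def)
      then obtain g where g: "g \<in> gens 0" "g - Poly_Mapping.single k 1 \<in> Low (mdeg k)"
        using single_top_eq_gen[of k] less.prems by auto
      have "g - Poly_Mapping.single k 1 \<in> mp.span (gens 0)"
        by (rule less.IH[OF k(2) g(2)]) (use k less.prems in auto)
      then have "g - (g - Poly_Mapping.single k 1) \<in> mp.span (gens 0)"
        by (rule mp.span_diff[OF mp.span_base[OF g(1)]])
      then have "Poly_Mapping.single k 1 \<in> mp.span (gens 0)" by simp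
      then have "pscale (Poly_Mapping.lookup p k) (Poly_Mapping.single k 1) \<in> mp.span (gens 0)"
        by (rule mp.span_scale)
      then show "Poly_Mapping.single k (Poly_Mapping.lookup p k) \<in> mp.span (gens 0)"
        by (simp add: pscale_eq mult_single)
    qed
  qed
  moreover have "Pol m D = Low (D + 1)"
    by (auto simp: Pol_def Low_def supported_def less_Suc_eq_le)
  ultimately show ?thesis by auto
qed

text \<open>The new total degree is |\<beta>| + q j + (q - 1)(q i + |\<epsilon>|), so the room (q -
  1) l kept free in the hypothesis suffices.\<close>

lemma shifted_gen:
  assumes \<beta>: "\<forall>i<m. \<beta> i < q" and h: "h \<in> Sym m j" and l: "exp_sum \<beta> + q * j + (q - 1) * l \<le> D"
    and \<epsilon>: "\<epsilon> \<in> (\<Pi>\<^sub>E i\<in>{..<m}. {..\<beta> i})" "q * i + exp_sum \<epsilon> \<le> l" and J0: "J0 \<le> exp_sum \<epsilon> + (j + (q - 1) * i)"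
  shows "monom_fun (\<lambda>i. \<beta> i - \<epsilon> i) * Ls (monom_fun \<epsilon> * steenrod q i h) \<in> gens J0"
proof -
  have "exp_sum (\<lambda>i. \<beta> i - \<epsilon> i) + exp_sum \<epsilon> = exp_sum \<beta>"
    unfolding exp_sum_def sum.distrib[symmetric] using \<epsilon>(1) by (intro sum.cong refl) (auto simp: PiE_def Pi_def)
  moreover obtain q' where q': "q = Suc q'" using q0 by (cases q) auto
  moreover have "q' * (q * i + exp_sum \<epsilon>) \<le> q' * l" using \<epsilon>(2) by (rule mult_le_mono2)
  ultimately have "exp_sum (\<lambda>i. \<beta> i - \<epsilon> i) + q * (exp_sum \<epsilon> + (j + (q - 1) * i)) \<le> D"
    using l by (simp add: algebra_simps)
  moreover have "monom_fun \<epsilon> * steenrod q i h \<in> Sym m (exp_sum \<epsilon> + (j + (q - 1) * i))"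
    by (intro Sym_mult monom_fun_Sym steenrod_Sym q0 h)
  moreover have "\<forall>i<m. \<beta> i - \<epsilon> i < q" using \<beta> by (auto intro: le_less_trans[OF diff_le_self])
  ultimately show ?thesis unfolding gens_def using J0 by blast
qed

text \<open>The zero exponent vector in extensional form, since the sums run over
  \<open>PiE\<close>.\<close>

definition zero_exp :: "nat \<Rightarrow> nat" where
  "zero_exp = restrict (\<lambda>_. 0) {..<m}"

lemma zero_exp_PiE: "zero_exp \<in> (\<Pi>\<^sub>E i\<in>{..<m}. {..\<beta> i})"
  by (simp add: zero_exp_def)

lemma exp_sum_zero_exp [simp]: "exp_sum zero_exp = 0"
  by (simp add: exp_sum_def zero_exp_def)

lemma exp_sum_pos:
  assumes "\<epsilon> \<in> (\<Pi>\<^sub>E i\<in>{..<m}. {..\<beta> i})" "\<epsilon> \<noteq> zero_exp"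
  shows "exp_sum \<epsilon> > 0"
proof (rule ccontr)
  assume "\<not> 0 < exp_sum \<epsilon>"
  then have "\<forall>i<m. \<epsilon> i = 0" by (simp add: exp_sum_def)
  then have "\<epsilon> = zero_exp" using assms(1) by (auto simp: zero_exp_def fun_eq_iff PiE_def extensional_def)
  then show False using assms(2) by simp
qed

lemma monom_fun_cong: "(\<And>i. i < m \<Longrightarrow> \<beta> i = \<gamma> i) \<Longrightarrow> monom_fun \<beta> = monom_fun \<gamma>"
  unfolding monom_fun_def by (rule prod.cong) auto

lemma zero_exp_term: "Con (multi_choose \<beta> zero_exp) * (monom_fun (\<lambda>i. \<beta> i - zero_exp i) * Ls (monom_fun zero_exp * h)) = monom_fun \<beta> * Ls h"
proof -
  have "multi_choose \<beta> zero_exp = 1" by (simp add: multi_choose_def zero_exp_def)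
  moreover have "monom_fun (\<lambda>i. \<beta> i - zero_exp i) = monom_fun \<beta>" by (rule monom_fun_cong) (simp add: zero_exp_def)
  moreover have "monom_fun zero_exp = 1" by (simp add: monom_fun_def zero_exp_def)
  ultimately show ?thesis by simp
qed

text \<open>In the expansion of \<open>polarL l\<close>, the degree of h grows by |\<epsilon>| + (q
  - 1) i, which is positive except for \<epsilon> = 0 and i = 0; that term carries the coefficient
  of y^l in (1 - y)^j.\<close>

lemma polarL_gen_cong:
  assumes \<beta>: "\<forall>i<m. \<beta> i < q" and h: "h \<in> Sym m j" and l: "exp_sum \<beta> + q * j + (q - 1) * l \<le> D"
  shows "polarL l (monom_fun \<beta> * Ls h) - Con (sgn_binom j l) * (monom_fun \<beta> * Ls h) \<in> mp.span (gens (Suc j))"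
proof -
  let ?P = "\<Pi>\<^sub>E i\<in>{..<m}. {..\<beta> i}"
  let ?S = "mp.span (gens (Suc j))"
  define t where "t \<epsilon> i = Con (fps_nth ((1 - fps_X) ^ (j - i) * fps_X ^ (q * i + exp_sum \<epsilon>)) l :: 'a) *
    (Con (multi_choose \<beta> \<epsilon>) * (monom_fun (\<lambda>i. \<beta> i - \<epsilon> i) * Ls (monom_fun \<epsilon> * steenrod q i h)))" for \<epsilon> i
  have fin: "finite ?P" by (intro finite_PiE) auto
  have t: "t \<epsilon> i \<in> ?S" if \<epsilon>: "\<epsilon> \<in> ?P" and ne: "\<epsilon> \<noteq> zero_exp \<or> i \<noteq> 0" for \<epsilon> i
  proof (cases "q * i + exp_sum \<epsilon> \<le> l")
    case True
    have "1 * i \<le> (q - 1) * i" using q2 by (intro mult_le_mono1) simp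
    moreover have "0 < exp_sum \<epsilon> \<or> 0 < i" using ne exp_sum_pos[OF \<epsilon>] by auto
    ultimately have "Suc j \<le> exp_sum \<epsilon> + (j + (q - 1) * i)" by linarith
    then have "monom_fun (\<lambda>i. \<beta> i - \<epsilon> i) * Ls (monom_fun \<epsilon> * steenrod q i h) \<in> ?S"
      using shifted_gen[OF \<beta> h l \<epsilon> True] by (intro mp.span_base)
    then show ?thesis unfolding t_def by (intro subspace_Con mp.subspace_span)
  next
    case False
    then have "fps_nth ((1 - fps_X) ^ (j - i) * fps_X ^ (q * i + exp_sum \<epsilon>)) l = (0 :: 'a)"
      by (simp add: fps_X_power_mult_right_nth)
    then show ?thesis by (simp add: t_def mp.span_zero)
  qed
  have "polarL l (monom_fun \<beta> * Ls h) = (\<Sum>\<epsilon>\<in>?P. \<Sum>i\<le>j. t \<epsilon> i)"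
    unfolding polarL_gen[OF h] t_def ..
  also have "\<dots> = (\<Sum>i\<le>j. t zero_exp i) + (\<Sum>\<epsilon>\<in>?P - {zero_exp}. \<Sum>i\<le>j. t \<epsilon> i)"
    by (rule sum.remove[OF fin zero_exp_PiE])
  also have "(\<Sum>i\<le>j. t zero_exp i) = t zero_exp 0 + (\<Sum>i\<in>{..j} - {0}. t zero_exp i)"
    by (rule sum.remove) auto
  also have "t zero_exp 0 = Con (sgn_binom j l) * (monom_fun \<beta> * Ls h)"
    unfolding t_def zero_exp_term by (simp add: sgn_binom_def steenrod_0_left[OF q0])
  finally have "polarL l (monom_fun \<beta> * Ls h) - Con (sgn_binom j l) * (monom_fun \<beta> * Ls h) =
      (\<Sum>i\<in>{..j} - {0}. t zero_exp i) + (\<Sum>\<epsilon>\<in>?P - {zero_exp}. \<Sum>i\<le>j. t \<epsilon> i)"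
    by simp
  also have "\<dots> \<in> ?S"
    using zero_exp_PiE by (intro mp.span_add mp.span_sum t) auto
  finally show ?thesis .
qed

definition top_gens :: "'a mpoly set" where
  "top_gens = {monom_fun \<beta> * Ls h | \<beta> h. (\<forall>i<m. \<beta> i < q) \<and> h \<in> Sym m d \<and> exp_sum \<beta> + q * d \<le> D}"

lemma sgn_binom_0 [simp]: "sgn_binom e 0 = 1"
  by (simp add: sgn_binom_def fps_nth_one_minus_X_power)

text \<open>(1 - y)^(d - j) has leading coefficient 1 or -1, hence a first nonzero coefficient after
  the constant one. Multiplied by (1 - y)^j it reappears unchanged in the difference of the two
  series. The bound on l keeps the degrees within D.\<close>

lemma sgn_binom_split:
  assumes "j < d"
  obtains l where "1 \<le> l" "l \<le> d - j" "sgn_binom d l \<noteq> sgn_binom j l"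
proof -
  define P where "P l \<longleftrightarrow> 1 \<le> l \<and> sgn_binom (d - j) l \<noteq> 0" for l
  have "P (d - j)" using assms by (simp add: P_def sgn_binom_def fps_nth_one_minus_X_power)
  define l where "l = (LEAST l. P l)"
  have l: "P l" "l \<le> d - j" unfolding l_def using \<open>P (d - j)\<close> by (auto intro: LeastI Least_le)
  have min: "sgn_binom (d - j) k = 0" if "1 \<le> k" "k < l" for k
    using not_less_Least[of k P] that by (auto simp: l_def P_def)
  have "(1 - fps_X :: 'a fps) ^ d = (1 - fps_X) ^ j * (1 - fps_X) ^ (d - j)"
    using assms by (simp flip: power_add)
  then have "sgn_binom d l = (\<Sum>i=0..l. sgn_binom j i * sgn_binom (d - j) (l - i))"
    by (simp add: sgn_binom_def fps_mult_nth)
  also have "\<dots> = (\<Sum>i\<in>{0, l}. sgn_binom j i * sgn_binom (d - j) (l - i))"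
    by (rule sum.mono_neutral_right) (auto intro!: min)
  also have "\<dots> = sgn_binom (d - j) l + sgn_binom j l" using l(1) by (simp add: P_def)
  finally have "sgn_binom d l \<noteq> sgn_binom j l" using l(1) by (simp add: P_def)
  then show ?thesis using that l by (auto simp: P_def)
qed

text \<open>Descending induction on the degree of h, started at D + 1, where no generator
  exists.\<close>

lemma gens_subset: "gens 0 \<subseteq> mp.span (H \<union> top_gens)"
proof -
  let ?Z = "mp.span (H \<union> top_gens)"
  have HZ: "x \<in> ?Z" if "x \<in> H" for x using that by (intro mp.span_base) auto
  have "gens (D + 1 - k) \<subseteq> ?Z" if "k \<le> D + 1" for k
    using that
  proof (induction k)
    case 0
    have "j \<le> D" if "exp_sum \<beta> + q * j \<le> D" for \<beta> j
    proof -
      have "1 * j \<le> q * j" using q0 by (intro mult_le_mono1) simp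
      then show ?thesis using that by linarith
    qed
    then show ?case by (fastforce simp: gens_def)
  next
    case (Suc k)
    have "Suc (D + 1 - Suc k) = D + 1 - k" using Suc.prems by linarith
    then have IH: "gens (Suc (D + 1 - Suc k)) \<subseteq> ?Z" using Suc.IH Suc.prems by simp
    show ?case
    proof
      fix x assume "x \<in> gens (D + 1 - Suc k)"
      then obtain \<beta> h j where x: "x = monom_fun \<beta> * Ls h" "\<forall>i<m. \<beta> i < q" "h \<in> Sym m j" "D + 1 - Suc k \<le> j"
          "exp_sum \<beta> + q * j \<le> D" by (auto simp: gens_def)
      have Sj: "mp.span (gens (Suc j)) \<subseteq> ?Z"
      proof (rule mp.span_minimal[OF _ mp.subspace_span])
        have "gens (Suc j) \<subseteq> gens (Suc (D + 1 - Suc k))" using x(4) by (fastforce simp: gens_def)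
        then show "gens (Suc j) \<subseteq> ?Z" using IH by blast
      qed
      consider "j > d" | "j = d" | "j < d" by linarith
      then show "x \<in> ?Z"
      proof cases
        case 1
        then show ?thesis using high_in_H[OF x(3) _ x(5)] x(1) by (intro HZ) simp
      next
        case 2
        then show ?thesis using x by (intro mp.span_base) (auto simp: top_gens_def)
      next
        case 3
        then obtain l where l: "1 \<le> l" "l \<le> d - j" "sgn_binom d l \<noteq> sgn_binom j l" by (rule sgn_binom_split)
        \<comment> \<open>In the worst case \<beta> is constantly q - 1 and l = d - j; the sum is
          then (q - 1) Q + j, which stays within D because j < d.\<close>
        have le: "exp_sum \<beta> + q * j + (q - 1) * l \<le> D"
        proof -
          have "exp_sum \<beta> \<le> (\<Sum>i<m. q - 1)" unfolding exp_sum_def using x(2) by (intro sum_mono) auto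
          then have "exp_sum \<beta> \<le> (q - 1) * m" by (simp add: mult.commute)
          moreover have "(q - 1) * l \<le> (q - 1) * (d - j)" using l by (intro mult_le_mono2)
          moreover have "(q - 1) * (d - j) + (q - 1) * j = (q - 1) * d"
            using 3 by (simp flip: add_mult_distrib2)
          moreover have "q * j = (q - 1) * j + j" using q0 by (cases q) auto
          moreover have "(q - 1) * d + (q - 1) * m = (q - 1) * Q" by (simp flip: d_plus_m add: add_mult_distrib2)
          ultimately show ?thesis using D_d 3 by linarith
        qed
        have "x \<in> Pol m (exp_sum \<beta> + q * j)"
          unfolding x(1) using monom_fun_Sym[of \<beta>] Sym_subset_Pol Ls_Pol[OF x(3)] by (intro Pol_mult) auto
        then have "polarL l x - Con (sgn_binom d l) * x \<in> ?Z" using polarL_cong[OF _ le] HZ by blast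
        moreover have "polarL l x - Con (sgn_binom j l) * x \<in> ?Z"
          using polarL_gen_cong[OF x(2,3) le] Sj x(1) by auto
        \<comment> \<open>The two congruences for \<open>polarL l x\<close> differ by a nonzero
          multiple of x.\<close>
        ultimately have "(polarL l x - Con (sgn_binom j l) * x) - (polarL l x - Con (sgn_binom d l) * x) \<in> ?Z"
          by (rule mp.span_diff[rotated])
        then have "Con (sgn_binom d l - sgn_binom j l) * x \<in> ?Z"
          by (simp add: Con.hom_diff left_diff_distrib)
        then have "Con (1 / (sgn_binom d l - sgn_binom j l)) * (Con (sgn_binom d l - sgn_binom j l) * x) \<in> ?Z"
          by (rule subspace_Con[OF mp.subspace_span])
        moreover have "Con (1 / (sgn_binom d l - sgn_binom j l)) * Con (sgn_binom d l - sgn_binom j l) = (1 :: 'a mpoly)"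
          using l(3) by (simp add: mult_single)
        ultimately show ?thesis by (simp only: mult.assoc[symmetric] mult_1_left)
      qed
    qed
  qed
  from this[of "D + 1"] show ?thesis by simp
qed

lemma Pol_subset_span: "Pol m D \<subseteq> mp.span (H \<union> top_gens)"
  using Pol_subset_span_gens mp.span_minimal[OF gens_subset mp.subspace_span] by blast

section \<open>Hits in fewer variables\<close>

lemma hit_subset_Sym: "hit q n e \<subseteq> (Sym n e :: 'a mpoly set)"
  unfolding hit_def
proof (rule mp.span_minimal[OF _ subspace_Sym], rule UN_least, rule image_subsetI)
  fix i p assume "i \<in> {i. 1 \<le> i \<and> (q - 1) * i \<le> e}" "p \<in> (Sym n (e - (q - 1) * i) :: 'a mpoly set)"
  then show "steenrod q i p \<in> Sym n e" using steenrod_Sym[OF q0, of p n "e - (q - 1) * i" i] by simp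
qed

lemma one_plus_X_J: "e \<le> n \<Longrightarrow> (1 + fps_X) ^ n * J ^ e = (1 + fps_X :: 'a fps) ^ (n - e)"
proof -
  assume "e \<le> n"
  then have "(1 + fps_X) ^ n * J ^ e = (1 + fps_X) ^ (n - e) * ((1 + fps_X) * J) ^ e"
    by (simp add: power_mult_distrib mult.assoc[symmetric] flip: power_add)
  then show ?thesis by (simp only: J power_one mult_1_right)
qed

text \<open>Take v = x^\<beta> h(L) and the coefficient of y^(q i0) in (1 + y)^d v(x + y J L). By
  the congruence it equals v times the same coefficient of (1 + y)^d (1 - y J)^d = 1, which is zero.
  In the direct expansion, \<epsilon> = 0 and i = i0 give the wanted element with coefficient 1;
  every other term has coefficient zero or contains a form of degree above d and is settled by
  \<open>high_in_H\<close>.\<close>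

lemma top_gens_steenrod:
  assumes \<beta>: "\<forall>i<m. \<beta> i < q" and D: "exp_sum \<beta> + q * d \<le> D" and i0: "1 \<le> i0" "(q - 1) * i0 \<le> d"
    and h: "h \<in> Sym m (d - (q - 1) * i0)"
  shows "monom_fun \<beta> * Ls (steenrod q i0 h) \<in> H"
proof (cases "i0 \<le> d - (q - 1) * i0")
  case False
  then have "steenrod q i0 h = 0" by (intro steenrod_eq_0[OF q0 h]) simp
  then show ?thesis using H_0 by simp
next
  case True
  let ?P = "\<Pi>\<^sub>E i\<in>{..<m}. {..\<beta> i}"
  define j l where "j = d - (q - 1) * i0" and "l = q * i0"
  have j: "j + (q - 1) * i0 = d" "h \<in> Sym m j" "i0 \<le> j" using i0 h True by (auto simp: j_def)
  obtain q' where q': "q = Suc q'" using q0 by (cases q) auto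
  have le: "exp_sum \<beta> + q * j + (q - 1) * l \<le> D"
  proof -
    have "q * j + (q - 1) * l = q * (j + (q - 1) * i0)"
      by (simp only: l_def add_mult_distrib2 mult.left_commute)
    then show ?thesis using D by (simp only: j(1))
  qed
  define v where "v = monom_fun \<beta> * Ls h"
  have v: "v \<in> Pol m (exp_sum \<beta> + q * j)"
    unfolding v_def using monom_fun_Sym[of \<beta>] Sym_subset_Pol Ls_Pol[OF j(2)] by (intro Pol_mult) auto
  define U where "U \<epsilon> i = Con (multi_choose \<beta> \<epsilon>) * (monom_fun (\<lambda>i. \<beta> i - \<epsilon> i) * Ls (monom_fun \<epsilon> * steenrod q i h))" for \<epsilon> i
  define A where "A \<epsilon> i = (fps_nth ((1 + fps_X) ^ d * (J ^ (j - i) * (fps_X * J) ^ (q * i + exp_sum \<epsilon>))) l)" for \<epsilon> i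
  have "(\<Sum>g\<le>l. Con (shear_coeff d l g) * (polarL g v - Con (sgn_binom d g) * v)) \<in> H"
  proof (intro H_sum H_Con polarL_cong[OF v])
    fix g assume "g \<in> {..l}"
    then have "(q - 1) * g \<le> (q - 1) * l" by (intro mult_le_mono2) auto
    then show "exp_sum \<beta> + q * j + (q - 1) * g \<le> D" using le by linarith
  qed
  moreover have "(\<Sum>g\<le>l. Con (shear_coeff d l g) * (Con (sgn_binom d g) * v)) = 0"
  proof -
    have "(\<Sum>g\<le>l. shear_coeff d l g * sgn_binom d g) = fps_nth ((1 + fps_X) ^ d * J ^ d) l"
      using shear_coeff_sum[where l = l and M = d and f = "(1 - fps_X) ^ d"] compose_z[of d 0] by (simp add: sgn_binom_def)
    also have "\<dots> = 0" using i0 q0 by (simp add: one_plus_X_J l_def)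
    finally have "Con (\<Sum>g\<le>l. shear_coeff d l g * sgn_binom d g) * v = 0" by simp
    then show ?thesis by (simp only: Con.homs sum_distrib_right mult.assoc)
  qed
  moreover have "(\<Sum>g\<le>l. Con (shear_coeff d l g) * polarL g v) = (\<Sum>\<epsilon>\<in>?P. \<Sum>i\<le>j. Con (A \<epsilon> i) * U \<epsilon> i)"
  proof -
    have "(\<Sum>g\<le>l. Con (shear_coeff d l g) * polarL g v) = (\<Sum>g\<le>l. \<Sum>\<epsilon>\<in>?P. \<Sum>i\<le>j.
        Con (shear_coeff d l g * fps_nth ((1 - fps_X) ^ (j - i) * fps_X ^ (q * i + exp_sum \<epsilon>)) g) * U \<epsilon> i)"
      unfolding v_def polarL_gen[OF j(2)] U_def[symmetric] by (simp only: sum_distrib_left Con.hom_mult mult.assoc)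
    also have "\<dots> = (\<Sum>\<epsilon>\<in>?P. \<Sum>g\<le>l. \<Sum>i\<le>j.
        Con (shear_coeff d l g * fps_nth ((1 - fps_X) ^ (j - i) * fps_X ^ (q * i + exp_sum \<epsilon>)) g) * U \<epsilon> i)"
      by (rule sum.swap)
    also have "\<dots> = (\<Sum>\<epsilon>\<in>?P. \<Sum>i\<le>j. \<Sum>g\<le>l.
        Con (shear_coeff d l g * fps_nth ((1 - fps_X) ^ (j - i) * fps_X ^ (q * i + exp_sum \<epsilon>)) g) * U \<epsilon> i)"
      by (intro sum.cong refl sum.swap)
    also have "\<dots> = (\<Sum>\<epsilon>\<in>?P. \<Sum>i\<le>j. Con (A \<epsilon> i) * U \<epsilon> i)"
      unfolding A_def compose_z[symmetric] shear_coeff_sum[symmetric] by (simp only: Con.hom_sum sum_distrib_right)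
    finally show ?thesis .
  qed
  ultimately have sumH: "(\<Sum>\<epsilon>\<in>?P. \<Sum>i\<le>j. Con (A \<epsilon> i) * U \<epsilon> i) \<in> H"
    by (simp add: right_diff_distrib sum_subtractf)
  have A_eq: "A \<epsilon> i = (if l < q * i + exp_sum \<epsilon> then 0 else
      fps_nth ((1 + fps_X) ^ d * J ^ (j - i + (q * i + exp_sum \<epsilon>))) (l - (q * i + exp_sum \<epsilon>)))" for \<epsilon> i
  proof -
    have e: "(1 + fps_X) ^ d * (J ^ (j - i) * (fps_X * J) ^ (q * i + exp_sum \<epsilon>)) =
        fps_X ^ (q * i + exp_sum \<epsilon>) * ((1 + fps_X) ^ d * J ^ (j - i + (q * i + exp_sum \<epsilon>)))"
      by (simp only: power_mult_distrib power_add mult_ac)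
    show ?thesis unfolding A_def e by (simp add: fps_X_power_mult_nth)
  qed
  have other: "Con (A \<epsilon> i) * U \<epsilon> i \<in> H" if \<epsilon>: "\<epsilon> \<in> ?P" and i: "i \<le> j" and ne: "\<epsilon> \<noteq> zero_exp \<or> i \<noteq> i0" for \<epsilon> i
  proof (cases "l < q * i + exp_sum \<epsilon>")
    case True
    then show ?thesis using H_0 by (simp add: A_eq)
  next
    case False
    \<comment> \<open>Only i \<le> i0 can reach the coefficient of y^(q i0), and i = i0 leaves no
      room for a nonzero \<epsilon>.\<close>
    have "q * i \<le> q * i0" using False unfolding l_def by linarith
    then have ii: "i \<le> i0" using q0 by simp
    have "i \<noteq> i0"
    proof
      assume "i = i0"
      then have "exp_sum \<epsilon> = 0" using False by (simp add: l_def)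
      then show False using ne \<open>i = i0\<close> exp_sum_pos[OF \<epsilon>] by auto
    qed
    then obtain k where k: "i0 = i + k" "k \<ge> 1" using ii by (metis le_add_diff_inverse less_eq_Suc_le le_neq_implies_less One_nat_def zero_less_diff)
    have ex: "j - i + (q * i + exp_sum \<epsilon>) + (q - 1) * k = d + exp_sum \<epsilon>"
    proof -
      have "(q - 1) * i0 = (q - 1) * i + (q - 1) * k" by (simp only: k(1) add_mult_distrib2)
      moreover have "q * i = (q - 1) * i + i" using q' by simp
      ultimately show ?thesis using j(1) i by linarith
    qed
    show ?thesis
    proof (cases "exp_sum \<epsilon> \<le> (q - 1) * k")
      \<comment> \<open>Here all powers of J are absorbed, and the remaining polynomial in y has
        degree k less than the index of the coefficient asked for.\<close>
      case True
      have "(1 + fps_X) ^ d * J ^ (j - i + (q * i + exp_sum \<epsilon>)) = (1 + fps_X :: 'a fps) ^ ((q - 1) * k - exp_sum \<epsilon>)"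
        by (subst one_plus_X_J) (use ex True in \<open>auto intro!: arg_cong2[where f = "(^)"]\<close>)
      moreover have "(q - 1) * k - exp_sum \<epsilon> < l - (q * i + exp_sum \<epsilon>)"
      proof -
        have "l = q * i + q * k" by (simp only: l_def k(1) add_mult_distrib2)
        moreover have "q * k = (q - 1) * k + k" using q' by simp
        ultimately show ?thesis using k True False by linarith
      qed
      ultimately have "A \<epsilon> i = 0"
        by (simp add: A_eq fps_nth_one_plus_X_power binomial_eq_0)
      then show ?thesis using H_0 by simp
    next
      \<comment> \<open>Now |\<epsilon>| > (q - 1) k pushes the degree of the form evaluated at L
        above d.\<close>
      case big: False
      have "Suc d \<le> exp_sum \<epsilon> + (j + (q - 1) * i)"
        using big j(1) k(1) by (simp add: add_mult_distrib2)
      then have "monom_fun (\<lambda>i. \<beta> i - \<epsilon> i) * Ls (monom_fun \<epsilon> * steenrod q i h) \<in> gens (Suc d)"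
        using False by (intro shifted_gen[OF \<beta> j(2) le \<epsilon>]) auto
      then have "monom_fun (\<lambda>i. \<beta> i - \<epsilon> i) * Ls (monom_fun \<epsilon> * steenrod q i h) \<in> H"
        using high_in_H by (fastforce simp: gens_def)
      then show ?thesis unfolding U_def by (intro H_Con)
    qed
  qed
  have fin: "finite ?P" by (intro finite_PiE) auto
  have "(\<Sum>\<epsilon>\<in>?P. \<Sum>i\<le>j. Con (A \<epsilon> i) * U \<epsilon> i) = (\<Sum>i\<le>j. Con (A zero_exp i) * U zero_exp i) + (\<Sum>\<epsilon>\<in>?P - {zero_exp}. \<Sum>i\<le>j. Con (A \<epsilon> i) * U \<epsilon> i)"
    by (rule sum.remove[OF fin zero_exp_PiE])
  also have "(\<Sum>i\<le>j. Con (A zero_exp i) * U zero_exp i) = Con (A zero_exp i0) * U zero_exp i0 + (\<Sum>i\<in>{..j} - {i0}. Con (A zero_exp i) * U zero_exp i)"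
    by (rule sum.remove) (use j(3) in auto)
  finally have "Con (A zero_exp i0) * U zero_exp i0 = (\<Sum>\<epsilon>\<in>?P. \<Sum>i\<le>j. Con (A \<epsilon> i) * U \<epsilon> i) -
      ((\<Sum>i\<in>{..j} - {i0}. Con (A zero_exp i) * U zero_exp i) + (\<Sum>\<epsilon>\<in>?P - {zero_exp}. \<Sum>i\<le>j. Con (A \<epsilon> i) * U \<epsilon> i))"
    by (simp add: algebra_simps)
  also have "\<dots> \<in> H"
    using zero_exp_PiE by (intro H_diff sumH H_add H_sum other) auto
  finally have "Con (A zero_exp i0) * U zero_exp i0 \<in> H" .
  moreover have "A zero_exp i0 = 1" by (simp add: A_eq l_def fps_power_zeroth J_def)
  moreover have "U zero_exp i0 = monom_fun \<beta> * Ls (steenrod q i0 h)" unfolding U_def zero_exp_term ..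
  ultimately show ?thesis by simp
qed

lemma top_gens_hit:
  assumes \<beta>: "\<forall>i<m. \<beta> i < q" and D: "exp_sum \<beta> + q * d \<le> D" and h: "h \<in> hit q m d"
  shows "monom_fun \<beta> * Ls h \<in> H"
proof -
  have "mp.subspace {h. monom_fun \<beta> * Ls h \<in> H}"
  proof (rule subspaceI)
    show "Con c * x \<in> {h. monom_fun \<beta> * Ls h \<in> H}" if "x \<in> {h. monom_fun \<beta> * Ls h \<in> H}" for c x
    proof -
      have "Ls (Con c) = Con c" by (simp add: Ls_def)
      then have "monom_fun \<beta> * Ls (Con c * x) = Con c * (monom_fun \<beta> * Ls x)"
        by (simp only: Ls.hom_mult mult.left_commute)
      then show ?thesis using that H_Con by (simp only: mem_Collect_eq)
    qed
  qed (use H_0 H_add in \<open>auto simp: Ls.homs distrib_left\<close>)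
  then have "hit q m d \<subseteq> {h. monom_fun \<beta> * Ls h \<in> H}"
    unfolding hit_def by (rule mp.span_minimal[rotated]) (use top_gens_steenrod[OF \<beta> D] in auto)
  then show ?thesis using h by auto
qed

section \<open>Taylor expansion at rational points\<close>

definition shift :: "(nat \<Rightarrow> 'a) \<Rightarrow> 'a mpoly \<Rightarrow> 'a mpoly" where
  "shift c = ev Con (\<lambda>i. Var i + Con (c i))"

lemma comm_ring_hom_shift: "comm_ring_hom (shift c)"
  unfolding shift_def by (rule Con.comm_ring_hom_ev)

lemma shift_Con: "shift c (Con a) = Con a"
  by (simp add: shift_def)

text \<open>Rational coordinates satisfy c^q = c, so translation by them fixes every L_i and hence
  commutes with the operations built from L.\<close>

lemma shift_L: "shift c (L i) = L i"
proof -
  interpret s: comm_ring_hom "shift c" by (rule comm_ring_hom_shift)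
  have "shift c (L i) = (Var i + Con (c i)) ^ q - (Var i + Con (c i))"
    by (simp add: L_def s.homs) (simp add: shift_def)
  also have "Con (c i) ^ q = Con (c i)"
    by (simp add: field_power_q flip: Con.hom_power)
  then have "(Var i + Con (c i)) ^ q = Var i ^ q + Con (c i)" by (simp add: freshman_mpoly)
  finally show ?thesis by (simp add: L_def)
qed

lemma shift_polarL: "shift c (polarL g v) = polarL g (shift c v)"
proof -
  have "shift c (polarL g v) = polar Con g (\<lambda>i. Var i + Con (c i)) L v"
    unfolding polarL_def hom_polar[OF comm_ring_hom_shift] shift_Con shift_L by (simp add: shift_def)
  also have "\<dots> = fps_nth (ev (\<lambda>c. fps_const (Con c)) (\<lambda>i. fps_const (Var i + Con (c i)) + fps_X * fps_const (L i)) v) g"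
    by (rule fps_nth_ev_translate[OF comm_ring_hom_Con, symmetric])
  also have "ev (\<lambda>c. fps_const (Con c)) (\<lambda>i. fps_const (Var i + Con (c i)) + fps_X * fps_const (L i)) v = Psi (shift c v)"
  proof -
    have "Psi (Con a) = fps_const (Con a)" for a by (simp add: Psi_def)
    moreover have "Psi (Var i + Con (c i)) = fps_const (Var i + Con (c i)) + fps_X * fps_const (L i)" for i
      by (simp add: Psi.homs Psi_Var calculation flip: fps_const_add)
    ultimately show ?thesis unfolding shift_def hom_ev[OF Psi.comm_ring_hom_axioms] by simp
  qed
  finally show ?thesis by (simp add: Psi_nth)
qed

lemma shift_steenrod_op: "shift c (steenrod_op M l v) = steenrod_op M l (shift c v)"
proof -
  interpret s: comm_ring_hom "shift c" by (rule comm_ring_hom_shift)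
  show ?thesis by (simp add: steenrod_op_def s.homs shift_Con shift_polarL)
qed

lemma shift_Pol:
  assumes "v \<in> Pol m M"
  shows "shift c v \<in> Pol m M"
proof -
  have "Var i + Con (c i) \<in> Pol m 1" if "i < m" for i
    using Var_Sym[OF that] Con_Sym[of "c i" m] Sym_subset_Pol[of m 1] Sym_subset_Pol[of m 0] Pol_mono[of 0 1 m]
    by (intro mp.subspace_add[OF subspace_Pol]) auto
  then show ?thesis using Pol_ev[OF assms, of "\<lambda>i. Var i + Con (c i)" m 1] by (simp add: shift_def)
qed

definition phi :: "(nat \<Rightarrow> 'a) \<Rightarrow> 'a mpoly \<Rightarrow> 'a mpoly" where
  "phi c p = hpart d (shift c p)"

lemma phi_add: "phi c (x + y) = phi c x + phi c y"
  using comm_ring_hom.hom_add[OF comm_ring_hom_shift] by (simp add: phi_def hpart_add)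

lemma phi_0: "phi c 0 = 0"
  using comm_ring_hom.hom_zero[OF comm_ring_hom_shift] by (simp add: phi_def)

lemma phi_sum: "phi c (sum f S) = (\<Sum>x\<in>S. phi c (f x))"
  by (induction S rule: infinite_finite_induct) (simp_all add: phi_add phi_0)

lemma phi_Con: "phi c (Con a * x) = Con a * phi c x"
  using comm_ring_hom.hom_mult[OF comm_ring_hom_shift] by (simp add: phi_def shift_Con hpart_Con_mult)

lemma steenrod_op_add: "steenrod_op M l (x + y) = steenrod_op M l x + steenrod_op M l y"
  by (simp add: steenrod_op_def polarL_add distrib_left sum.distrib)

lemma steenrod_op_sum: "steenrod_op M l (sum f S) = (\<Sum>x\<in>S. steenrod_op M l (f x))"
proof (induction S rule: infinite_finite_induct)
qed (simp_all add: steenrod_op_add steenrod_op_def[of _ _ 0])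

text \<open>The component of degree e contributes multiples of P^i with e + (q - 1) i = d. Those
  with i > 0 are hits; for i = 0 the factor is the binomial coefficient of M - d over l, zero by
  \<open>choose_vanish\<close>.\<close>

lemma hpart_steenrod_op:
  assumes v: "v \<in> Pol m M" and l: "1 \<le> l" "M + (q - 1) * l = D"
  shows "hpart d (steenrod_op M l v) \<in> hit q m d"
proof -
  have "hpart d (steenrod_op M l v) = (\<Sum>e\<le>M. hpart d (steenrod_op M l (hpart e v)))"
    by (subst Pol_eq_sum_hpart[OF v]) (simp add: steenrod_op_sum hpart_sum)
  also have "\<dots> = (\<Sum>e\<le>M. \<Sum>i\<le>l. Con (of_nat ((M - e) choose (l - i))) * hpart d (steenrod q i (hpart e v)))"
    by (intro sum.cong refl) (simp only: atMost_iff steenrod_op_Sym[OF hpart_in_Sym[OF v]] hpart_sum hpart_Con_mult)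
  also have "\<dots> \<in> hit q m d"
  proof (intro mp.subspace_sum[OF subspace_hit])
    fix e i assume ei: "e \<in> {..M}" "i \<in> {..l}"
    have S: "steenrod q i (hpart e v) \<in> Sym m (e + (q - 1) * i)"
      by (rule steenrod_Sym[OF q0 hpart_in_Sym[OF v]])
    show "Con (of_nat ((M - e) choose (l - i))) * hpart d (steenrod q i (hpart e v)) \<in> hit q m d"
    proof (cases "e + (q - 1) * i = d")
      case False
      then show ?thesis using hpart_Sym_ne[OF S] mp.subspace_0[OF subspace_hit] by simp
    next
      case True
      then have hp: "hpart d (steenrod q i (hpart e v)) = steenrod q i (hpart e v)"
        using hpart_Sym[OF S] by simp
      show ?thesis
      proof (cases "i = 0")
        case True
        then have ed: "e = d" using \<open>e + (q - 1) * i = d\<close> by simp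
        \<comment> \<open>A component of degree d exists only if M is at least d, which forces l <
          Q.\<close>
        have "(q - 1) * l < (q - 1) * Q" using l D_d ei ed by (simp only: atMost_iff)
        then have lQ: "l < Q" by simp
        have "(q - 1) * (Q - l) + (q - 1) * l = (q - 1) * Q"
          using lQ by (simp flip: add_mult_distrib2)
        then have "M - e = (q - 1) * (Q - l) - 1"
          using l D_d ed by linarith
        then have "of_nat ((M - e) choose (l - i)) = (0 :: 'a)"
          using choose_vanish[OF q l(1), of "m - 1"] lQ True by (simp add: Q_def)
        then show ?thesis using mp.subspace_0[OF subspace_hit] by simp
      next
        case False
        have "steenrod q i (hpart e v) \<in> hit q m d"
          unfolding hit_def
        proof (intro mp.span_base UN_I[of i] imageI)
          show "hpart e v \<in> Sym m (d - (q - 1) * i)"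
            using hpart_in_Sym[OF v, of e] by (simp only: True[symmetric] diff_add_inverse2)
        qed (use False True in auto)
        then show ?thesis unfolding hp by (intro subspace_Con[OF subspace_hit])
      qed
    qed
  qed
  finally show ?thesis .
qed

lemma phi_H:
  assumes "x \<in> H"
  shows "phi c x \<in> hit q m d"
proof -
  have "mp.subspace {y. phi c (dehom y) \<in> hit q m d}"
    using mp.subspace_0[OF subspace_hit] mp.subspace_add[OF subspace_hit] subspace_Con[OF subspace_hit]
    by (intro subspaceI) (auto simp: dehom.homs phi_add phi_Con phi_0)
  moreover have "phi c (dehom (steenrod q i V)) \<in> hit q m d"
    if "1 \<le> i" "(q - 1) * i \<le> D" "V \<in> Sym (Suc m) (D - (q - 1) * i)" for i V
    unfolding dehom_steenrod[OF that(3)] phi_def shift_steenrod_op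
    by (rule hpart_steenrod_op[OF shift_Pol[OF dehom_Pol[OF that(3)]] that(1)]) (use that in simp)
  ultimately have "hit q (Suc m) D \<subseteq> {y. phi c (dehom y) \<in> hit q m d}"
    unfolding hit_def[of q "Suc m"] by (intro mp.span_minimal) auto
  then show ?thesis using assms by (auto simp: H_def)
qed

lemma Ord1_mult:
  assumes "x - Con a \<in> Ord 1" "y - Con b \<in> Ord 1"
  shows "x * y - Con (a * b) \<in> (Ord 1 :: 'a mpoly set)"
proof -
  have "(x - Con a) * y + Con a * (y - Con b) \<in> Ord 1"
    using Ord_mult[OF assms(1) Ord_0[of y]] subspace_Con[OF subspace_Ord assms(2)]
    by (intro mp.subspace_add[OF subspace_Ord]) auto
  then show ?thesis by (simp add: algebra_simps mult_single)
qed

lemma Ord1_power: "x - Con a \<in> (Ord 1 :: 'a mpoly set) \<Longrightarrow> x ^ k - Con (a ^ k) \<in> Ord 1"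
proof (induction k)
  case 0
  then show ?case using mp.subspace_0[OF subspace_Ord] by simp
qed (simp only: power_Suc Ord1_mult)

lemma Ord1_prod: "finite I \<Longrightarrow> (\<And>i. i \<in> I \<Longrightarrow> f i - Con (a i) \<in> Ord 1) \<Longrightarrow> prod f I - Con (prod a I) \<in> (Ord 1 :: 'a mpoly set)"
proof (induction I rule: finite_induct)
  case empty
  then show ?case using mp.subspace_0[OF subspace_Ord] by simp
next
  case (insert i I)
  then show ?case unfolding prod.insert[OF insert.hyps] by (intro Ord1_mult) auto
qed

lemma phi_top_gens:
  assumes h: "h \<in> Sym m d"
  shows "phi c (monom_fun \<beta> * Ls h) = Con ((-1) ^ d * (\<Prod>i<m. c i ^ \<beta> i)) * h"
proof -
  interpret s: comm_ring_hom "shift c" by (rule comm_ring_hom_shift)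
  define a where "a = (\<Prod>i<m. c i ^ \<beta> i)"
  have 1: "shift c (monom_fun \<beta>) - Con a \<in> Ord 1"
    unfolding monom_fun_def s.homs a_def
  proof (intro Ord1_prod Ord1_power)
    fix i assume "i \<in> {..<m}"
    then show "shift c (Var i) - Con (c i) \<in> Ord 1"
      using Var_Sym[of i m] Sym_Ord[of 1 1 m] by (auto simp: shift_def)
  qed simp
  \<comment> \<open>With L = -x + x^q, the lowest form of h(L) is (-1)^d h; the other terms are
    multiples of P^g h and lie in degree d + (q - 1) g.\<close>
  have "Ls h = ev Con (\<lambda>i. (-1) * Var i + 1 * Var i ^ q) h"
    by (simp add: Ls_def L_def[abs_def])
  also have "\<dots> = (\<Sum>g\<le>d. (-1) ^ (d - g) * 1 ^ g * polar Con g Var (\<lambda>i. Var i ^ q) h)"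
    by (rule ev_combination) (use h in \<open>auto simp: Sym_def\<close>)
  also have "\<dots> = (\<Sum>g\<le>d. Con ((-1) ^ (d - g)) * steenrod q g h)"
    by (simp add: steenrod_eq_polar[OF q0] Con.homs single_uminus)
  also have "\<dots> = Con ((-1) ^ d) * h + (\<Sum>g\<in>{..d} - {0}. Con ((-1) ^ (d - g)) * steenrod q g h)"
    by (subst sum.remove[of _ 0]) (auto simp: steenrod_0_left[OF q0])
  finally have Lh: "Ls h - Con ((-1) ^ d) * h = (\<Sum>g\<in>{..d} - {0}. Con ((-1) ^ (d - g)) * steenrod q g h)"
    by simp
  have 2: "Ls h - Con ((-1) ^ d) * h \<in> Ord (Suc d)"
    unfolding Lh
  proof (intro mp.subspace_sum[OF subspace_Ord] subspace_Con[OF subspace_Ord])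
    fix g assume "g \<in> {..d} - {0}"
    then have "1 \<le> (q - 1) * g" using q2 by simp
    then have "Suc d \<le> d + (q - 1) * g" by simp
    then show "steenrod q g h \<in> Ord (Suc d)"
      using steenrod_Sym[OF q0 h, of g] Sym_Ord[of "Suc d" "d + (q - 1) * g" m] by auto
  qed
  have "shift c (Ls h) = Ls h"
    unfolding Ls_def hom_ev[OF comm_ring_hom_shift] shift_Con shift_L ..
  then have "shift c (monom_fun \<beta> * Ls h) = shift c (monom_fun \<beta>) * Ls h" by (simp add: s.homs)
  also have "\<dots> = Con a * (Con ((-1) ^ d) * h) +
      ((shift c (monom_fun \<beta>) - Con a) * (Con ((-1) ^ d) * h) + shift c (monom_fun \<beta>) * (Ls h - Con ((-1) ^ d) * h))"
    by (simp add: algebra_simps)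
  finally have e: "shift c (monom_fun \<beta> * Ls h) = Con a * (Con ((-1) ^ d) * h) +
      ((shift c (monom_fun \<beta>) - Con a) * (Con ((-1) ^ d) * h) + shift c (monom_fun \<beta>) * (Ls h - Con ((-1) ^ d) * h))" .
  have "Con ((-1) ^ d) * h \<in> Ord d"
    using subspace_Con[OF subspace_Ord subsetD[OF Sym_Ord h]] by simp
  then have "(shift c (monom_fun \<beta>) - Con a) * (Con ((-1) ^ d) * h) + shift c (monom_fun \<beta>) * (Ls h - Con ((-1) ^ d) * h) \<in> Ord (Suc d)"
    using Ord_mult[OF 1, of _ d] Ord_mult[OF Ord_0 2] by (intro mp.subspace_add[OF subspace_Ord]) auto
  from hpart_Ord[OF this lessI] have "hpart d (shift c (monom_fun \<beta> * Ls h)) = hpart d (Con a * (Con ((-1) ^ d) * h))"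
    unfolding e by (subst hpart_add) simp
  then have "hpart d (shift c (monom_fun \<beta> * Ls h)) = Con a * (Con ((-1) ^ d) * h)"
    by (simp only: hpart_Con_mult hpart_Sym[OF h])
  then show ?thesis by (simp add: phi_def a_def mult_single mult.commute flip: mult.assoc)
qed

end

section \<open>Monomial functions on a finite vector space\<close>

lemma sum_PiE_Suc:
  fixes B :: "nat set" and G :: "(nat \<Rightarrow> nat) \<Rightarrow> 'b::comm_monoid_add"
  shows "(\<Sum>\<beta>\<in>(\<Pi>\<^sub>E i\<in>{..<Suc m}. B). G \<beta>) = (\<Sum>b\<in>B. \<Sum>g\<in>(\<Pi>\<^sub>E i\<in>{..<m}. B). G (g(m := b)))"
proof -
  have "{..<Suc m} = insert m {..<m}" by auto
  then have "(\<Pi>\<^sub>E i\<in>{..<Suc m}. B) = (\<lambda>(b, g). g(m := b)) ` (B \<times> (\<Pi>\<^sub>E i\<in>{..<m}. B))"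
    by (simp add: PiE_insert_eq)
  moreover have "inj_on (\<lambda>(b, g). g(m := b)) (B \<times> (\<Pi>\<^sub>E i\<in>{..<m}. B))"
    by (rule inj_combinator) simp
  ultimately show ?thesis
    by (simp add: sum.reindex sum.cartesian_product case_prod_unfold)
qed

lemma poly_coeffs_eq_0:
  fixes a :: "nat \<Rightarrow> 'a::{field,finite}"
  assumes "\<And>y. (\<Sum>b<CARD('a). a b * y ^ b) = 0" "b < CARD('a)"
  shows "a b = 0"
proof -
  define f where "f = (\<Sum>b<CARD('a). monom (a b) b)"
  have "poly f y = 0" for y using assms(1)[of y] by (simp add: f_def poly_sum poly_monom)
  then have all: "{x. poly f x = 0} = UNIV" by auto
  have "f = 0"
  proof (rule ccontr)
    assume "f \<noteq> 0"
    then have "CARD('a) \<le> degree f" using card_poly_roots_bound[of f] all by simp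
    moreover have "degree f \<le> CARD('a) - 1"
      unfolding f_def by (rule degree_sum_le) (auto intro: order_trans[OF degree_monom_le])
    ultimately show False using CARD_field_ge_2[where 'a='a] by linarith
  qed
  then have "coeff f b = 0" by simp
  then show ?thesis using assms(2) by (simp add: f_def coeff_sum)
qed

text \<open>With the first m coordinates fixed, the sum is a polynomial of degree below q in the
  last coordinate and vanishes at all q points; so each of its coefficients vanishes, and induction
  applies to them.\<close>

lemma monomial_functions_independent:
  fixes f :: "(nat \<Rightarrow> nat) \<Rightarrow> 'a::{field,finite}"
  assumes "\<And>c :: nat \<Rightarrow> 'a. (\<Sum>\<beta>\<in>(\<Pi>\<^sub>E i\<in>{..<m}. {..<CARD('a)}). f \<beta> * (\<Prod>i<m. c i ^ \<beta> i)) = 0"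
    and "\<beta> \<in> (\<Pi>\<^sub>E i\<in>{..<m}. {..<CARD('a)})"
  shows "f \<beta> = 0"
  using assms
proof (induction m arbitrary: f \<beta>)
  case (Suc m)
  let ?P = "\<Pi>\<^sub>E i\<in>{..<m}. {..<CARD('a)}"
  have split: "(\<Sum>b<CARD('a). (\<Sum>g\<in>?P. f (g(m := b)) * (\<Prod>i<m. c i ^ g i)) * y ^ b) = 0" for c :: "nat \<Rightarrow> 'a" and y
  proof -
    have e: "(\<Prod>i<Suc m. (c(m := y)) i ^ (g(m := b)) i) = (\<Prod>i<m. c i ^ g i) * y ^ b" for g b
      by simp
    have "(\<Sum>\<beta>\<in>(\<Pi>\<^sub>E i\<in>{..<Suc m}. {..<CARD('a)}). f \<beta> * (\<Prod>i<Suc m. (c(m := y)) i ^ \<beta> i)) = 0"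
      by (rule Suc.prems)
    then show ?thesis unfolding sum_PiE_Suc e by (simp add: sum_distrib_right mult.assoc)
  qed
  have z: "(\<Sum>g\<in>?P. f (g(m := b)) * (\<Prod>i<m. c i ^ g i)) = 0" if "b < CARD('a)" for b and c :: "nat \<Rightarrow> 'a"
    by (rule poly_coeffs_eq_0[OF split that])
  \<comment> \<open>Resetting the value at m to \<open>undefined\<close> makes the exponent vector
    extensional on the first m coordinates.\<close>
  have "(\<lambda>g. f (g(m := \<beta> m))) (\<beta>(m := undefined)) = 0"
  proof (rule Suc.IH[of "\<lambda>g. f (g(m := \<beta> m))" "\<beta>(m := undefined)"])
    show "(\<Sum>g\<in>?P. f (g(m := \<beta> m)) * (\<Prod>i<m. c i ^ g i)) = 0" for c :: "nat \<Rightarrow> 'a"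
      by (rule z) (use Suc.prems(2) in auto)
    show "\<beta>(m := undefined) \<in> ?P"
      using Suc.prems(2) by (auto simp: PiE_def Pi_def extensional_def)
  qed
  then show ?case by simp
qed auto

section \<open>Complements of the hits\<close>

text \<open>A lifted basis of the quotient by hits, kept as an indexed family so that its size N is
  explicit and no quotient space is formed.\<close>

definition hit_complement :: "nat \<Rightarrow> nat \<Rightarrow> nat \<Rightarrow> (nat \<Rightarrow> 'a::field mpoly) \<Rightarrow> nat \<Rightarrow> bool" where
  "hit_complement q n e b N \<longleftrightarrow> (\<forall>i<N. b i \<in> Sym n e)
    \<and> (\<forall>f. (\<Sum>i<N. Con (f i) * b i) \<in> hit q n e \<longrightarrow> (\<forall>i<N. f i = 0))
    \<and> (\<forall>p\<in>Sym n e. \<exists>f. p - (\<Sum>i<N. Con (f i) * b i) \<in> hit q n e)"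

context hit_step
begin

section \<open>The induction step from m to m + 1 variables\<close>

definition Box :: "(nat \<Rightarrow> nat) set" where
  "Box = {\<beta> \<in> (\<Pi>\<^sub>E i\<in>{..<m}. {..<q}). exp_sum \<beta> + q * d \<le> D}"

lemma finite_Box: "finite Box"
  unfolding Box_def by (rule finite_subset[of _ "\<Pi>\<^sub>E i\<in>{..<m}. {..<q}"]) (auto intro: finite_PiE)

lemma card_Box: "card Box = q ^ m - 1"
proof -
  let ?P = "\<Pi>\<^sub>E i\<in>{..<m}. {..<q}"
  let ?t = "restrict (\<lambda>_. q - 1) {..<m}"
  have fin: "finite ?P" by (intro finite_PiE) auto
  \<comment> \<open>The total degree belonging to the constant exponent q - 1: one more than is
    allowed.\<close>
  have top: "q * d + (q - 1) * m = D + 1"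
  proof -
    have "q * d = (q - 1) * d + d" using q0 by (cases q) auto
    moreover have "(q - 1) * Q = (q - 1) * d + (q - 1) * m" by (simp only: d_plus_m[symmetric] add_mult_distrib2)
    ultimately show ?thesis using D_d by linarith
  qed
  have "exp_sum \<beta> + q * d \<le> D \<longleftrightarrow> \<beta> \<noteq> ?t" if b: "\<beta> \<in> ?P" for \<beta>
  proof
    assume "exp_sum \<beta> + q * d \<le> D"
    moreover have "exp_sum ?t = (q - 1) * m" by (simp add: exp_sum_def mult.commute)
    ultimately show "\<beta> \<noteq> ?t" using top by auto
  next
    assume "\<beta> \<noteq> ?t"
    then obtain i where i: "i < m" "\<beta> i \<noteq> q - 1"
      using b by (auto simp: fun_eq_iff PiE_def extensional_def split: if_splits)
    moreover have "\<beta> k \<le> q - 1" if "k < m" for k using b that by (fastforce simp: PiE_def Pi_def)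
    ultimately have "exp_sum \<beta> < (\<Sum>i<m. q - 1)"
      unfolding exp_sum_def by (intro sum_strict_mono_ex1) (auto intro!: bexI[of _ i] simp: le_neq_implies_less)
    then have "exp_sum \<beta> < (q - 1) * m" by (simp add: mult.commute)
    then show "exp_sum \<beta> + q * d \<le> D" using top by linarith
  qed
  then have "Box = ?P - {?t}" by (auto simp: Box_def)
  moreover have "?t \<in> ?P" using q0 by auto
  ultimately show ?thesis using fin by (simp add: card_PiE)
qed

lemma sum_Box_eq_0:
  assumes z: "\<And>c. (\<Sum>\<beta>\<in>Box. f \<beta> * (\<Prod>i<m. c i ^ \<beta> i)) = (0 :: 'a)" and \<beta>: "\<beta> \<in> Box"
  shows "f \<beta> = 0"
proof -
  let ?P = "\<Pi>\<^sub>E i\<in>{..<m}. {..<CARD('a)}"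
  let ?f = "\<lambda>\<beta>. if \<beta> \<in> Box then f \<beta> else 0"
  have sub: "Box \<subseteq> ?P" unfolding Box_def q[symmetric] by auto
  have "?f \<beta> = 0"
  proof (rule monomial_functions_independent[where m = m and f = ?f and \<beta> = \<beta>])
    fix c :: "nat \<Rightarrow> 'a"
    have "(\<Sum>\<beta>\<in>?P. ?f \<beta> * (\<Prod>i<m. c i ^ \<beta> i)) = (\<Sum>\<beta>\<in>Box. ?f \<beta> * (\<Prod>i<m. c i ^ \<beta> i))"
      by (rule sum.mono_neutral_right) (use sub in \<open>auto intro: finite_PiE\<close>)
    also have "\<dots> = 0" using z[of c] by simp
    finally show "(\<Sum>\<beta>\<in>?P. ?f \<beta> * (\<Prod>i<m. c i ^ \<beta> i)) = 0" .
    show "\<beta> \<in> ?P" using \<beta> sub by auto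
  qed
  then show ?thesis using \<beta> by simp
qed

context
  fixes b :: "nat \<Rightarrow> 'a mpoly" and N :: nat
  assumes b: "hit_complement q m d b N"
begin

definition next_basis :: "(nat \<Rightarrow> nat) \<times> nat \<Rightarrow> 'a mpoly" where
  "next_basis x = monom_fun (fst x) * Ls (b (snd x))"

lemma b_Sym: "i < N \<Longrightarrow> b i \<in> Sym m d"
  using b by (simp add: hit_complement_def)

lemma next_basis_Pol: "x \<in> Box \<times> {..<N} \<Longrightarrow> next_basis x \<in> Pol m D"
  unfolding next_basis_def by (rule monom_fun_Ls_Pol[OF b_Sym]) (simp_all add: mem_Times_iff Box_def)

text \<open>Applying \<open>phi c\<close> gives a relation modulo hits among the b_i whose
  coefficients are reduced polynomial functions of c. They vanish for every c, so their own
  coefficients do.\<close>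

lemma next_basis_independent:
  assumes "(\<Sum>x\<in>Box \<times> {..<N}. Con (f x) * next_basis x) \<in> H" "x \<in> Box \<times> {..<N}"
  shows "f x = 0"
proof -
  obtain \<beta> i where x: "x = (\<beta>, i)" "\<beta> \<in> Box" "i < N" using assms(2) by auto
  have "(\<Sum>\<beta>\<in>Box. f (\<beta>, i) * (\<Prod>k<m. c k ^ \<beta> k)) = 0" for c
  proof -
    let ?g = "\<lambda>i. \<Sum>\<beta>\<in>Box. f (\<beta>, i) * ((-1) ^ d * (\<Prod>k<m. c k ^ \<beta> k))"
    have "phi c (\<Sum>x\<in>Box \<times> {..<N}. Con (f x) * next_basis x) =
        (\<Sum>x\<in>Box \<times> {..<N}. Con (f x * ((-1) ^ d * (\<Prod>k<m. c k ^ fst x k))) * b (snd x))"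
      unfolding phi_sum phi_Con next_basis_def
    proof (intro sum.cong refl)
      fix x assume "x \<in> Box \<times> {..<N}"
      then have "phi c (monom_fun (fst x) * Ls (b (snd x))) = Con ((-1) ^ d * (\<Prod>k<m. c k ^ fst x k)) * b (snd x)"
        by (intro phi_top_gens b_Sym) auto
      then show "Con (f x) * phi c (monom_fun (fst x) * Ls (b (snd x))) = Con (f x * ((-1) ^ d * (\<Prod>k<m. c k ^ fst x k))) * b (snd x)"
        by (simp only: Con.hom_mult[of "f x"] mult.assoc)
    qed
    also have "\<dots> = (\<Sum>i<N. \<Sum>\<beta>\<in>Box. Con (f (\<beta>, i) * ((-1) ^ d * (\<Prod>k<m. c k ^ \<beta> k))) * b i)"
      by (subst sum.swap) (simp add: sum.cartesian_product case_prod_unfold)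
    also have "\<dots> = (\<Sum>i<N. Con (?g i) * b i)"
      by (simp only: Con.hom_sum sum_distrib_right)
    finally have "(\<Sum>i<N. Con (?g i) * b i) \<in> hit q m d"
      using phi_H[OF assms(1), of c] by simp
    moreover have "\<forall>f. (\<Sum>i<N. Con (f i) * b i) \<in> hit q m d \<longrightarrow> (\<forall>i<N. f i = 0)"
      using b by (simp add: hit_complement_def)
    ultimately have "?g i = 0" using x(3) by (elim allE[of _ ?g]) simp
    then have "(-1) ^ d * (\<Sum>\<beta>\<in>Box. f (\<beta>, i) * (\<Prod>k<m. c k ^ \<beta> k)) = 0"
      by (simp only: sum_distrib_left mult.left_commute)
    then show ?thesis by simp
  qed
  then have "(\<lambda>\<beta>. f (\<beta>, i)) \<beta> = 0" by (rule sum_Box_eq_0) (rule x(2))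
  then show ?thesis by (simp add: x(1))
qed

text \<open>For a generator x^\<beta> h(L), expand h along b modulo hits; the error term x^\<beta>
  (hit)(L) is absorbed by \<open>top_gens_hit\<close>.\<close>

lemma next_basis_spanning:
  assumes "p \<in> Pol m D"
  shows "\<exists>f. p - (\<Sum>x\<in>Box \<times> {..<N}. Con (f x) * next_basis x) \<in> H"
proof -
  let ?Y = "{p. \<exists>f. p - (\<Sum>x\<in>Box \<times> {..<N}. Con (f x) * next_basis x) \<in> H}"
  have "mp.subspace ?Y"
  proof (rule subspaceI)
    show "0 \<in> ?Y" using H_0 by (auto intro!: exI[of _ "\<lambda>_. 0"])
    fix x y assume "x \<in> ?Y" "y \<in> ?Y"
    then obtain f g where "x - (\<Sum>x\<in>Box \<times> {..<N}. Con (f x) * next_basis x) \<in> H" "y - (\<Sum>x\<in>Box \<times> {..<N}. Con (g x) * next_basis x) \<in> H"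
      by auto
    from H_add[OF this] show "x + y \<in> ?Y"
      by (auto intro!: exI[of _ "\<lambda>x. f x + g x"] simp: Con.hom_add distrib_right sum.distrib add_diff_add)
  next
    fix c x assume "x \<in> ?Y"
    then obtain f where "x - (\<Sum>x\<in>Box \<times> {..<N}. Con (f x) * next_basis x) \<in> H" by auto
    from H_Con[OF this, of c] show "Con c * x \<in> ?Y"
      by (auto intro!: exI[of _ "\<lambda>x. c * f x"] simp: Con.hom_mult right_diff_distrib sum_distrib_left mult.assoc)
  qed
  moreover have "H \<subseteq> ?Y" by (auto intro!: exI[of _ "\<lambda>_. 0"])
  moreover have "top_gens \<subseteq> ?Y"
  proof
    fix x assume "x \<in> top_gens"
    then obtain \<beta> h where x: "x = monom_fun \<beta> * Ls h" "\<forall>i<m. \<beta> i < q" "h \<in> Sym m d" "exp_sum \<beta> + q * d \<le> D"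
      by (auto simp: top_gens_def)
    obtain f where f: "h - (\<Sum>i<N. Con (f i) * b i) \<in> hit q m d"
      using b x(3) unfolding hit_complement_def by blast
    \<comment> \<open>\<open>Box\<close> contains extensional exponents only; restricting changes
      neither the monomial nor its degree.\<close>
    define \<beta>' where "\<beta>' = restrict \<beta> {..<m}"
    have \<beta>': "monom_fun \<beta>' = monom_fun \<beta>" "exp_sum \<beta>' = exp_sum \<beta>"
      by (auto simp: \<beta>'_def exp_sum_def intro: monom_fun_cong)
    have B: "\<beta>' \<in> Box" using x \<beta>' by (auto simp: Box_def \<beta>'_def)
    let ?g = "\<lambda>x. if fst x = \<beta>' then f (snd x) else 0"
    have "(\<Sum>x\<in>Box \<times> {..<N}. Con (?g x) * next_basis x) = (\<Sum>\<gamma>\<in>Box. \<Sum>i<N. Con (?g (\<gamma>, i)) * next_basis (\<gamma>, i))"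
      unfolding sum.cartesian_product by (intro sum.cong refl) auto
    also have "\<dots> = (\<Sum>\<gamma>\<in>{\<beta>'}. \<Sum>i<N. Con (?g (\<gamma>, i)) * next_basis (\<gamma>, i))"
      by (rule sum.mono_neutral_right) (use B finite_Box in auto)
    also have "\<dots> = (\<Sum>i<N. Con (f i) * (monom_fun \<beta> * Ls (b i)))"
      by (simp add: next_basis_def \<beta>')
    also have "\<dots> = monom_fun \<beta> * Ls (\<Sum>i<N. Con (f i) * b i)"
    proof -
      have "Ls (Con a) = Con a" for a by (simp add: Ls_def)
      then show ?thesis by (simp only: Ls.hom_sum Ls.hom_mult sum_distrib_left mult.left_commute)
    qed
    finally have "x - (\<Sum>x\<in>Box \<times> {..<N}. Con (?g x) * next_basis x) = monom_fun \<beta> * Ls (h - (\<Sum>i<N. Con (f i) * b i))"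
      by (simp only: x(1) Ls.hom_diff right_diff_distrib)
    also have "\<dots> \<in> H" by (rule top_gens_hit[OF x(2,4) f])
    finally show "x \<in> ?Y" by (intro CollectI exI[of _ ?g])
  qed
  ultimately have "mp.span (H \<union> top_gens) \<subseteq> ?Y" by (intro mp.span_minimal) auto
  then show ?thesis using Pol_subset_span assms by blast
qed

lemma hit_complement_step: "\<exists>b' :: nat \<Rightarrow> 'a mpoly. hit_complement q (Suc m) D b' ((q ^ m - 1) * N)"
proof -
  let ?I = "Box \<times> {..<N}"
  have fin: "finite ?I" using finite_Box by simp
  have card: "card ?I = (q ^ m - 1) * N" by (simp add: card_cartesian_product card_Box)
  obtain e where "bij_betw e {0..<card ?I} ?I" using ex_bij_betw_nat_finite[OF fin] by blast
  then have e: "bij_betw e {..<(q ^ m - 1) * N} ?I" unfolding card by (simp add: atLeast0LessThan)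
  let ?K = "(q ^ m - 1) * N"
  let ?b' = "\<lambda>k. hmg D (next_basis (e k))"
  have eI: "e k \<in> ?I" if "k < ?K" for k using e that by (auto simp: bij_betw_def)
  have b'S: "?b' k \<in> Sym (Suc m) D" if "k < ?K" for k
    by (rule hmg_Sym[OF next_basis_Pol[OF eI[OF that]]])
  have reindex: "(\<Sum>k<?K. Con (f (e k)) * next_basis (e k)) = (\<Sum>x\<in>?I. Con (f x) * next_basis x)" for f
    by (rule sum.reindex_bij_betw[OF e])
  have dh: "dehom (\<Sum>k<?K. Con (g k) * ?b' k) = (\<Sum>k<?K. Con (g k) * next_basis (e k))" for g
    unfolding dehom.homs by (intro sum.cong refl) (use dehom_hmg[OF next_basis_Pol[OF eI]] in auto)
  have "hit_complement q (Suc m) D ?b' ?K"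
    unfolding hit_complement_def
  proof (intro conjI allI impI ballI)
    show "?b' k \<in> Sym (Suc m) D" if "k < ?K" for k by (rule b'S[OF that])
  next
    fix f k assume f: "(\<Sum>k<?K. Con (f k) * ?b' k) \<in> hit q (Suc m) D" and k: "k < ?K"
    define g where "g x = f (the_inv_into {..<?K} e x)" for x
    have inj: "inj_on e {..<?K}" using e by (simp add: bij_betw_def)
    have g: "g (e k) = f k" if "k < ?K" for k
      unfolding g_def using the_inv_into_f_f[OF inj, of k] that by (simp only: lessThan_iff)
    have "(\<Sum>x\<in>?I. Con (g x) * next_basis x) = (\<Sum>k<?K. Con (f k) * next_basis (e k))"
      by (subst reindex[symmetric]) (auto simp: g)
    also have "\<dots> = dehom (\<Sum>k<?K. Con (f k) * ?b' k)" by (rule dh[symmetric])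
    also have "\<dots> \<in> H" using f by (auto simp: H_def)
    finally have "g (e k) = 0" by (rule next_basis_independent) (rule eI[OF k])
    then show "f k = 0" by (simp only: g[OF k])
  next
    fix p :: "'a mpoly" assume p: "p \<in> Sym (Suc m) D"
    obtain g where "dehom p - (\<Sum>x\<in>?I. Con (g x) * next_basis x) \<in> H"
      using next_basis_spanning[OF dehom_Pol[OF p]] by blast
    then obtain y where y: "y \<in> hit q (Suc m) D" "dehom p - (\<Sum>k<?K. Con (g (e k)) * next_basis (e k)) = dehom y"
      unfolding reindex by (auto simp: H_def)
    let ?r = "p - (\<Sum>k<?K. Con (g (e k)) * ?b' k)"
    have rS: "?r \<in> Sym (Suc m) D"
      by (intro mp.subspace_diff[OF subspace_Sym] mp.subspace_sum[OF subspace_Sym] subspace_Con[OF subspace_Sym] p)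
        (use b'S in auto)
    have "dehom ?r = dehom y" unfolding dehom.hom_diff dh by (rule y(2))
    \<comment> \<open>Homogenising recovers a form of degree D, so equality after dehomogenising
      lifts and membership in \<open>hit\<close> follows.\<close>
    then have "hmg D (dehom ?r) = hmg D (dehom y)" by (rule arg_cong)
    then have "?r = y"
      unfolding hmg_dehom[OF rS] hmg_dehom[OF subsetD[OF hit_subset_Sym y(1)]] .
    then show "\<exists>f. p - (\<Sum>k<?K. Con (f k) * ?b' k) \<in> hit q (Suc m) D"
      using y(1) by (intro exI[of _ "\<lambda>k. g (e k)"]) (simp only:)
  qed
  then show ?thesis by - (rule exI[of _ ?b'])
qed

end

end

section \<open>From complements of the hits to dimensions\<close>

lemma finite_monomials: "finite {k :: nat \<Rightarrow>\<^sub>0 nat. Poly_Mapping.keys k \<subseteq> {..<n} \<and> mdeg k = e}"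
proof (rule finite_subset)
  let ?f = "\<lambda>\<gamma>. \<Sum>i<n. Poly_Mapping.single i (\<gamma> i :: nat)"
  show "finite (?f ` (\<Pi>\<^sub>E i\<in>{..<n}. {..e}))" by (intro finite_imageI finite_PiE) auto
  show "{k. Poly_Mapping.keys k \<subseteq> {..<n} \<and> mdeg k = e} \<subseteq> ?f ` (\<Pi>\<^sub>E i\<in>{..<n}. {..e})"
  proof
    fix k assume "k \<in> {k. Poly_Mapping.keys k \<subseteq> {..<n} \<and> mdeg k = e}"
    then have k: "Poly_Mapping.keys k \<subseteq> {..<n}" "mdeg k = e" by auto
    have "Poly_Mapping.lookup k i \<le> e" if "i < n" for i
      unfolding k(2)[symmetric] mdeg_superset[OF finite_lessThan k(1)] using that by (intro member_le_sum) auto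
    then have "restrict (Poly_Mapping.lookup k) {..<n} \<in> (\<Pi>\<^sub>E i\<in>{..<n}. {..e})" by auto
    moreover have "k = ?f (restrict (Poly_Mapping.lookup k) {..<n})"
    proof (rule poly_mapping_eqI)
      fix i
      have "Poly_Mapping.lookup k i = 0" if "\<not> i < n" using k(1) that by (auto simp: in_keys_iff)
      then show "Poly_Mapping.lookup k i = Poly_Mapping.lookup (?f (restrict (Poly_Mapping.lookup k) {..<n})) i"
        by (auto simp: lookup_sum lookup_single when_def)
    qed
    ultimately show "k \<in> ?f ` (\<Pi>\<^sub>E i\<in>{..<n}. {..e})" by blast
  qed
qed

lemma Sym_finitely_spanned:
  obtains S :: "'a::field mpoly set" where "finite S" "Sym n e \<subseteq> mp.span S"
proof
  let ?S = "(\<lambda>k. Poly_Mapping.single k (1::'a)) ` {k. Poly_Mapping.keys k \<subseteq> {..<n} \<and> mdeg k = e}"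
  show "finite ?S" using finite_monomials by simp
  show "Sym n e \<subseteq> mp.span ?S"
  proof
    fix p :: "'a mpoly" assume p: "p \<in> Sym n e"
    have "(\<Sum>k\<in>Poly_Mapping.keys p. pscale (Poly_Mapping.lookup p k) (Poly_Mapping.single k 1)) \<in> mp.span ?S"
      using p by (intro mp.span_sum mp.span_scale mp.span_base) (auto simp: Sym_def)
    then show "p \<in> mp.span ?S"
      by (simp add: pscale_eq mult_single flip: mpoly_eq_sum_single)
  qed
qed

text \<open>The b_i are adjoined one at a time to a basis of the hits. The additive form ensures
  that the truncated difference in \<open>dimQ\<close> is a true one.\<close>

lemma dim_Sym_eq:
  fixes b :: "nat \<Rightarrow> 'a::field mpoly"
  assumes b: "hit_complement q n e b N" and sub: "hit q n e \<subseteq> (Sym n e :: 'a mpoly set)"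
  shows "mp.dim (Sym n e :: 'a mpoly set) = mp.dim (hit q n e :: 'a mpoly set) + N"
proof -
  have sh: "mp.subspace (hit q n e :: 'a mpoly set)" unfolding hit_def by (rule mp.subspace_span)
  obtain B :: "'a mpoly set" where B: "B \<subseteq> hit q n e" "mp.independent B" "hit q n e \<subseteq> mp.span B" "card B = mp.dim (hit q n e :: 'a mpoly set)"
    by (rule mp.basis_exists[of "hit q n e :: 'a mpoly set"]) (rule that, assumption+)
  obtain S :: "'a mpoly set" where S: "finite S" "Sym n e \<subseteq> mp.span S" by (rule Sym_finitely_spanned)
  have finB: "finite B" using mp.independent_span_bound[OF S(1) B(2)] B(1) sub S(2) by blast
  have rep: "\<exists>f. x - (\<Sum>i<k. Con (f i) * b i) \<in> hit q n e" if "x \<in> mp.span (B \<union> b ` {..<k})" for x k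
  proof -
    let ?Y = "{x. \<exists>f. x - (\<Sum>i<k. Con (f i) * b i) \<in> hit q n e}"
    have "mp.subspace ?Y"
    proof (rule subspaceI)
      show "0 \<in> ?Y" using mp.subspace_0[OF sh] by (auto intro!: exI[of _ "\<lambda>_. 0"])
      fix x y assume "x \<in> ?Y" "y \<in> ?Y"
      then obtain f g where "x - (\<Sum>i<k. Con (f i) * b i) \<in> hit q n e" "y - (\<Sum>i<k. Con (g i) * b i) \<in> hit q n e" by auto
      from mp.subspace_add[OF sh this] show "x + y \<in> ?Y"
        by (auto intro!: exI[of _ "\<lambda>x. f x + g x"] simp: Con.hom_add distrib_right sum.distrib add_diff_add)
    next
      fix c x assume "x \<in> ?Y"
      then obtain f where "x - (\<Sum>i<k. Con (f i) * b i) \<in> hit q n e" by auto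
      from subspace_Con[OF sh this, of c] show "Con c * x \<in> ?Y"
        by (auto intro!: exI[of _ "\<lambda>x. c * f x"] simp: Con.hom_mult right_diff_distrib sum_distrib_left mult.assoc)
    qed
    moreover have "B \<subseteq> ?Y" using B(1) by (auto intro!: exI[of _ "\<lambda>_. 0"])
    moreover have "b ` {..<k} \<subseteq> ?Y"
    proof safe
      fix i assume "i < k"
      have "(\<Sum>j<k. Con (if j = i then 1 else 0) * b j) = (\<Sum>j\<in>{i}. Con (if j = i then 1 else 0) * b j)"
        by (rule sum.mono_neutral_right) (use \<open>i < k\<close> in auto)
      then show "\<exists>f. b i - (\<Sum>j<k. Con (f j) * b j) \<in> hit q n e"
        using mp.subspace_0[OF sh] by (intro exI[of _ "\<lambda>j. if j = i then 1 else 0"]) simp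
    qed
    ultimately have "mp.span (B \<union> b ` {..<k}) \<subseteq> ?Y" by (intro mp.span_minimal) auto
    then show ?thesis using that by blast
  qed
  have notin: "b k \<notin> mp.span (B \<union> b ` {..<k})" if k: "k < N" for k
  proof
    assume "b k \<in> mp.span (B \<union> b ` {..<k})"
    then obtain f where f: "b k - (\<Sum>i<k. Con (f i) * b i) \<in> hit q n e" using rep by blast
    \<comment> \<open>The supposed dependence, normalised to coefficient 1 at k and padded with
      zeros up to N, contradicts independence modulo hits.\<close>
    define g where "g i = (if i < k then - f i else if i = k then 1 else 0)" for i
    have "(\<Sum>i<N. Con (g i) * b i) = (\<Sum>i<Suc k. Con (g i) * b i)"
      by (rule sum.mono_neutral_right) (use k in \<open>auto simp: g_def\<close>)
    also have "\<dots> = b k - (\<Sum>i<k. Con (f i) * b i)"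
      by (simp add: g_def Con.hom_uminus sum_negf)
    finally have "g k = 0" using f b k unfolding hit_complement_def by auto
    then show False by (simp add: g_def)
  qed
  have "mp.independent (B \<union> b ` {..<k}) \<and> card (B \<union> b ` {..<k}) = card B + k" if "k \<le> N" for k
    using that
  proof (induction k)
    case (Suc k)
    have e: "B \<union> b ` {..<Suc k} = insert (b k) (B \<union> b ` {..<k})" by (auto simp: lessThan_Suc)
    have n: "b k \<notin> mp.span (B \<union> b ` {..<k})" using notin Suc.prems by simp
    have "b k \<notin> B \<union> b ` {..<k}"
    proof
      assume "b k \<in> B \<union> b ` {..<k}"
      from mp.span_base[OF this] show False using n by contradiction
    qed
    moreover have "finite (B \<union> b ` {..<k})" using finB by simp
    ultimately have "card (insert (b k) (B \<union> b ` {..<k})) = Suc (card (B \<union> b ` {..<k}))"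
      by (rule card_insert_disjoint[rotated])
    moreover have IH: "mp.independent (B \<union> b ` {..<k})" "card (B \<union> b ` {..<k}) = card B + k"
      using Suc by simp_all
    moreover have "mp.independent (insert (b k) (B \<union> b ` {..<k}))"
      by (rule mp.independent_insertI[OF n IH(1)])
    ultimately show ?case unfolding e by (intro conjI) (simp_all only: add_Suc_right not_False_eq_True)
  qed (use B in simp)
  then have C: "mp.independent (B \<union> b ` {..<N})" "card (B \<union> b ` {..<N}) = card B + N" by auto
  have s1: "B \<union> b ` {..<N} \<subseteq> Sym n e"
    using B(1) sub b by (auto simp: hit_complement_def)
  have s2: "Sym n e \<subseteq> mp.span (B \<union> b ` {..<N})"
  proof
    fix p :: "'a mpoly" assume "p \<in> Sym n e"
    then obtain f where f: "p - (\<Sum>i<N. Con (f i) * b i) \<in> hit q n e"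
      using b by (auto simp: hit_complement_def)
    have "mp.span B \<subseteq> mp.span (B \<union> b ` {..<N})" by (rule mp.span_mono) auto
    then have "p - (\<Sum>i<N. Con (f i) * b i) \<in> mp.span (B \<union> b ` {..<N})" using f B(3) by auto
    moreover have "(\<Sum>i<N. Con (f i) * b i) \<in> mp.span (B \<union> b ` {..<N})"
      by (intro mp.span_sum subspace_Con[OF mp.subspace_span] mp.span_base) auto
    ultimately have "(p - (\<Sum>i<N. Con (f i) * b i)) + (\<Sum>i<N. Con (f i) * b i) \<in> mp.span (B \<union> b ` {..<N})"
      by (rule mp.span_add)
    then show "p \<in> mp.span (B \<union> b ` {..<N})" by simp
  qed
  have "mp.dim (Sym n e :: 'a mpoly set) = card (B \<union> b ` {..<N})"
    by (rule mp.dim_unique[OF s1 s2 C(1) refl])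
  then show ?thesis using C(2) B(4) by simp
qed

text \<open>The induction starts at n = 1, where the degree is 0: no operation of positive index
  lands there, the constants form a line, and the empty product is 1.\<close>

lemma hit_complement_exists:
  assumes "n \<ge> 1"
  shows "\<exists>b :: nat \<Rightarrow> 'a::{field,finite} mpoly.
    hit_complement CARD('a) n (CARD('a) ^ (n - 1) - n) b (\<Prod>i\<in>{1..n-1}. CARD('a) ^ i - 1)"
  using assms
proof (induction n rule: nat_induct_at_least)
  case base
  let ?q = "CARD('a)"
  have q2: "?q \<ge> 2" by (rule CARD_field_ge_2)
  have e: "{i. 1 \<le> i \<and> (?q - 1) * i \<le> 0} = {}" using q2 by auto
  have h: "hit ?q 1 0 = ({0} :: 'a mpoly set)"
    by (simp only: hit_def e UN_empty mp.span_empty)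
  have "\<exists>c. p = Con c" if "p \<in> Sym 1 0" for p :: "'a mpoly"
  proof -
    have "k = 0" if "k \<in> Poly_Mapping.keys p" for k
    proof -
      have "Poly_Mapping.keys k \<subseteq> {..<1}" "mdeg k = 0" using \<open>p \<in> Sym 1 0\<close> that by (auto simp: Sym_def)
      then show ?thesis
        by (auto simp: mdeg_superset[of "{..<1}" k] in_keys_iff intro!: poly_mapping_eqI)
    qed
    then have "Poly_Mapping.lookup p k = Poly_Mapping.lookup (Con (Poly_Mapping.lookup p 0)) k" for k
      by (cases "k = 0") (auto simp: lookup_single when_def in_keys_iff)
    then have "p = Con (Poly_Mapping.lookup p 0)" by (rule poly_mapping_eqI)
    then show ?thesis by blast
  qed
  moreover have "c = 0" if "Con c = 0" for c :: 'a
    by (metis that lookup_single_eq lookup_zero)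
  ultimately have "hit_complement ?q 1 0 (\<lambda>_. 1 :: 'a mpoly) 1"
    unfolding hit_complement_def h
  proof (intro conjI allI impI ballI)
    fix p :: "'a mpoly" assume "p \<in> Sym 1 0"
    then obtain c where "p = Con c" using \<open>\<And>p :: 'a mpoly. p \<in> Sym 1 0 \<Longrightarrow> \<exists>c. p = Con c\<close> by blast
    then show "\<exists>f :: nat \<Rightarrow> 'a. p - (\<Sum>i<1. Con (f i) * 1) \<in> {0}" by (intro exI[of _ "\<lambda>_. c"]) simp
  next
    fix f :: "nat \<Rightarrow> 'a" and i :: nat
    assume "(\<Sum>i<1. Con (f i) * (1 :: 'a mpoly)) \<in> {0}" "i < 1"
    then show "f i = 0" using \<open>\<And>c :: 'a. Con c = 0 \<Longrightarrow> c = 0\<close> by simp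
  qed (rule one_Sym)
  then show ?case by auto
next
  case (Suc m)
  interpret hit_step "TYPE('a)" "CARD('a)" m by unfold_locales (use Suc.hyps in auto)
  obtain b :: "nat \<Rightarrow> 'a mpoly" where "hit_complement CARD('a) m d b (\<Prod>i\<in>{1..m-1}. CARD('a) ^ i - 1)"
    using Suc.IH unfolding d_def Q_def by blast
  from hit_complement_step[OF this] obtain b' :: "nat \<Rightarrow> 'a mpoly"
    where "hit_complement CARD('a) (Suc m) D b' ((CARD('a) ^ m - 1) * (\<Prod>i\<in>{1..m-1}. CARD('a) ^ i - 1))"
    by blast
  moreover have "(\<Prod>i\<in>{1..m}. CARD('a) ^ i - 1) = (CARD('a) ^ m - 1) * (\<Prod>i\<in>{1..m-1}. CARD('a) ^ i - 1)"
  proof -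
    have "{1..m} = insert m {1..m-1}" using Suc.hyps by auto
    then show ?thesis using Suc.hyps by simp
  qed
  ultimately show ?case by (auto simp: D_def)
qed

theorem theorem1p4:
  fixes n :: nat
  assumes "n \<ge> 2"
  shows "dimQ TYPE('a::{field,finite}) CARD('a) n (CARD('a) ^ (n - 1) - n)
           = (\<Prod>i\<in>{1..n-1}. CARD('a) ^ i - 1)"
proof -
  let ?e = "CARD('a) ^ (n - 1) - n"
  \<comment> \<open>\<open>hit_subset_Sym\<close> lives in the locale but holds for any number of
    variables, so the instance m = 1 provides it.\<close>
  interpret hit_step "TYPE('a)" "CARD('a)" 1 by unfold_locales auto
  obtain b :: "nat \<Rightarrow> 'a mpoly" where "hit_complement CARD('a) n ?e b (\<Prod>i\<in>{1..n-1}. CARD('a) ^ i - 1)"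
    using hit_complement_exists[of n, where 'a='a] assms by auto
  from dim_Sym_eq[OF this hit_subset_Sym] show ?thesis
    by (simp add: dimQ_def)
qed

end
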